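(* Let $1\le d<D$ be integers, $R_{\min}>0$ and $\mathbf{L}=(L_\perp,L_3,\dots,L_k)$. (a) If $k\ge 4$, there exist a constant $C$ and a threshold $t_{R_{\min},\mathbf{L},d,k}>0$, both depending only on $R_{\min},\mathbf{L},d,k$, such that for every $0\le t\le t_{R_{\min},\mathbf{L},d,k}$ and every $\mathbf{M}\in\mathfrak{C}^k_{R_{\min},\mathbf{L}}$, $$\left|h_{\mathbf{M}}(t)-\frac{t^2}{2R_\ell}\right|\le C t^4 .$$ (b) If $k=3$, there exist a constant $C'$ and a threshold $t_{R_{\min},\mathbf{L},d}>0$, both depending only on $R_{\min},\mathbf{L},d$, such that for every $0\le t\le t_{R_{\min},\mathbf{L},d}$ and every $\mathbf{M}\in\mathfrak{C}^3_{R_{\min},\mathbf{L}}$, $$\left|h_{\mathbf{M}}(t)-\frac{t^2}{2R_\ell}\right|\le C' t^3 .$$ Here $R_\ell=R_\ell(\mathbf{M})$ is the local reach of $\mathbf{M}$ and $h_{\mathbf{M}}$ its convexity defect function.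
   Context: Reach: $R(\mathbf{M})$ is the supremum of all $\delta\ge 0$ such that every point of $\mathbf{R}^D$ at distance less than $\delta$ from $\mathbf{M}$ has a unique nearest point in $\mathbf{M}$. Local reach: $R_\ell(\mathbf{M})=\inf_{p\in\mathbf{M}}1/\|\mathrm{II}_p\|_{\mathrm{op}}$, where $\mathrm{II}_p$ is the second fundamental form of $\mathbf{M}\subseteq\mathbf{R}^D$ at $p$. Class of manifolds: for $d<D$, $k\ge 3$, $R_{\min}>0$ and $\mathbf{L}=(L_\perp,L_3,\dots,L_k)$ (positive numbers), $\mathfrak{C}^k_{R_{\min},\mathbf{L}}$ is the set of $d$-dimensional compact connected submanifolds $\mathbf{M}$ of $\mathbf{R}^D$ such that: (i) $R(\mathbf{M})\ge R_{\min}$; (ii) for all $p\in\mathbf{M}$ there is a local one-to-one parametrization $\psi_p:B_{T_p\mathbf{M}}(0,r)\subseteq T_p\mathbf{M}\to\mathbf{M}$, $v\mapsto p+v+\mathbf{N}_p(v)$, for some $r\ge\frac1{4L_\perp}$, with $\mathbf{N}_p\in C^k(B_{T_p\mathbf{M}}(0,r),\mathbf{R}^D)$, $\mathbf{N}_p(0)=0$, $d_0\mathbf{N}_p=0$, and $\|d_v^2\mathbf{N}_p\|_{\mathrm{op}}\le L_\perp$ for all $\|v\|\le\frac1{4L_\perp}$; (iii) $\|d_v^i\mathbf{N}_p\|_{\mathrm{op}}\le L_i$ for all $3\le i\le k$ and $\|v\|\le\frac1{4L_\perp}$. Convexity defect function: for compact $\sigma\subseteq\mathbf{R}^D$, $\mathrm{Rad}(\sigma)$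 is the radius of the smallest closed ball containing $\sigma$ and $\mathrm{Hull}(\sigma)$ is its convex hull. For compact $\mathbf{X}\subseteq\mathbf{R}^D$ and $t\ge 0$, $\mathrm{Hull}(\mathbf{X},t)=\bigcup_{\sigma\subseteq\mathbf{X},\ \mathrm{Rad}(\sigma)\le t}\mathrm{Hull}(\sigma)$ (union over nonempty compact $\sigma$), and $h_{\mathbf{X}}(t)=\sup_{y\in\mathrm{Hull}(\mathbf{X},t)}d(y,\mathbf{X})$, which is the Hausdorff distance between $\mathrm{Hull}(\mathbf{X},t)$ and $\mathbf{X}$. *)

theory Defs
  imports "HOL-Analysis.Analysis" "HOL-Library.Poly_Mapping"
begin

text \<open>
  The constants of the theorem may depend on the dimension d but not on the ambient dimension D, so
  D has to be quantified inside the statement and cannot be a type. All the spaces \<open>\<real>\<^sup>D\<close> are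
  therefore realised in one inner product space, the finitely supported real sequences
  \<open>nat \<Rightarrow>\<^sub>0 real\<close>: \<open>\<real>\<^sup>D\<close> is the subspace of sequences supported in \<open>{..<D}\<close>, with
  the Euclidean inner product.
\<close>

instantiation poly_mapping :: (type, real_vector) real_vector
begin

lift_definition scaleR_poly_mapping :: "real \<Rightarrow> ('a \<Rightarrow>\<^sub>0 'b) \<Rightarrow> 'a \<Rightarrow>\<^sub>0 'b"
  is "\<lambda>c f i. c *\<^sub>R f i"
  by (erule rev_finite_subset) auto

instance
  by standard (rule poly_mapping_eqI;
    simp add: scaleR_poly_mapping.rep_eq lookup_add scaleR_add_left scaleR_add_right)+

end

instantiation poly_mapping :: (type, real_normed_vector) real_normed_vector
begin

definition norm_poly_mapping :: "('a \<Rightarrow>\<^sub>0 'b) \<Rightarrow> real" where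
  "norm x = L2_set (\<lambda>i. norm (Poly_Mapping.lookup x i)) (Poly_Mapping.keys x)"

definition sgn_poly_mapping :: "('a \<Rightarrow>\<^sub>0 'b) \<Rightarrow> 'a \<Rightarrow>\<^sub>0 'b" where
  "sgn x = inverse (norm x) *\<^sub>R x" for x :: "'a \<Rightarrow>\<^sub>0 'b"

definition dist_poly_mapping :: "('a \<Rightarrow>\<^sub>0 'b) \<Rightarrow> ('a \<Rightarrow>\<^sub>0 'b) \<Rightarrow> real" where
  "dist x y = norm (x - y)" for x y :: "'a \<Rightarrow>\<^sub>0 'b"

definition uniformity_poly_mapping :: "(('a \<Rightarrow>\<^sub>0 'b) \<times> ('a \<Rightarrow>\<^sub>0 'b)) filter" where
  "uniformity_poly_mapping = (INF e\<in>{0<..}. principal {(x, y). dist x y < e})"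

definition open_poly_mapping :: "('a \<Rightarrow>\<^sub>0 'b) set \<Rightarrow> bool" where
  "open_poly_mapping U \<longleftrightarrow> (\<forall>x\<in>U. \<forall>\<^sub>F (x', y) in uniformity. x' = x \<longrightarrow> y \<in> U)"

lemma norm_poly_mapping_superset:
  fixes x :: "'a \<Rightarrow>\<^sub>0 'b"
  assumes "finite A" "Poly_Mapping.keys x \<subseteq> A"
  shows "norm x = L2_set (\<lambda>i. norm (Poly_Mapping.lookup x i)) A"
  unfolding norm_poly_mapping_def L2_set_def
  by (rule arg_cong[where f = sqrt], rule sum.mono_neutral_left)
    (use assms in \<open>auto simp: in_keys_iff\<close>)

instance
proof
  fix x y :: "'a \<Rightarrow>\<^sub>0 'b" and a :: real
  show "sgn x = x /\<^sub>R norm x" by (fact sgn_poly_mapping_def)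
  show "dist x y = norm (x - y)" by (fact dist_poly_mapping_def)
  show "uniformity = (INF e\<in>{0<..}. principal {(x::'a \<Rightarrow>\<^sub>0 'b, y). dist x y < e})"
    by (fact uniformity_poly_mapping_def)
  show "open U \<longleftrightarrow> (\<forall>x\<in>U. \<forall>\<^sub>F (x', y) in uniformity. x' = x \<longrightarrow> y \<in> U)"
    for U :: "('a \<Rightarrow>\<^sub>0 'b) set"
    by (fact open_poly_mapping_def)
  show "norm x = 0 \<longleftrightarrow> x = 0"
    unfolding norm_poly_mapping_def
    by (subst L2_set_eq_0_iff) (auto simp: in_keys_iff intro: poly_mapping_eqI)
  let ?A = "Poly_Mapping.keys x \<union> Poly_Mapping.keys y"
  have fin: "finite ?A" by simp
  have sub: "Poly_Mapping.keys x \<subseteq> ?A" "Poly_Mapping.keys y \<subseteq> ?A"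
    "Poly_Mapping.keys (x + y) \<subseteq> ?A" "Poly_Mapping.keys (a *\<^sub>R x) \<subseteq> ?A"
    by (auto simp: in_keys_iff lookup_add scaleR_poly_mapping.rep_eq)
  note norm_A = sub[THEN norm_poly_mapping_superset[OF fin]]
  show "norm (x + y) \<le> norm x + norm y"
    unfolding norm_A
    by (rule order_trans[OF L2_set_mono L2_set_triangle_ineq])
      (auto simp: lookup_add norm_triangle_ineq)
  show "norm (a *\<^sub>R x) = \<bar>a\<bar> * norm x"
    unfolding norm_A by (simp add: scaleR_poly_mapping.rep_eq L2_set_right_distrib)
qed

end

instantiation poly_mapping :: (type, real_inner) real_inner
begin

definition inner_poly_mapping :: "('a \<Rightarrow>\<^sub>0 'b) \<Rightarrow> ('a \<Rightarrow>\<^sub>0 'b) \<Rightarrow> real" where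
  "inner x y =
     (\<Sum>i\<in>Poly_Mapping.keys x. inner (Poly_Mapping.lookup x i) (Poly_Mapping.lookup y i))"

lemma inner_poly_mapping_superset:
  fixes x y :: "'a \<Rightarrow>\<^sub>0 'b"
  assumes "finite A" "Poly_Mapping.keys x \<subseteq> A"
  shows "inner x y = (\<Sum>i\<in>A. inner (Poly_Mapping.lookup x i) (Poly_Mapping.lookup y i))"
  unfolding inner_poly_mapping_def
  by (rule sum.mono_neutral_left) (use assms in \<open>auto simp: in_keys_iff\<close>)

instance
proof
  fix x y z :: "'a \<Rightarrow>\<^sub>0 'b" and a :: real
  let ?A = "Poly_Mapping.keys x \<union> Poly_Mapping.keys y"
  have fin: "finite ?A" by simp
  have sub: "Poly_Mapping.keys x \<subseteq> ?A" "Poly_Mapping.keys y \<subseteq> ?A"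
    "Poly_Mapping.keys (x + y) \<subseteq> ?A" "Poly_Mapping.keys (a *\<^sub>R x) \<subseteq> ?A"
    by (auto simp: in_keys_iff lookup_add scaleR_poly_mapping.rep_eq)
  note inner_A = sub[THEN inner_poly_mapping_superset[OF fin]]
  show "inner x y = inner y x"
    unfolding inner_A by (simp add: inner_commute)
  show "inner (x + y) z = inner x z + inner y z"
    unfolding inner_A by (simp add: lookup_add inner_add_left sum.distrib)
  show "inner (a *\<^sub>R x) y = a * inner x y"
    unfolding inner_A by (simp add: scaleR_poly_mapping.rep_eq sum_distrib_left)
  show "0 \<le> inner x x"
    unfolding inner_A by (simp add: sum_nonneg)
  show norm: "norm x = sqrt (inner x x)"
    by (simp add: norm_poly_mapping_def inner_poly_mapping_def L2_set_def power2_norm_eq_inner)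
  show "inner x x = 0 \<longleftrightarrow> x = 0"
    using norm by (metis norm_eq_zero real_sqrt_eq_zero_cancel_iff)
qed

end

definition Rspace :: "nat \<Rightarrow> (nat \<Rightarrow>\<^sub>0 real) set" where
  "Rspace D = {x. Poly_Mapping.keys x \<subseteq> {..<D}}"

lemma inner_Rspace:
  assumes "x \<in> Rspace D"
  shows "inner x y = (\<Sum>i<D. Poly_Mapping.lookup x i * Poly_Mapping.lookup y i)"
  using assms inner_poly_mapping_superset[OF finite_lessThan, of x D y] by (simp add: Rspace_def)


subsection \<open>Differentiability of order k and higher differentials\<close>

text \<open>
  In the next three definitions V is a finite-dimensional subspace and S a relatively open subset of
  V. Derivatives are taken within S; at points of S they are determined on V, and are evaluated only
  there.
\<close>

fun Ck_on :: "nat \<Rightarrow> 'a::real_normed_vector set \<Rightarrow> 'a set \<Rightarrow> ('a \<Rightarrow> 'b::real_normed_vector) \<Rightarrow> bool"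
  where
    "Ck_on 0 V S f \<longleftrightarrow> continuous_on S f"
  | "Ck_on (Suc n) V S f \<longleftrightarrow> (\<forall>x\<in>S. f differentiable (at x within S)) \<and>
       (\<forall>u\<in>V. Ck_on n V S (\<lambda>x. frechet_derivative f (at x within S) u))"

text \<open>
  \<open>higher_differential S f x [u\<^sub>1, \<dots>, u\<^sub>i]\<close> is the i-th differential of f at x,
  an i-linear map, applied to \<open>u\<^sub>1, \<dots>, u\<^sub>i\<close>.
\<close>

fun higher_differential ::
  "'a::real_normed_vector set \<Rightarrow> ('a \<Rightarrow> 'b::real_normed_vector) \<Rightarrow> 'a \<Rightarrow> 'a list \<Rightarrow> 'b"
  where
    "higher_differential S f x [] = f x"
  | "higher_differential S f x (u # us) =
       frechet_derivative (\<lambda>y. higher_differential S f y us) (at x within S) u"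

definition multilinear_norm ::
  "'a::real_normed_vector set \<Rightarrow> nat \<Rightarrow> ('a list \<Rightarrow> 'b::real_normed_vector) \<Rightarrow> real" where
  "multilinear_norm V i T =
     (SUP us\<in>{us. length us = i \<and> set us \<subseteq> V \<inter> cball 0 1}. norm (T us))"


subsection \<open>Submanifolds, tangent spaces, second fundamental form\<close>

definition local_parametrization ::
  "'b::topological_space set \<Rightarrow> 'a::topological_space set \<Rightarrow> ('a \<Rightarrow> 'b) \<Rightarrow> bool" where
  "local_parametrization M S \<psi> \<longleftrightarrow>
     openin (top_of_set M) (\<psi> ` S) \<and> (\<exists>g. homeomorphism S (\<psi> ` S) \<psi> g)"

definition submanifold :: "nat \<Rightarrow> nat \<Rightarrow> nat \<Rightarrow> (nat \<Rightarrow>\<^sub>0 real) set \<Rightarrow> bool" where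
  "submanifold k d D M \<longleftrightarrow> M \<subseteq> Rspace D \<and>
     (\<forall>p\<in>M. \<exists>S \<phi>. openin (top_of_set (Rspace d)) S \<and> p \<in> \<phi> ` S \<and>
        local_parametrization M S \<phi> \<and> Ck_on k (Rspace d) S \<phi> \<and>
        (\<forall>x\<in>S. inj_on (frechet_derivative \<phi> (at x within S)) (Rspace d)))"

definition tangent_space :: "'a::real_normed_vector set \<Rightarrow> 'a \<Rightarrow> 'a set" where
  "tangent_space M p = {w. \<exists>\<gamma> e. 0 < e \<and> \<gamma> 0 = p \<and> \<gamma> ` {-e<..<e} \<subseteq> M \<and>
     (\<gamma> has_vector_derivative w) (at (0::real))}"

definition tangent_field :: "'a::real_normed_vector set \<Rightarrow> ('a \<Rightarrow> 'a) \<Rightarrow> bool" where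
  "tangent_field M X \<longleftrightarrow>
     (\<forall>q\<in>M. X q \<in> tangent_space M q) \<and> (\<forall>q\<in>M. X differentiable (at q within M))"

text \<open>
  For tangent vectors u, v at p this is the component normal to M of the derivative at p, in
  direction u, of any tangent vector field X of M with X(p) = v. The derivative within M is
  determined on tangent vectors.
\<close>

definition second_fundamental_form :: "'a::real_inner set \<Rightarrow> 'a \<Rightarrow> 'a \<Rightarrow> 'a \<Rightarrow> 'a" where
  "second_fundamental_form M p u v = (THE w. \<exists>X. tangent_field M X \<and> X p = v \<and>
     (\<forall>z\<in>tangent_space M p. orthogonal w z) \<and>
     frechet_derivative X (at p within M) u - w \<in> tangent_space M p)"

definition second_fundamental_norm :: "'a::real_inner set \<Rightarrow> 'a \<Rightarrow> real" where
  "second_fundamental_norm M p =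
     multilinear_norm (tangent_space M p) 2 (\<lambda>us. second_fundamental_form M p (us ! 0) (us ! 1))"


subsection \<open>Reach and local reach\<close>

definition reach :: "nat \<Rightarrow> (nat \<Rightarrow>\<^sub>0 real) set \<Rightarrow> ereal" where
  "reach D M = (SUP \<delta>\<in>{\<delta>. 0 \<le> \<delta> \<and>
     (\<forall>x\<in>Rspace D. infdist x M < \<delta> \<longrightarrow> (\<exists>!p. p \<in> M \<and> (\<forall>q\<in>M. dist x p \<le> dist x q)))}. ereal \<delta>)"

text \<open>In \<open>ereal\<close>, \<open>1 / 0 = \<infinity>\<close>: flat points do not contribute to the infimum.\<close>

definition local_reach :: "'a::real_inner set \<Rightarrow> ereal" where
  "local_reach M = (INF p\<in>M. 1 / ereal (second_fundamental_norm M p))"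


subsection \<open>The class of manifolds\<close>

text \<open>
  The ball of radius r in the tangent space is open; the bounds on the differentials are imposed at
  the points v of that ball with \<open>norm v \<le> 1 / (4 * Lperp)\<close>.
\<close>

definition manifold_class ::
  "nat \<Rightarrow> nat \<Rightarrow> nat \<Rightarrow> real \<Rightarrow> real \<Rightarrow> (nat \<Rightarrow> real) \<Rightarrow> (nat \<Rightarrow>\<^sub>0 real) set set" where
  "manifold_class k d D Rmin Lperp L = {M.
     submanifold k d D M \<and> compact M \<and> connected M \<and> M \<noteq> {} \<and>
     ereal Rmin \<le> reach D M \<and>
     (\<forall>p\<in>M. \<exists>r N. 1 / (4 * Lperp) \<le> r \<and>
        (let T = tangent_space M p; B = T \<inter> ball 0 r in
          local_parametrization M B (\<lambda>v. p + v + N v) \<and>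
          N ` B \<subseteq> Rspace D \<and> Ck_on k T B N \<and>
          N 0 = 0 \<and> (N has_derivative (\<lambda>u. 0)) (at 0 within B) \<and>
          (\<forall>v\<in>B. norm v \<le> 1 / (4 * Lperp) \<longrightarrow>
             multilinear_norm T 2 (higher_differential B N v) \<le> Lperp \<and>
             (\<forall>i\<in>{3..k}. multilinear_norm T i (higher_differential B N v) \<le> L i))))}"


subsection \<open>The convexity defect function\<close>

definition Rad :: "nat \<Rightarrow> (nat \<Rightarrow>\<^sub>0 real) set \<Rightarrow> real" where
  "Rad D \<sigma> = Inf {r. 0 \<le> r \<and> (\<exists>c\<in>Rspace D. \<sigma> \<subseteq> cball c r)}"

definition Hull :: "nat \<Rightarrow> (nat \<Rightarrow>\<^sub>0 real) set \<Rightarrow> real \<Rightarrow> (nat \<Rightarrow>\<^sub>0 real) set" where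
  "Hull D X t = (\<Union>\<sigma>\<in>{\<sigma>. \<sigma> \<subseteq> X \<and> \<sigma> \<noteq> {} \<and> compact \<sigma> \<and> Rad D \<sigma> \<le> t}. convex hull \<sigma>)"

definition convexity_defect :: "nat \<Rightarrow> (nat \<Rightarrow>\<^sub>0 real) set \<Rightarrow> real \<Rightarrow> real" where
  "convexity_defect D X t = (SUP y\<in>Hull D X t. infdist y X)"

end

theory Submission
  imports Defs
begin

text \<open>
  Let \<open>\<kappa>\<close> be the supremum over M of the norms of the second fundamental forms, so that
  \<open>t\<^sup>2 / (2 R\<^sub>l) = \<kappa> t\<^sup>2 / 2\<close> (lemma \<open>square_over_local_reach\<close>). Two estimates are needed,
  with constants that only involve the bounds on the second, third and fourth derivatives of the
  graphs \<open>N\<close>.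

  Upper bound. Let y lie in the convex hull of a set \<open>\<sigma> \<subseteq> M\<close> contained in a ball of radius t, let p be
  a point of M nearest to y and n the unit vector from p to y; it is normal to M at p. The main point
  (\<open>osculating_bound\<close>) is that every x in M close to p satisfies
  \<open>\<langle>x - p, n\<rangle> \<le> \<kappa> |x - y|\<^sup>2 / 2 + O(|x - p|\<^sup>4)\<close>, with no cubic term. A geodesic from p to x would
  give this at once, because its acceleration is normal to M and has norm at most \<open>\<kappa>\<close>. In its place
  stands the image, under the chart at p, of a parabola whose quadratic term is chosen such that
  the acceleration at p is normal up to third order; the tangential part of the acceleration then
  stays of third order along the curve, and it contributes to the height over the tangent space in
  direction n at fourth order only, since n is nearly normal to M near p. Averaged over
  \<open>\<sigma>\<close>, the inequalities put y at distance at most \<open>\<kappa> t\<^sup>2 / 2 + O(t\<^sup>4)\<close> from M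
  (\<open>infdist_convex_hull_le\<close>). So the upper bound has a fourth-order error for \<open>k = 3\<close> already.

  Lower bound. Take p and a unit tangent vector u with \<open>|II(u, u)|\<close> close to \<open>\<kappa>\<close>; the diagonal is
  enough because II is symmetric. The midpoint of the images under the chart of \<open>s u\<close> and \<open>- s u\<close>,
  with s slightly smaller than t, has height
  \<open>s\<^sup>2 |II(u, u)| / 2\<close> over p, up to the remainder of the even part of \<open>N\<close>. Cubic terms cancel
  there, so the remainder is of fourth order if N is four times differentiable and of third order
  otherwise: this is the difference between the two cases. Points of M close to the midpoint are so
  close to p that they have height \<open>O(s\<^sup>4)\<close> (\<open>infdist_midpoint_ge\<close>).

  Both estimates use that every point of M near p lies in the chart at p
  (\<open>nearby_points_in_chart\<close>). This is where the reach enters: if x in M were near p but outside the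
  chart, then x minus its nearest point q in the chart would be a short normal vector at q, and
  \<open>normal_chord_trivial\<close> excludes short normal chords.

  The second fundamental form is defined through global tangent fields. It is identified with the
  normal part of the second differential of N at 0 by \<open>second_fundamental_form_eq\<close>, and with the
  normal part of the acceleration of curves by \<open>curve_acceleration\<close>.
\<close>

section \<open>Orthonormal bases of finite-dimensional subspaces\<close>

text \<open>The space of finitely supported sequences is neither complete nor finite-dimensional; orthonormal
  bases make its finite-dimensional subspaces concrete.\<close>

definition orthonormal_basis :: "'a::real_inner set \<Rightarrow> bool" where
  "orthonormal_basis E \<longleftrightarrow> finite E \<and> (\<forall>a\<in>E. \<forall>b\<in>E. inner a b = (if a = b then 1 else 0))"

definition proj :: "'a::real_inner set \<Rightarrow> 'a \<Rightarrow> 'a" where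
  "proj E x = (\<Sum>e\<in>E. inner x e *\<^sub>R e)"

lemma orthonormal_basis_exists:
  fixes F :: "'a::real_inner set"
  assumes "finite F"
  obtains E where "orthonormal_basis E" "span E = span F"
proof -
  obtain C where C: "finite C" "span C = span F" "pairwise orthogonal C"
    using basis_orthogonal[OF assms] by blast
  define E where "E = (\<lambda>c. c /\<^sub>R norm c) ` (C - {0})"
  have "inner a b = (if a = b then 1 else 0)" if ab: "a \<in> E" "b \<in> E" for a b
  proof -
    obtain c c' where c: "c \<in> C" "c \<noteq> 0" "a = c /\<^sub>R norm c" "c' \<in> C" "c' \<noteq> 0" "b = c' /\<^sub>R norm c'"
      using ab unfolding E_def by blast
    show ?thesis
    proof (cases "c = c'")
      case True
      then show ?thesis using c by (simp add: dot_square_norm power2_eq_square)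
    next
      case False
      then have "orthogonal c c'" using C(3) c by (auto simp: pairwise_def)
      then have *: "inner a b = 0" using c by (simp add: orthogonal_def)
      have "a \<noteq> b"
      proof
        assume "a = b"
        with * have "a = 0" by simp
        then show False using c by simp
      qed
      with * show ?thesis by simp
    qed
  qed
  then have onb: "orthonormal_basis E" using C(1) by (auto simp: orthonormal_basis_def E_def)
  have "span E = span C"
  proof (rule antisym)
    show "span E \<subseteq> span C"
      by (rule span_minimal) (auto simp: E_def intro: span_base span_scale)
    have "c \<in> span E" if "c \<in> C" for c
    proof (cases "c = 0")
      case False
      then have "c /\<^sub>R norm c \<in> span E" using that by (auto simp: E_def intro: span_base)
      then have "norm c *\<^sub>R (c /\<^sub>R norm c) \<in> span E" by (rule span_scale)
      then show ?thesis using False by simp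
    qed (simp add: span_zero)
    then show "span C \<subseteq> span E" by (intro span_minimal) auto
  qed
  with onb C(2) show ?thesis by (auto intro: that)
qed

lemma proj_in_span: "proj E x \<in> span E"
  unfolding proj_def by (intro span_sum span_scale span_base)

lemma bounded_linear_proj: "bounded_linear (proj E)"
  unfolding proj_def by (intro bounded_linear_sum bounded_linear_scaleR_const[OF bounded_linear_inner_left])

lemma inner_proj_basis:
  assumes "orthonormal_basis E" "e \<in> E"
  shows "inner (proj E x) e = inner x e"
proof -
  have "inner (proj E x) e = (\<Sum>e'\<in>E. inner x e' * (if e' = e then 1 else 0))"
    unfolding proj_def inner_sum_left using assms
    by (intro sum.cong) (auto simp: orthonormal_basis_def)
  also have "\<dots> = inner x e"
    using assms by (simp add: orthonormal_basis_def if_distrib sum.delta cong: if_cong)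
  finally show ?thesis .
qed

lemma inner_proj:
  assumes "orthonormal_basis E" "w \<in> span E"
  shows "inner (proj E x) w = inner x w"
  using assms(2)
proof (induct rule: span_induct_alt)
  case base then show ?case by simp
next
  case (step c e w)
  then show ?case using inner_proj_basis[OF assms(1)] by (simp add: inner_add_right)
qed

lemma proj_id:
  assumes "orthonormal_basis E" "x \<in> span E"
  shows "proj E x = x"
proof -
  have "x - proj E x \<in> span E" using assms(2) proj_in_span span_diff by blast
  then have "inner (x - proj E x) (x - proj E x) = 0"
    using inner_proj[OF assms(1), of "x - proj E x" x] by (simp add: inner_diff_left)
  then show ?thesis by simp
qed

lemma norm_proj_le:
  assumes "orthonormal_basis E"
  shows "norm (proj E x) \<le> norm x"
proof (cases "proj E x = 0")
  case False
  have "norm (proj E x) * norm (proj E x) = inner (proj E x) (proj E x)"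
    by (metis dot_square_norm power2_eq_square)
  also have "\<dots> = inner x (proj E x)" using inner_proj[OF assms proj_in_span] by simp
  also have "\<dots> \<le> norm x * norm (proj E x)" by (rule norm_cauchy_schwarz)
  finally show ?thesis using False by simp
qed simp

lemma norm_minus_proj_le:
  assumes "orthonormal_basis E"
  shows "norm (x - proj E x) \<le> norm x"
proof -
  have "(norm x)\<^sup>2 = (norm (x - proj E x))\<^sup>2 + (norm (proj E x))\<^sup>2"
    using inner_proj[OF assms proj_in_span, of x x]
    by (simp add: power2_norm_eq_inner inner_diff inner_commute)
  then have "(norm (x - proj E x))\<^sup>2 \<le> (norm x)\<^sup>2" by simp
  then show ?thesis by (simp add: power2_le_iff_abs_le)
qed

lemma closed_span_onb:
  assumes "orthonormal_basis E"
  shows "closed (span E)"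
proof -
  have "span E = {x. x = proj E x}"
    using proj_id[OF assms] proj_in_span by (metis (mono_tags, lifting) Collect_cong Collect_mem_eq)
  moreover have "continuous_on UNIV (proj E)"
    using bounded_linear_proj linear_continuous_on by blast
  then have "closed {x. x = proj E x}"
    by (intro closed_Collect_eq continuous_intros)
  ultimately show ?thesis by simp
qed

text \<open>The set is closed in the continuous image of a cube of coefficients.\<close>

lemma compact_span_cball:
  fixes E :: "'a::real_inner set"
  assumes onb: "orthonormal_basis E"
  shows "compact (span E \<inter> cball 0 r)"
proof -
  have fin: "finite E" using onb by (simp add: orthonormal_basis_def)
  have cpt: "compact {(\<Sum>e\<in>F. c e *\<^sub>R e) | c. \<forall>e\<in>F. c e \<in> {-r..r}}" (is "compact (?K F)") if "finite F" for F :: "'a set"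
    using that
  proof (induct F)
    case empty
    have "?K {} = {0}" by auto
    then show ?case by simp
  next
    case (insert a F)
    have "?K (insert a F) = (\<lambda>(c, x). c *\<^sub>R a + x) ` ({-r..r} \<times> ?K F)" (is "_ = ?R")
    proof
      show "?K (insert a F) \<subseteq> ?R"
      proof
        fix y assume "y \<in> ?K (insert a F)"
        then obtain c where "y = (\<Sum>e\<in>insert a F. c e *\<^sub>R e)" "\<forall>e\<in>insert a F. c e \<in> {-r..r}" by blast
        then show "y \<in> ?R" using insert
          by (intro image_eqI[where x="(c a, \<Sum>e\<in>F. c e *\<^sub>R e)"]) auto
      qed
      show "?R \<subseteq> ?K (insert a F)"
      proof
        fix y assume "y \<in> ?R"
        then obtain b c where "y = b *\<^sub>R a + (\<Sum>e\<in>F. c e *\<^sub>R e)" "\<forall>e\<in>F. c e \<in> {-r..r}" "b \<in> {-r..r}" by auto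
        moreover have "(\<Sum>e\<in>F. c e *\<^sub>R e) = (\<Sum>e\<in>F. (c(a := b)) e *\<^sub>R e)"
          using insert by (intro sum.cong) auto
        ultimately show "y \<in> ?K (insert a F)" using insert
          by (intro CollectI exI[of _ "c(a := b)"]) auto
      qed
    qed
    moreover have "compact ?R"
      by (intro compact_continuous_image compact_Times compact_Icc insert)
        (auto simp: split_beta intro!: continuous_intros)
    ultimately show ?case by simp
  qed
  have sub: "span E \<inter> cball 0 r \<subseteq> ?K E"
  proof
    fix x assume x: "x \<in> span E \<inter> cball 0 r"
    then have "x = (\<Sum>e\<in>E. inner x e *\<^sub>R e)" using proj_id[OF onb, of x] by (simp add: proj_def)
    moreover have "inner x e \<in> {-r..r}" if "e \<in> E" for e
    proof -
      have "norm e = 1" using onb that by (simp add: orthonormal_basis_def norm_eq_sqrt_inner)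
      then have "\<bar>inner x e\<bar> \<le> r" using Cauchy_Schwarz_ineq2[of x e] x by simp
      then show ?thesis by auto
    qed
    ultimately show "x \<in> ?K E" by blast
  qed
  have "closed (span E \<inter> cball 0 r)" using closed_span_onb[OF onb] by (intro closed_Int) auto
  then have "compact (?K E \<inter> (span E \<inter> cball 0 r))" using cpt[OF fin] by (rule compact_Int_closed[rotated])
  then show ?thesis using sub by (simp add: Int_absorb1)
qed

text \<open>A linear left inverse of \<open>A\<close> need not be bounded on the whole space; it becomes bounded once it is
  preceded by the orthogonal projection onto the image of \<open>V\<close>.\<close>

lemma bounded_left_inverse:
  fixes A :: "'a::real_inner \<Rightarrow> 'b::real_inner"
  assumes V: "finite F" "V = span F" and A: "linear A" "inj_on A V"
  obtains G where "bounded_linear G" "\<And>y. G y \<in> V" "\<And>v. v \<in> V \<Longrightarrow> G (A v) = v"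
proof -
  obtain g where g: "linear g" "\<forall>v\<in>V. g (A v) = v" "range g \<subseteq> V"
    using linear_exists_left_inverse_on[OF A(1) _ A(2)] V by auto
  obtain C where C: "orthonormal_basis C" "span C = span (A ` F)"
    using orthonormal_basis_exists[of "A ` F"] V by auto
  define G where "G = (\<lambda>x. \<Sum>c\<in>C. inner x c *\<^sub>R g c)"
  have "bounded_linear G" unfolding G_def
    by (intro bounded_linear_sum bounded_linear_scaleR_const[OF bounded_linear_inner_left])
  moreover have "G y \<in> V" for y
    unfolding G_def V(2) using g(3) V(2) by (intro span_sum span_scale) auto
  moreover have "G (A v) = v" if "v \<in> V" for v
  proof -
    have "A v \<in> span C" using that V C A linear_span_image by fastforce
    then have "A v = (\<Sum>c\<in>C. inner (A v) c *\<^sub>R c)" using proj_id[OF C(1)] by (metis proj_def)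
    then have "g (A v) = (\<Sum>c\<in>C. inner (A v) c *\<^sub>R g c)"
      using g(1) by (metis (no_types, lifting) linear_sum linear_cmul sum.cong)
    then show ?thesis using g(2) that by (simp add: G_def)
  qed
  ultimately show ?thesis by (rule that)
qed

section \<open>Higher differentials as multilinear maps\<close>

text \<open>Derivatives within a set are only known along curves that stay in the set.\<close>

lemma has_vector_derivative_compose_within:
  assumes f: "(f has_derivative A) (at (c t) within S)"
    and c: "(c has_vector_derivative w) (at t)"
    and S: "\<forall>\<^sub>F s in nhds t. c s \<in> S"
  shows "((\<lambda>s. f (c s)) has_vector_derivative A w) (at (t::real))"
proof -
  obtain U where U: "open U" "t \<in> U" "\<And>s. s \<in> U \<Longrightarrow> c s \<in> S"
    using S unfolding eventually_nhds by blast
  have cU: "(c has_derivative (\<lambda>h. h *\<^sub>R w)) (at t within U)"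
    using c unfolding has_vector_derivative_def by (rule has_derivative_at_withinI)
  have "(f \<circ> c has_derivative A \<circ> (\<lambda>h. h *\<^sub>R w)) (at t within U)"
    by (rule diff_chain_within[OF cU has_derivative_subset[OF f]]) (use U(3) in blast)
  then have "(f \<circ> c has_derivative A \<circ> (\<lambda>h. h *\<^sub>R w)) (at t)"
    unfolding at_within_open[OF U(2,1)] .
  moreover have "A \<circ> (\<lambda>h. h *\<^sub>R w) = (\<lambda>h. h *\<^sub>R A w)"
    unfolding o_def linear_cmul[OF has_derivative_linear[OF f]] ..
  ultimately show ?thesis unfolding has_vector_derivative_def o_def by simp
qed

lemma eventually_in_relatively_open:
  assumes "openin (top_of_set V) S" "c t \<in> S" "isCont c (t::real)" "\<forall>\<^sub>F s in nhds t. c s \<in> V"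
  shows "\<forall>\<^sub>F s in nhds t. c s \<in> S"
proof -
  obtain U where U: "open U" "S = V \<inter> U" using assms(1) unfolding openin_open by blast
  have "\<forall>\<^sub>F s in nhds t. c s \<in> U"
    using assms(2,3) U by (simp add: continuous_within tendsto_at_iff_tendsto_nhds topological_tendstoD)
  then show ?thesis using assms(4) U(2) by (auto elim: eventually_elim2)
qed

lemma eventually_line_in_relatively_open:
  fixes x z :: "'a::real_normed_vector"
  assumes "openin (top_of_set V) S" "subspace V" "x + t *\<^sub>R z \<in> S" "x \<in> V" "z \<in> V"
  shows "\<forall>\<^sub>F s in nhds (t::real). x + s *\<^sub>R z \<in> S"
proof (rule eventually_in_relatively_open[where c = "\<lambda>s. x + s *\<^sub>R z", OF assms(1,3)])
  show "isCont (\<lambda>s. x + s *\<^sub>R z) t" by simp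
qed (use assms in \<open>auto intro!: always_eventually subspace_add subspace_scale\<close>)

text \<open>On directions in \<open>V\<close> a derivative within \<open>S\<close> is determined by its restriction to lines.\<close>

lemma frechet_derivative_within_unique:
  assumes f: "(f has_derivative A) (at x within S)" and S: "openin (top_of_set V) S" "subspace V"
    and "x \<in> S" "u \<in> V"
  shows "frechet_derivative f (at x within S) u = A u"
proof -
  have x: "x \<in> V" using S(1) \<open>x \<in> S\<close> openin_imp_subset by blast
  let ?F = "frechet_derivative f (at x within S)"
  have F: "(f has_derivative ?F) (at x within S)"
    using f by (subst frechet_derivative_works[symmetric]) (rule differentiableI)
  have line: "\<forall>\<^sub>F s in nhds (0::real). x + s *\<^sub>R u \<in> S"
    using eventually_line_in_relatively_open[OF S, of x 0 u] assms x by simp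
  have c: "((\<lambda>s. x + s *\<^sub>R u) has_vector_derivative u) (at 0)"
    by (auto intro!: derivative_eq_intros)
  have *: "((\<lambda>s. f (x + s *\<^sub>R u)) has_vector_derivative B u) (at 0)"
    if "(f has_derivative B) (at x within S)" for B
    by (rule has_vector_derivative_compose_within[OF _ c line]) (use that in simp)
  show ?thesis by (rule vector_derivative_unique_at[OF *[OF F] *[OF f]])
qed

lemma frechet_derivative_within_cong:
  assumes "\<And>y. y \<in> S \<Longrightarrow> f y = g y" "x \<in> S"
  shows "frechet_derivative f (at x within S) = frechet_derivative g (at x within S)"
proof -
  have "(f has_derivative A) (at x within S) \<longleftrightarrow> (g has_derivative A) (at x within S)" for A
    by (rule iffI; erule has_derivative_transform[OF assms(2), rotated]) (simp_all add: assms(1))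
  then show ?thesis by (simp add: frechet_derivative_def)
qed

lemma Ck_on_higher_differential:
  assumes "Ck_on (j + length us) V S f" "set us \<subseteq> V"
  shows "Ck_on j V S (\<lambda>y. higher_differential S f y us)"
  using assms
proof (induct us arbitrary: j)
  case (Cons u us)
  then have "Ck_on (Suc j) V S (\<lambda>y. higher_differential S f y us)"
    by (simp del: Ck_on.simps)
  then show ?case using Cons.prems by simp
qed simp

lemma higher_differential_has_derivative:
  assumes "Ck_on k V S f" "length us < k" "set us \<subseteq> V" "x \<in> S"
  shows "((\<lambda>y. higher_differential S f y us) has_derivative (\<lambda>u. higher_differential S f x (u # us)))
    (at x within S)"
proof -
  obtain j where j: "k = Suc j + length us" using assms(2) by (intro that[of "k - Suc (length us)"]) simp
  have "(\<lambda>y. higher_differential S f y us) differentiable (at x within S)"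
    using Ck_on_higher_differential[of "Suc j" us V S f] assms j by simp
  then show ?thesis by (simp add: frechet_derivative_works)
qed

definition multilinear_on :: "'a::real_vector set \<Rightarrow> nat \<Rightarrow> ('a list \<Rightarrow> 'b::real_vector) \<Rightarrow> bool" where
  "multilinear_on V i F \<longleftrightarrow> (\<forall>us ws a b c. length us + Suc (length ws) = i \<longrightarrow>
     set us \<subseteq> V \<longrightarrow> set ws \<subseteq> V \<longrightarrow> a \<in> V \<longrightarrow> b \<in> V \<longrightarrow>
     F (us @ (a + c *\<^sub>R b) # ws) = F (us @ a # ws) + c *\<^sub>R F (us @ b # ws))"

lemma multilinear_onD:
  assumes "multilinear_on V i F" "length us + Suc (length ws) = i" "set us \<subseteq> V" "set ws \<subseteq> V" "a \<in> V" "b \<in> V"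
  shows "F (us @ (a + c *\<^sub>R b) # ws) = F (us @ a # ws) + c *\<^sub>R F (us @ b # ws)"
  using assms(1)[unfolded multilinear_on_def, rule_format, OF assms(2-)] .

lemma multilinear_on_Cons:
  assumes F: "multilinear_on V (Suc i) F" and "x \<in> V"
  shows "multilinear_on V i (\<lambda>us. F (x # us))"
  unfolding multilinear_on_def
proof (intro allI impI)
  fix us ws a b c
  assume "length us + Suc (length ws) = i" "set us \<subseteq> V" "set ws \<subseteq> V" "a \<in> V" "b \<in> V"
  then show "F (x # us @ (a + c *\<^sub>R b) # ws) = F (x # us @ a # ws) + c *\<^sub>R F (x # us @ b # ws)"
    using multilinear_onD[OF F, of "x # us" ws a b c] \<open>x \<in> V\<close> by simp
qed

lemma multilinear_on_linear_head:
  assumes F: "multilinear_on V (Suc i) F" and "length ws = i" "set ws \<subseteq> V" "a \<in> V" "b \<in> V"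
  shows "F ((a + c *\<^sub>R b) # ws) = F (a # ws) + c *\<^sub>R F (b # ws)"
  using multilinear_onD[OF F, of "[]" ws a b c] assms by simp

lemma multilinear_on_head_sum:
  assumes F: "multilinear_on V (Suc i) F" and V: "subspace V" and "length ws = i" "set ws \<subseteq> V"
    and "finite E" "E \<subseteq> V"
  shows "F ((\<Sum>e\<in>E. c e *\<^sub>R e) # ws) = (\<Sum>e\<in>E. c e *\<^sub>R F (e # ws))"
  using assms(5,6)
proof (induct E)
  case empty
  have "F ((0 + 1 *\<^sub>R 0) # ws) = F (0 # ws) + 1 *\<^sub>R F (0 # ws)"
    by (rule multilinear_on_linear_head[OF F assms(3,4)]) (use V subspace_0 in auto)
  then show ?case by simp
next
  case (insert a E)
  have sub: "(\<Sum>e\<in>E. c e *\<^sub>R e) \<in> V"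
    using insert V by (intro subspace_sum subspace_scale) auto
  then show ?case
    using multilinear_on_linear_head[OF F assms(3,4) sub, of a "c a"] insert
    by (simp add: add.commute)
qed

lemma multilinear_on_scale_head:
  assumes F: "multilinear_on V (Suc i) F" and V: "subspace V" and "length ws = i" "set ws \<subseteq> V"
    and "a \<in> V"
  shows "F ((c *\<^sub>R a) # ws) = c *\<^sub>R F (a # ws)"
  using multilinear_on_head_sum[OF F V assms(3,4), of "{a}" "\<lambda>_. c"] assms(5) by simp

lemma multilinear_on_uminus:
  assumes F: "multilinear_on V i F" and "subspace V"
    and us: "length us + Suc (length ws) = i" "set us \<subseteq> V" "set ws \<subseteq> V" "a \<in> V"
  shows "F (us @ (- a) # ws) = - F (us @ a # ws)"
proof -
  have "F (us @ 0 # ws) = 0"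
    using multilinear_onD[OF F us(1,2,3) us(4) us(4), of "-1"] by simp
  then show ?thesis
    using multilinear_onD[OF F us(1,2,3) subspace_0[OF assms(2)] us(4), of "-1"] by simp
qed

text \<open>The supremum in the operator norm of a multilinear map is a genuine one only because the map
  is bounded; this is where finite dimension of the domain enters.\<close>

lemma multilinear_on_bounded:
  assumes onb: "orthonormal_basis E" and F: "multilinear_on (span E) i F"
  shows "\<exists>K. \<forall>us. length us = i \<longrightarrow> set us \<subseteq> span E \<inter> cball 0 1 \<longrightarrow> norm (F us) \<le> K"
  using F
proof (induct i arbitrary: F)
  case 0
  then show ?case by auto
next
  case (Suc i)
  have "\<forall>e\<in>E. \<exists>K. \<forall>us. length us = i \<longrightarrow> set us \<subseteq> span E \<inter> cball 0 1 \<longrightarrow> norm (F (e # us)) \<le> K"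
  proof
    fix e assume "e \<in> E"
    then show "\<exists>K. \<forall>us. length us = i \<longrightarrow> set us \<subseteq> span E \<inter> cball 0 1 \<longrightarrow> norm (F (e # us)) \<le> K"
      using Suc.hyps[OF multilinear_on_Cons[OF Suc.prems span_base]] by blast
  qed
  then obtain K where K: "\<And>e us. e \<in> E \<Longrightarrow> length us = i \<Longrightarrow> set us \<subseteq> span E \<inter> cball 0 1 \<Longrightarrow> norm (F (e # us)) \<le> K e"
    by metis
  have "norm (F us) \<le> (\<Sum>e\<in>E. K e)" if us: "length us = Suc i" "set us \<subseteq> span E \<inter> cball 0 1" for us
  proof -
    obtain u ws where uw: "us = u # ws" using us by (cases us) auto
    have ws: "length ws = i" "set ws \<subseteq> span E" "set ws \<subseteq> span E \<inter> cball 0 1" and u: "u \<in> span E" "norm u \<le> 1"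
      using us uw by auto
    have "u = (\<Sum>e\<in>E. inner u e *\<^sub>R e)" using proj_id[OF onb u(1)] by (simp add: proj_def)
    then have "F us = (\<Sum>e\<in>E. inner u e *\<^sub>R F (e # ws))"
      using multilinear_on_head_sum[OF Suc.prems subspace_span ws(1,2), of E "inner u"] onb uw
      by (auto simp: orthonormal_basis_def span_superset)
    also have "norm \<dots> \<le> (\<Sum>e\<in>E. norm (inner u e *\<^sub>R F (e # ws)))" by (rule norm_sum)
    also have "\<dots> \<le> (\<Sum>e\<in>E. K e)"
    proof (rule sum_mono)
      fix e assume e: "e \<in> E"
      then have "norm e = 1" using onb by (simp add: orthonormal_basis_def norm_eq_sqrt_inner)
      then have "\<bar>inner u e\<bar> \<le> 1" using Cauchy_Schwarz_ineq2[of u e] u by simp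
      then have "\<bar>inner u e\<bar> * norm (F (e # ws)) \<le> 1 * K e"
        using K[OF e ws(1,3)] by (intro mult_mono) auto
      then show "norm (inner u e *\<^sub>R F (e # ws)) \<le> K e" by simp
    qed
    finally show ?thesis .
  qed
  then show ?case by blast
qed

lemma multilinear_on_normalize:
  assumes F: "multilinear_on V i F" and V: "subspace V" and "length us = i" "set us \<subseteq> V"
  shows "F us = prod_list (map norm us) *\<^sub>R F (map sgn us)"
  using assms(1,3,4)
proof (induct us arbitrary: i F)
  case (Cons u us)
  then obtain j where j: "i = Suc j" "length us = j" by auto
  have u: "u \<in> V" "sgn u \<in> V" and us: "set us \<subseteq> V" using Cons.prems V by (auto simp: sgn_div_norm subspace_scale)
  have "F (u # us) = F ((norm u *\<^sub>R sgn u) # us)"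
    by (cases "u = 0") (simp_all add: sgn_div_norm)
  also have "\<dots> = norm u *\<^sub>R F (sgn u # us)"
    using Cons.prems(1) j us u by (intro multilinear_on_scale_head[OF _ V]) auto
  also have "F (sgn u # us) = prod_list (map norm us) *\<^sub>R F (sgn u # map sgn us)"
    using Cons.hyps[OF multilinear_on_Cons[OF _ u(2)]] Cons.prems(1) j us by blast
  finally show ?case by simp
qed simp

lemma norm_le_multilinear_norm:
  assumes onb: "orthonormal_basis E" and F: "multilinear_on (span E) i F"
    and us: "length us = i" "set us \<subseteq> span E"
  shows "norm (F us) \<le> multilinear_norm (span E) i F * prod_list (map norm us)"
proof -
  let ?I = "{us. length us = i \<and> set us \<subseteq> span E \<inter> cball 0 1}"
  have bdd: "bdd_above ((\<lambda>us. norm (F us)) ` ?I)"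
    using multilinear_on_bounded[OF onb F] by (auto simp: bdd_above_def)
  have "map sgn us \<in> ?I"
  proof -
    have "sgn u \<in> span E \<inter> cball 0 1" if "u \<in> span E" for u
    proof -
      have "sgn u \<in> span E" using that by (simp add: sgn_div_norm span_scale)
      then show ?thesis by (simp add: norm_sgn)
    qed
    then show ?thesis using us by auto
  qed
  then have "norm (F (map sgn us)) \<le> multilinear_norm (span E) i F"
    unfolding multilinear_norm_def using bdd by (rule cSUP_upper)
  moreover have nonneg: "0 \<le> prod_list (map norm us)"
    by (induct us) auto
  ultimately have "prod_list (map norm us) * norm (F (map sgn us)) \<le> prod_list (map norm us) * multilinear_norm (span E) i F"
    by (intro mult_left_mono)
  then show ?thesis
    using multilinear_on_normalize[OF F subspace_span us] nonneg by (simp add: mult.commute)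
qed

text \<open>The slot of the outermost derivative is linear as the argument of a derivative; the other slots
  inherit linearity because differentiation is linear.\<close>

lemma multilinear_on_higher_differential:
  assumes S: "openin (top_of_set V) S" and V: "subspace V" and f: "Ck_on k V S f"
    and x: "x \<in> S" and ik: "i \<le> k"
  shows "multilinear_on V i (higher_differential S f x)"
  unfolding multilinear_on_def
proof (intro allI impI)
  fix us ws a b c
  assume "length us + Suc (length ws) = i" "set us \<subseteq> V" "set ws \<subseteq> V" "a \<in> V" "b \<in> V"
  then show "higher_differential S f x (us @ (a + c *\<^sub>R b) # ws) =
    higher_differential S f x (us @ a # ws) + c *\<^sub>R higher_differential S f x (us @ b # ws)"
    using x ik
  proof (induct us arbitrary: i x)
    case Nil
    have L: "linear (\<lambda>u. higher_differential S f x (u # ws))"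
      using higher_differential_has_derivative[OF f, of ws x] Nil has_derivative_linear by fastforce
    show ?case using linear_add[OF L, of a "c *\<^sub>R b"] linear_cmul[OF L, of c b]
      by (simp del: higher_differential.simps)
  next
    case (Cons u us)
    let ?H = "\<lambda>a y. higher_differential S f y (us @ a # ws)"
    have d: "(?H a has_derivative (\<lambda>u. higher_differential S f x (u # us @ a # ws))) (at x within S)"
      if "a \<in> V" for a
      using Cons.prems that by (intro higher_differential_has_derivative[OF f]) auto
    have eq: "?H (a + c *\<^sub>R b) y = ?H a y + c *\<^sub>R ?H b y" if "y \<in> S" for y
      using Cons.prems that by (intro Cons.hyps[of "i - 1"]) auto
    have "frechet_derivative (?H (a + c *\<^sub>R b)) (at x within S) u
        = frechet_derivative (\<lambda>y. ?H a y + c *\<^sub>R ?H b y) (at x within S) u"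
      using frechet_derivative_within_cong[of S, OF eq] Cons.prems by simp
    also have "\<dots> = higher_differential S f x (u # us @ a # ws) + c *\<^sub>R higher_differential S f x (u # us @ b # ws)"
      using Cons.prems
      by (intro frechet_derivative_within_unique[OF _ S V] has_derivative_add has_derivative_scaleR_right d) auto
    finally show ?case by simp
  qed
qed

lemma higher_differential_curve:
  assumes f: "Ck_on k V S f" and "length us < k" "set us \<subseteq> V" "c t \<in> S"
    and c: "(c has_vector_derivative w) (at t)" and cS: "\<forall>\<^sub>F s in nhds t. c s \<in> S"
  shows "((\<lambda>s. higher_differential S f (c s) us) has_vector_derivative
    higher_differential S f (c t) (w # us)) (at t)"
  using has_vector_derivative_compose_within[OF higher_differential_has_derivative[OF assms(1-4)] c cS] .

text \<open>Taylor's formula with remainder bound for vector-valued functions, obtained from the scalar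
  Maclaurin formula for the component along the remainder itself.\<close>

lemma vector_Maclaurin_bound:
  fixes D :: "nat \<Rightarrow> real \<Rightarrow> 'a::real_inner"
  assumes n: "0 < n"
    and D: "\<And>m t. m < n \<Longrightarrow> 0 \<le> t \<Longrightarrow> t \<le> 1 \<Longrightarrow> (D m has_vector_derivative D (Suc m) t) (at t)"
    and K: "\<And>t. 0 \<le> t \<Longrightarrow> t \<le> 1 \<Longrightarrow> norm (D n t) \<le> K"
  shows "norm (D 0 1 - (\<Sum>m<n. D m 0 /\<^sub>R fact m)) \<le> K / fact n"
proof -
  define R where "R = D 0 1 - (\<Sum>m<n. D m 0 /\<^sub>R fact m)"
  define e where "e = sgn R"
  have "\<exists>t>0. t < 1 \<and> inner (D 0 1) e = (\<Sum>m<n. inner (D m 0) e / fact m * 1 ^ m) + inner (D n t) e / fact n * 1 ^ n"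
  proof (rule Maclaurin[where diff = "\<lambda>m t. inner (D m t) e" and f = "\<lambda>t. inner (D 0 t) e" and h = 1 and n = n])
    show "\<forall>m t. m < n \<and> 0 \<le> t \<and> t \<le> 1 \<longrightarrow> ((\<lambda>t. inner (D m t) e) has_real_derivative inner (D (Suc m) t) e) (at t)"
    proof (intro allI impI)
      fix m t assume "m < n \<and> 0 \<le> t \<and> t \<le> (1::real)"
      then have "((\<lambda>t. inner (D m t) e) has_vector_derivative inner (D (Suc m) t) e) (at t)"
        using D bounded_linear.has_vector_derivative[OF bounded_linear_inner_left] by blast
      then show "((\<lambda>t. inner (D m t) e) has_real_derivative inner (D (Suc m) t) e) (at t)"
        by (simp add: has_real_derivative_iff_has_vector_derivative)
    qed
  qed (use n in auto)
  then obtain t where t: "0 < t" "t < 1" and eq: "inner (D 0 1) e = (\<Sum>m<n. inner (D m 0) e / fact m) + inner (D n t) e / fact n"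
    by auto
  have "norm R = inner R e"
    by (cases "R = 0") (simp_all add: e_def sgn_div_norm dot_square_norm power2_eq_square)
  also have "\<dots> = inner (D n t) e / fact n"
    using eq by (simp add: R_def inner_diff_left inner_sum_left divide_inverse mult.commute)
  also have "\<dots> \<le> K / fact n"
  proof (rule divide_right_mono)
    have "inner (D n t) e \<le> norm (D n t) * norm e" by (rule norm_cauchy_schwarz)
    also have "\<dots> \<le> norm (D n t) * 1" by (intro mult_left_mono) (auto simp: e_def norm_sgn)
    finally show "inner (D n t) e \<le> K" using K[of t] t by simp
  qed simp
  finally show ?thesis by (simp add: R_def)
qed

section \<open>Local parametrizations and tangent spaces\<close>

text \<open>Injectivity of the differential makes \<open>\<psi>\<close> bi-Lipschitz near x, and this turns the first-order
  expansion of \<open>\<psi>\<close> into one of its inverse.\<close>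

lemma local_parametrization_inverse:
  fixes \<psi> :: "'a::real_inner \<Rightarrow> 'b::real_inner"
  assumes V: "finite F" "V = span F" and S: "openin (top_of_set V) S" "x \<in> S"
    and M: "openin (top_of_set M) (\<psi> ` S)" and hom: "homeomorphism S (\<psi> ` S) \<psi> g"
    and \<psi>: "(\<psi> has_derivative A) (at x within S)" and inj: "inj_on A V"
  shows "\<exists>G. bounded_linear G \<and> (\<forall>y. G y \<in> V) \<and> (\<forall>v\<in>V. G (A v) = v) \<and>
    (g has_derivative G) (at (\<psi> x) within M)"
proof -
  obtain G where G: "bounded_linear G" "\<And>y. G y \<in> V" "\<And>v. v \<in> V \<Longrightarrow> G (A v) = v"
    using bounded_left_inverse[OF V has_derivative_linear[OF \<psi>] inj] by blast
  obtain K where K: "0 < K" "\<And>y. norm (G y) \<le> norm y * K"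
    using bounded_linear.pos_bounded[OF G(1)] by blast
  have gx: "g (\<psi> x) = x" using hom S(2) by (rule homeomorphism_apply1)
  have "(g has_derivative G) (at (\<psi> x) within M)"
    unfolding has_derivative_within_alt
  proof (intro conjI G(1) allI impI)
    fix e :: real assume e: "0 < e"
    define e' where "e' = min (1 / (2 * K)) (e / (2 * K * K))"
    have e': "0 < e'" "K * e' \<le> 1 / 2" "K * e' * (2 * K) \<le> e"
    proof -
      show "0 < e'" using e K(1) by (simp add: e'_def)
      have "K * e' \<le> K * (1 / (2 * K))" using K(1) by (intro mult_left_mono) (auto simp: e'_def)
      then show "K * e' \<le> 1 / 2" using K(1) by simp
      have "e' * (2 * K * K) \<le> e / (2 * K * K) * (2 * K * K)" using K(1) by (intro mult_right_mono) (auto simp: e'_def)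
      then show "K * e' * (2 * K) \<le> e" using K(1) by (simp add: mult_ac)
    qed
    obtain d where d: "0 < d" "\<And>y. y \<in> S \<Longrightarrow> norm (y - x) < d \<Longrightarrow> norm (\<psi> y - \<psi> x - A (y - x)) \<le> e' * norm (y - x)"
      using \<psi> e'(1) unfolding has_derivative_within_alt by blast
    have "continuous_on (\<psi> ` S) g" using hom by (simp add: homeomorphism_def)
    then obtain d1 where d1: "0 < d1" "\<And>y. y \<in> \<psi> ` S \<Longrightarrow> norm (y - \<psi> x) < d1 \<Longrightarrow> norm (g y - x) < d"
      using d(1) S(2) gx unfolding continuous_on_iff dist_norm by (metis imageI)
    obtain d2 where d2: "0 < d2" "\<And>y. y \<in> M \<Longrightarrow> norm (y - \<psi> x) < d2 \<Longrightarrow> y \<in> \<psi> ` S"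
      using M S(2) unfolding openin_euclidean_subtopology_iff dist_norm by (metis imageI)
    show "\<exists>d>0. \<forall>y\<in>M. norm (y - \<psi> x) < d \<longrightarrow> norm (g y - g (\<psi> x) - G (y - \<psi> x)) \<le> e * norm (y - \<psi> x)"
    proof (intro exI[of _ "min d1 d2"] conjI ballI impI)
      show "0 < min d1 d2" using d1 d2 by simp
      fix y assume y: "y \<in> M" "norm (y - \<psi> x) < min d1 d2"
      then have yS: "y \<in> \<psi> ` S" "norm (g y - x) < d" using d1 d2 by auto
      then have gy: "g y \<in> S" "\<psi> (g y) = y" using hom by (auto simp: homeomorphism_def)
      let ?D = "g y - x"
      have "g y \<in> V" "x \<in> V" using openin_imp_subset[OF S(1)] S(2) gy(1) by auto
      then have DV: "?D \<in> V" unfolding V(2) by (rule span_diff)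
      have "norm (G (y - \<psi> x) - ?D) = norm (G (y - \<psi> x - A ?D))"
        using G(3)[OF DV] by (simp add: linear_diff[OF bounded_linear.linear[OF G(1)]])
      also have "\<dots> \<le> norm (y - \<psi> x - A ?D) * K" by (rule K(2))
      also have "\<dots> \<le> (e' * norm ?D) * K" using d(2)[OF gy(1) yS(2)] gy(2) K(1) by (intro mult_right_mono) auto
      finally have 1: "norm (G (y - \<psi> x) - ?D) \<le> K * e' * norm ?D" by (simp add: mult_ac)
      also have "\<dots> \<le> 1 / 2 * norm ?D" using e'(2) by (intro mult_right_mono) auto
      finally have "norm (G (y - \<psi> x) - ?D) \<le> 1 / 2 * norm ?D" .
      moreover have "norm ?D \<le> norm (G (y - \<psi> x)) + norm (G (y - \<psi> x) - ?D)"
        using norm_triangle_ineq4[of "G (y - \<psi> x)" "G (y - \<psi> x) - ?D"] by simp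
      ultimately have "norm ?D \<le> 2 * K * norm (y - \<psi> x)" using K(2)[of "y - \<psi> x"] by (simp add: mult_ac)
      then have "K * e' * norm ?D \<le> K * e' * (2 * K * norm (y - \<psi> x))"
        using K(1) e'(1) by (intro mult_left_mono) auto
      also have "\<dots> \<le> e * norm (y - \<psi> x)"
        using mult_right_mono[OF e'(3), of "norm (y - \<psi> x)"] by (simp add: mult_ac)
      finally show "norm (g y - g (\<psi> x) - G (y - \<psi> x)) \<le> e * norm (y - \<psi> x)"
        using 1 gx by (simp add: norm_minus_commute)
    qed
  qed
  with G show ?thesis by (intro exI[of _ G]) simp
qed

text \<open>Velocities of curves in M are recovered by pulling the curves back to the parameter space, where
  the inverse parametrization is differentiable. In particular the tangent space is a linear
  subspace.\<close>

lemma tangent_space_local_parametrization: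
  fixes \<psi> :: "'a::real_inner \<Rightarrow> 'b::real_inner"
  assumes V: "finite F" "V = span F" and S: "openin (top_of_set V) S" "x \<in> S"
    and lp: "local_parametrization M S \<psi>"
    and \<psi>: "(\<psi> has_derivative A) (at x within S)" and inj: "inj_on A V"
  shows "tangent_space M (\<psi> x) = A ` V"
proof -
  obtain g where M: "openin (top_of_set M) (\<psi> ` S)" and hom: "homeomorphism S (\<psi> ` S) \<psi> g"
    using lp unfolding local_parametrization_def by blast
  obtain G where GV: "\<forall>y. G y \<in> V" and G: "(g has_derivative G) (at (\<psi> x) within M)"
    using local_parametrization_inverse[OF V S M hom \<psi> inj] by (elim exE conjE) rule
  have gx: "g (\<psi> x) = x" using hom S(2) by (rule homeomorphism_apply1)
  have hgy: "g y \<in> S" "\<psi> (g y) = y" if "y \<in> \<psi> ` S" for y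
    using hom that by (auto simp: homeomorphism_def)
  show ?thesis
  proof
    show "A ` V \<subseteq> tangent_space M (\<psi> x)"
    proof
      fix w assume "w \<in> A ` V"
      then obtain v where v: "v \<in> V" "w = A v" by blast
      have ev: "\<forall>\<^sub>F s in nhds (0::real). x + s *\<^sub>R v \<in> S"
        using S v V by (intro eventually_line_in_relatively_open[OF S(1)]) (auto dest: openin_imp_subset)
      then obtain e where e: "0 < e" "\<And>s. \<bar>s\<bar> < e \<Longrightarrow> x + s *\<^sub>R v \<in> S"
        unfolding eventually_nhds_metric by (auto simp: dist_real_def)
      have "((\<lambda>s. \<psi> (x + s *\<^sub>R v)) has_vector_derivative A v) (at 0)"
        by (rule has_vector_derivative_compose_within[OF _ _ ev]) (use \<psi> in \<open>auto intro!: derivative_eq_intros\<close>)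
      moreover have "(\<lambda>s. \<psi> (x + s *\<^sub>R v)) ` {-e<..<e} \<subseteq> M"
        using e(2) openin_imp_subset[OF M] by fastforce
      ultimately show "w \<in> tangent_space M (\<psi> x)"
        unfolding tangent_space_def using e(1) v(2)
        by (intro CollectI exI[of _ "\<lambda>s. \<psi> (x + s *\<^sub>R v)"] exI[of _ e]) auto
    qed
    show "tangent_space M (\<psi> x) \<subseteq> A ` V"
    proof
      fix w assume "w \<in> tangent_space M (\<psi> x)"
      then obtain \<gamma> e where \<gamma>: "0 < e" "\<gamma> 0 = \<psi> x" "\<gamma> ` {-e<..<e} \<subseteq> M" "(\<gamma> has_vector_derivative w) (at (0::real))"
        unfolding tangent_space_def by blast
      have evM: "\<forall>\<^sub>F s in nhds 0. \<gamma> s \<in> M"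
        unfolding eventually_nhds using \<gamma> by (intro exI[of _ "{-e<..<e}"]) auto
      have evS: "\<forall>\<^sub>F s in nhds 0. \<gamma> s \<in> \<psi> ` S"
        using \<gamma>(2) S(2) has_vector_derivative_continuous[OF \<gamma>(4)]
        by (intro eventually_in_relatively_open[OF M _ _ evM]) auto
      have 1: "((\<lambda>s. g (\<gamma> s)) has_vector_derivative G w) (at 0)"
        using has_vector_derivative_compose_within[OF _ \<gamma>(4) evM] G \<gamma>(2) by simp
      have evg: "\<forall>\<^sub>F s in nhds 0. g (\<gamma> s) \<in> S" and eq: "\<forall>\<^sub>F s in nhds 0. \<psi> (g (\<gamma> s)) = \<gamma> s"
        using evS by (auto elim!: eventually_mono simp: hgy)
      have "((\<lambda>s. \<psi> (g (\<gamma> s))) has_vector_derivative A (G w)) (at 0)"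
        by (rule has_vector_derivative_compose_within[OF _ 1 evg]) (use \<psi> gx \<gamma>(2) in simp)
      then have "(\<gamma> has_vector_derivative A (G w)) (at 0)"
        unfolding has_vector_derivative_def
        by (rule has_derivative_transform_eventually)
          (use eq \<gamma>(2) gx in \<open>auto simp: eventually_at_filter elim: eventually_mono\<close>)
      then show "w \<in> A ` V" using vector_derivative_unique_at[OF \<gamma>(4), of "A (G w)"] GV by simp
    qed
  qed
qed

section \<open>Graphs over a tangent space\<close>

text \<open>M is near p the graph of \<open>N\<close> over \<open>span E\<close>. The bounds \<open>L i\<close> on the differentials start at
  \<open>i = 2\<close>, so \<open>L 2\<close> is the bound on the second differential. That \<open>span E\<close> is the tangent space at p
  is derived below.\<close>

locale tangent_chart =
  fixes M :: "'a::real_inner set" and p :: 'a and E :: "'a set" and r :: real and N :: "'a \<Rightarrow> 'a"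
    and k :: nat and L :: "nat \<Rightarrow> real"
  assumes onb: "orthonormal_basis E"
    and k: "3 \<le> k"
    and L_pos: "\<And>i. i \<in> {2..k} \<Longrightarrow> 0 < L i"
    and r: "1 / (4 * L 2) \<le> r"
    and chart: "local_parametrization M (span E \<inter> ball 0 r) (\<lambda>v. p + v + N v)"
    and N_Ck: "Ck_on k (span E) (span E \<inter> ball 0 r) N"
    and N_0: "N 0 = 0"
    and dN_0: "(N has_derivative (\<lambda>u. 0)) (at 0 within span E \<inter> ball 0 r)"
    and N_bounds: "\<And>v i. v \<in> span E \<inter> ball 0 r \<Longrightarrow> norm v \<le> 1 / (4 * L 2) \<Longrightarrow> i \<in> {2..k} \<Longrightarrow>
      multilinear_norm (span E) i (higher_differential (span E \<inter> ball 0 r) N v) \<le> L i"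
begin

definition B where "B = span E \<inter> ball 0 r"

text \<open>The radius on which the differentials are controlled: \<open>L 2 * r0 = 1 / 4\<close> keeps the differential of
  the chart within 1/4 of the inclusion of the tangent space.\<close>

definition r0 where "r0 = 1 / (4 * L 2)"

definition H where "H = higher_differential B N"

definition \<psi> where "\<psi> v = p + v + N v"

text \<open>The component normal to M at p.\<close>

definition perp where "perp x = x - proj E x"

lemma L2_pos: "0 < L 2" and L3_pos: "0 < L 3"
  using L_pos k by auto

lemma r0_pos: "0 < r0" and r0_le: "r0 \<le> r" and L2_r0: "L 2 * r0 = 1 / 4"
  using L2_pos r by (auto simp: r0_def)

lemma open_B: "openin (top_of_set (span E)) B"
  unfolding B_def by (simp add: openin_open_Int)

lemma in_B: "v \<in> span E \<Longrightarrow> norm v < r0 \<Longrightarrow> v \<in> B"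
  using r0_le by (simp add: B_def)

lemma zero_in_B: "0 \<in> B"
  using r0_pos by (simp add: in_B span_zero)

lemma \<psi>_0: "\<psi> 0 = p"
  by (simp add: \<psi>_def N_0)

lemma chart_\<psi>: "local_parametrization M B \<psi>"
  using chart by (simp add: B_def \<psi>_def[abs_def])

lemma \<psi>_in_M: "v \<in> B \<Longrightarrow> \<psi> v \<in> M"
  using chart_\<psi> openin_imp_subset unfolding local_parametrization_def by blast

lemma p_in_M: "p \<in> M"
  using \<psi>_in_M[OF zero_in_B] \<psi>_0 by simp

lemma H_Nil: "H v [] = N v"
  by (simp add: H_def)

lemma H_multilinear: "v \<in> B \<Longrightarrow> i \<le> k \<Longrightarrow> multilinear_on (span E) i (H v)"
  unfolding H_def using N_Ck open_B
  by (intro multilinear_on_higher_differential[of _ _ k]) (simp_all add: B_def)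

lemma H_bound:
  assumes "v \<in> span E" "norm v < r0" "set us \<subseteq> span E" "length us \<in> {2..k}"
  shows "norm (H v us) \<le> L (length us) * prod_list (map norm us)"
proof -
  have v: "v \<in> B" using assms in_B by simp
  have "norm (H v us) \<le> multilinear_norm (span E) (length us) (H v) * prod_list (map norm us)"
    using assms v by (intro norm_le_multilinear_norm[OF onb] H_multilinear) auto
  also have "\<dots> \<le> L (length us) * prod_list (map norm us)"
  proof (rule mult_right_mono)
    show "multilinear_norm (span E) (length us) (H v) \<le> L (length us)"
      using N_bounds[of v "length us"] v assms by (simp add: H_def B_def r0_def)
    show "0 \<le> prod_list (map norm us)" by (induct us) auto
  qed
  finally show ?thesis .
qed

lemma H_curve:
  assumes "set us \<subseteq> span E" "length us < k"
    and c: "(c has_vector_derivative w) (at t)" and cT: "\<forall>\<^sub>F s in nhds t. c s \<in> span E"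
    and ct: "norm (c t) < r0"
  shows "((\<lambda>s. H (c s) us) has_vector_derivative H (c t) (w # us)) (at t)"
proof -
  have ctB: "c t \<in> B" using in_B[OF eventually_nhds_x_imp_x[OF cT] ct] .
  have "\<forall>\<^sub>F s in nhds t. c s \<in> B"
    using has_vector_derivative_continuous[OF c] cT
    by (intro eventually_in_relatively_open[where c = c, OF open_B ctB]) auto
  then show ?thesis
    unfolding H_def using N_Ck assms ctB
    by (intro higher_differential_curve[where V = "span E" and k = k]) (simp_all add: B_def)
qed

lemma H_line:
  assumes "set us \<subseteq> span E" "length us < k" "x \<in> span E" "z \<in> span E" "norm (x + t *\<^sub>R z) < r0"
  shows "((\<lambda>s. H (x + s *\<^sub>R z) us) has_vector_derivative H (x + t *\<^sub>R z) (z # us)) (at t)"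
proof (rule H_curve)
  show "((\<lambda>s. x + s *\<^sub>R z) has_vector_derivative z) (at t)"
    by (auto intro!: derivative_eq_intros)
qed (use assms in \<open>auto intro!: always_eventually span_add span_scale\<close>)

text \<open>The expansions of \<open>N\<close>, of its first and of its second differential in one statement: \<open>ws\<close> are the
  arguments of the differential that is expanded, n is the order of the remainder.\<close>

lemma H_Taylor:
  assumes n: "0 < n" "n + length ws \<in> {2..k}" and ws: "set ws \<subseteq> span E" and z: "z \<in> span E" "norm z < r0"
  shows "norm (H z ws - (\<Sum>m<n. H 0 (replicate m z @ ws) /\<^sub>R fact m))
    \<le> L (n + length ws) * norm z ^ n * prod_list (map norm ws) / fact n"
proof -
  let ?D = "\<lambda>m t. H (t *\<^sub>R z) (replicate m z @ ws)"
  have small: "norm (t *\<^sub>R z) < r0" if "0 \<le> t" "t \<le> 1" for t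
    using that z(2) mult_right_mono[of t 1 "norm z"] by auto
  have "norm (?D 0 1 - (\<Sum>m<n. ?D m 0 /\<^sub>R fact m))
    \<le> (L (n + length ws) * norm z ^ n * prod_list (map norm ws)) / fact n"
  proof (rule vector_Maclaurin_bound[OF n(1)])
    fix m and t :: real assume m: "m < n" and t: "0 \<le> t" "t \<le> 1"
    show "(?D m has_vector_derivative ?D (Suc m) t) (at t)"
    proof -
      have "set (replicate m z) \<subseteq> span E" using z by auto
      then show ?thesis
        using H_line[of "replicate m z @ ws" 0 z t] small[OF t] z n m ws by (simp add: span_zero)
    qed
  next
    fix t :: real assume t: "0 \<le> t" "t \<le> 1"
    have "prod_list (map norm (replicate n z @ ws)) = norm z ^ n * prod_list (map norm ws)"
      by (simp add: prod_list_replicate)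
    then show "norm (?D n t) \<le> L (n + length ws) * norm z ^ n * prod_list (map norm ws)"
      using H_bound[of "t *\<^sub>R z" "replicate n z @ ws"] small[OF t] z ws n by (auto simp: span_scale mult_ac)
  qed
  then show ?thesis by simp
qed

lemma H_0_single: "u \<in> span E \<Longrightarrow> H 0 [u] = 0"
  using frechet_derivative_within_unique[OF dN_0[folded B_def] open_B subspace_span zero_in_B]
  by (simp add: H_def)

lemma dN_bound: "z \<in> span E \<Longrightarrow> norm z < r0 \<Longrightarrow> w \<in> span E \<Longrightarrow> norm (H z [w]) \<le> L 2 * norm z * norm w"
  using H_Taylor[of 1 "[w]" z] k by (simp add: H_0_single numeral_2_eq_2)

lemma N_bound: "z \<in> span E \<Longrightarrow> norm z < r0 \<Longrightarrow> norm (N z) \<le> L 2 * norm z ^ 2 / 2"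
  using H_Taylor[of 2 "[]" z] k by (simp add: H_0_single H_Nil N_0 numeral_2_eq_2)

lemma dN_expand: "z \<in> span E \<Longrightarrow> norm z < r0 \<Longrightarrow> w \<in> span E \<Longrightarrow>
    norm (H z [w] - H 0 [z, w]) \<le> L 3 * norm z ^ 2 * norm w / 2"
  using H_Taylor[of 2 "[w]" z] k by (simp add: H_0_single numeral_2_eq_2 numeral_3_eq_3)

lemma d2N_expand: "z \<in> span E \<Longrightarrow> norm z < r0 \<Longrightarrow> v \<in> span E \<Longrightarrow> w \<in> span E \<Longrightarrow>
    norm (H z [v, w] - H 0 [v, w]) \<le> L 3 * norm z * norm v * norm w"
  using H_Taylor[of 1 "[v, w]" z] k by (simp add: numeral_3_eq_3 mult_ac)

lemma d2N_bound: "z \<in> span E \<Longrightarrow> norm z < r0 \<Longrightarrow> v \<in> span E \<Longrightarrow> w \<in> span E \<Longrightarrow>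
    norm (H z [v, w]) \<le> L 2 * norm v * norm w"
  using H_bound[of z "[v, w]"] k by (simp add: numeral_2_eq_2 mult_ac)

lemma \<psi>_derivative:
  assumes "z \<in> B"
  shows "(\<psi> has_derivative (\<lambda>w. w + H z [w])) (at z within B)"
proof -
  have "(N has_derivative (\<lambda>w. H z [w])) (at z within B)"
    using higher_differential_has_derivative[of k "span E" B N "[]" z] N_Ck k assms
    by (simp add: H_def B_def)
  then show ?thesis unfolding \<psi>_def[abs_def]
    by (auto intro!: derivative_eq_intros)
qed

lemma norm_d\<psi>_ge:
  assumes "z \<in> span E" "norm z < r0" "w \<in> span E"
  shows "3 / 4 * norm w \<le> norm (w + H z [w])"
proof -
  have "L 2 * norm z \<le> L 2 * r0" using assms L2_pos by (intro mult_left_mono) auto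
  then have "L 2 * norm z * norm w \<le> 1 / 4 * norm w" unfolding L2_r0 by (intro mult_right_mono) auto
  then have "norm (H z [w]) \<le> 1 / 4 * norm w" using dN_bound[OF assms] by simp
  moreover have "norm w \<le> norm (w + H z [w]) + norm (H z [w])"
    using norm_triangle_ineq4[of "w + H z [w]" "H z [w]"] by simp
  ultimately show ?thesis by simp
qed

lemma d\<psi>_inj:
  assumes "z \<in> span E" "norm z < r0"
  shows "inj_on (\<lambda>w. w + H z [w]) (span E)"
proof -
  have lin: "linear (\<lambda>w. w + H z [w])"
    using \<psi>_derivative[OF in_B[OF assms]] by (rule has_derivative_linear)
  show ?thesis
  proof (rule inj_onI)
    fix v w assume v: "v \<in> span E" "w \<in> span E" "v + H z [v] = w + H z [w]"
    then have "(v - w) + H z [v - w] = 0" using linear_diff[OF lin, of v w] by simp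
    then show "v = w" using norm_d\<psi>_ge[OF assms, of "v - w"] v by (simp add: span_diff)
  qed
qed

lemma tangent_space_\<psi>:
  assumes "z \<in> span E" "norm z < r0"
  shows "tangent_space M (\<psi> z) = (\<lambda>w. w + H z [w]) ` span E"
  using onb by (intro tangent_space_local_parametrization[OF _ refl open_B in_B[OF assms] chart_\<psi>
        \<psi>_derivative[OF in_B[OF assms]] d\<psi>_inj[OF assms]]) (simp add: orthonormal_basis_def)

lemma tangent_space_p: "tangent_space M p = span E"
  using tangent_space_\<psi>[of 0] r0_pos by (simp add: \<psi>_0 span_zero H_0_single)

end

section \<open>The second fundamental form\<close>

lemma has_vector_derivative_difference_quotient:
  fixes f :: "real \<Rightarrow> 'a::real_normed_vector"
  assumes "(f has_vector_derivative D) (at 0)"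
  shows "((\<lambda>h. (f h - f 0) /\<^sub>R h) \<longlongrightarrow> D) (at 0)"
proof -
  have "((\<lambda>h. norm (f h - f 0 - h *\<^sub>R D) / norm h) \<longlongrightarrow> 0) (at 0)"
    using assms unfolding has_vector_derivative_def has_derivative_at by simp
  moreover have "\<forall>\<^sub>F h in at (0::real). norm (f h - f 0 - h *\<^sub>R D) / norm h = norm ((f h - f 0) /\<^sub>R h - D)"
  proof (rule eventually_at_filter[THEN iffD2], rule always_eventually, intro allI impI)
    fix h :: real assume "h \<noteq> 0"
    then have "(f h - f 0) /\<^sub>R h - D = (f h - f 0 - h *\<^sub>R D) /\<^sub>R h" by (simp add: scaleR_right_diff_distrib)
    then show "norm (f h - f 0 - h *\<^sub>R D) / norm h = norm ((f h - f 0) /\<^sub>R h - D)"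
      by (simp add: divide_inverse mult.commute)
  qed
  ultimately have "((\<lambda>h. norm ((f h - f 0) /\<^sub>R h - D)) \<longlongrightarrow> 0) (at 0)"
    by (rule Lim_transform_eventually)
  then show ?thesis using Lim_null tendsto_norm_zero_iff by blast
qed

lemma zero_in_tangent_space: "q \<in> M \<Longrightarrow> 0 \<in> tangent_space M q"
  unfolding tangent_space_def by (intro CollectI exI[of _ "\<lambda>_. q"] exI[of _ 1]) auto

lemma curve_velocity_in_tangent_space:
  assumes "(c has_vector_derivative w) (at t)" "\<forall>\<^sub>F s in nhds (t::real). c s \<in> M"
  shows "w \<in> tangent_space M (c t)"
proof -
  obtain e where e: "0 < e" "\<And>s. dist s t < e \<Longrightarrow> c s \<in> M"
    using assms(2) unfolding eventually_nhds_metric by blast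
  have shift: "((\<lambda>s. t + s) has_vector_derivative 1) (at 0)"
    by (auto intro!: derivative_eq_intros)
  have "((\<lambda>s. c (t + s)) has_vector_derivative w) (at 0)"
    using vector_diff_chain_at[OF shift, of c w] assms(1) by (simp add: o_def)
  moreover have "(\<lambda>s. c (t + s)) ` {-e<..<e} \<subseteq> M" using e(2) by (auto simp: dist_real_def)
  ultimately show ?thesis unfolding tangent_space_def using e(1)
    by (intro CollectI exI[of _ "\<lambda>s. c (t + s)"] exI[of _ e]) auto
qed

context tangent_chart
begin

lemma linear_perp: "linear perp"
  unfolding perp_def[abs_def] using linear_compose_sub[OF linear_ident bounded_linear.linear[OF bounded_linear_proj]] .

lemma bounded_linear_perp: "bounded_linear perp"
  unfolding perp_def[abs_def] by (intro bounded_linear_sub bounded_linear_ident bounded_linear_proj)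

lemma norm_perp_le: "norm (perp x) \<le> norm x"
  unfolding perp_def by (rule norm_minus_proj_le[OF onb])

lemma perp_span: "x \<in> span E \<Longrightarrow> perp x = 0"
  by (simp add: perp_def proj_id[OF onb])

lemma inner_perp: "w \<in> span E \<Longrightarrow> inner (perp x) w = 0"
  by (simp add: perp_def inner_diff_left inner_proj[OF onb])

lemma diff_perp_in_span: "x - perp x \<in> span E"
  by (simp add: perp_def proj_in_span)

lemma perp_unique:
  assumes "\<And>z. z \<in> span E \<Longrightarrow> inner w z = 0" "x - w \<in> span E"
  shows "w = perp x"
proof -
  have "perp x - w \<in> span E"
    using span_diff[OF assms(2) diff_perp_in_span[of x]] by (simp add: algebra_simps)
  then have "inner (perp x - w) (perp x - w) = 0"
    using inner_perp assms(1) by (simp add: inner_diff_left)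
  then show ?thesis by simp
qed

lemma d2N_add_left: "a \<in> span E \<Longrightarrow> b \<in> span E \<Longrightarrow> v \<in> span E \<Longrightarrow> H 0 [a + c *\<^sub>R b, v] = H 0 [a, v] + c *\<^sub>R H 0 [b, v]"
  using multilinear_onD[OF H_multilinear[OF zero_in_B, of 2], of "[]" "[v]" a b c] k by simp

lemma d2N_add_right: "a \<in> span E \<Longrightarrow> b \<in> span E \<Longrightarrow> v \<in> span E \<Longrightarrow> H 0 [v, a + c *\<^sub>R b] = H 0 [v, a] + c *\<^sub>R H 0 [v, b]"
  using multilinear_onD[OF H_multilinear[OF zero_in_B, of 2], of "[v]" "[]" a b c] k by simp

lemma inverse_chart:
  "\<exists>g. g p = 0 \<and> (\<forall>z\<in>B. g (\<psi> z) = z) \<and> (\<forall>q\<in>\<psi> ` B. g q \<in> B \<and> \<psi> (g q) = q) \<and>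
    (\<forall>z\<in>span E. norm z < r0 \<longrightarrow> (\<exists>G. (g has_derivative G) (at (\<psi> z) within M) \<and>
      (\<forall>w\<in>span E. G (w + H z [w]) = w)))"
proof -
  obtain g where g: "homeomorphism B (\<psi> ` B) \<psi> g" and op: "openin (top_of_set M) (\<psi> ` B)"
    using chart_\<psi> unfolding local_parametrization_def by blast
  have g\<psi>: "g (\<psi> z) = z" if "z \<in> B" for z using homeomorphism_apply1[OF g that] .
  have "\<exists>G. (g has_derivative G) (at (\<psi> z) within M) \<and> (\<forall>w\<in>span E. G (w + H z [w]) = w)"
    if z: "z \<in> span E" "norm z < r0" for z
    using local_parametrization_inverse[OF _ refl open_B in_B[OF z] op g \<psi>_derivative[OF in_B[OF z]] d\<psi>_inj[OF z]] onb
    by (auto simp: orthonormal_basis_def)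
  moreover have "g p = 0" using g\<psi>[OF zero_in_B] \<psi>_0 by simp
  ultimately show ?thesis using g\<psi> by (intro exI[of _ g]) auto
qed

text \<open>Near p a tangent vector at \<open>\<psi> z\<close> has the form \<open>w + H z [w]\<close> with w tangent at p, so its component
  normal at p is that of \<open>H z [w]\<close>, which is \<open>H 0 [z, w]\<close> up to \<open>O(|z|\<^sup>2)\<close>. Along the curve \<open>z = h u + o(h)\<close> and w
  tends to \<open>Y 0\<close>. The lemma covers tangent fields restricted to a curve as well as the velocity
  of the curve itself.\<close>

lemma perp_derivative_of_tangent_field_along_curve:
  assumes c0: "c 0 = p" and cM: "\<forall>\<^sub>F h in nhds (0::real). c h \<in> M"
    and c: "(c has_vector_derivative u) (at 0)"
    and Y: "(Y has_vector_derivative y') (at 0)"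
    and YT: "\<forall>\<^sub>F h in nhds 0. Y h \<in> tangent_space M (c h)"
  shows "perp y' = perp (H 0 [u, Y 0])"
proof -
  obtain g where g0: "g p = 0" and gB: "\<forall>q\<in>\<psi> ` B. g q \<in> B \<and> \<psi> (g q) = q"
    and dg: "\<forall>z\<in>span E. norm z < r0 \<longrightarrow> (\<exists>G. (g has_derivative G) (at (\<psi> z) within M) \<and>
      (\<forall>w\<in>span E. G (w + H z [w]) = w))"
    using inverse_chart by (elim exE conjE) rule
  have u: "u \<in> span E" using curve_velocity_in_tangent_space[OF c cM] c0 tangent_space_p by simp
  have Y0: "Y 0 \<in> span E" using eventually_nhds_x_imp_x[OF YT] c0 tangent_space_p by simp
  define z where "z = (\<lambda>h. g (c h))"
  have z0: "z 0 = 0" by (simp add: z_def c0 g0)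
  obtain G where G: "(g has_derivative G) (at p within M)" "\<And>w. w \<in> span E \<Longrightarrow> G (w + H 0 [w]) = w"
    using dg[rule_format, OF span_zero] r0_pos \<psi>_0 by auto
  have dz: "(z has_vector_derivative u) (at 0)"
    using has_vector_derivative_compose_within[of g G c 0 M, OF _ c cM] G(1) G(2)[OF u] c0
    by (simp add: z_def H_0_single[OF u])
  have zlim: "(z \<longlongrightarrow> 0) (at 0)"
    using has_vector_derivative_continuous[OF dz] z0 by (simp add: continuous_within)
  have z_quot: "((\<lambda>h. z h /\<^sub>R h) \<longlongrightarrow> u) (at 0)"
    using has_vector_derivative_difference_quotient[OF dz] z0 by simp
  have ev1: "\<forall>\<^sub>F h in at 0. z h \<in> B \<and> \<psi> (z h) = c h"
  proof -
    have op: "openin (top_of_set M) (\<psi> ` B)" using chart_\<psi> by (simp add: local_parametrization_def)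
    have "c 0 \<in> \<psi> ` B" using zero_in_B \<psi>_0 c0 by (metis imageI)
    then have "\<forall>\<^sub>F h in nhds 0. c h \<in> \<psi> ` B"
      using eventually_in_relatively_open[of M "\<psi> ` B" c 0, OF op _ has_vector_derivative_continuous[OF c] cM] by simp
    then have "\<forall>\<^sub>F h in nhds 0. z h \<in> B \<and> \<psi> (z h) = c h"
      by (rule eventually_mono) (use gB in \<open>auto simp: z_def\<close>)
    then show ?thesis by (simp add: eventually_at_filter eventually_mono)
  qed
  have ev2: "\<forall>\<^sub>F h in at 0. norm (z h) < r0"
    using order_tendstoD(2)[OF tendsto_norm[OF zlim], of r0] r0_pos by simp
  have ev3: "\<forall>\<^sub>F h in at 0. Y h \<in> tangent_space M (c h)" using YT by (simp add: eventually_at_filter eventually_mono)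
  have ev0: "\<forall>\<^sub>F h in at (0::real). h \<noteq> 0" by (simp add: eventually_at_filter)
  \<comment> \<open>The three terms bound the error of linearizing the differential of N, the error of
    \<open>z h / h \<rightarrow> u\<close>, and the error of \<open>w \<rightarrow> Y 0\<close>.\<close>
  define b where "b = (\<lambda>h. L 3 * norm (z h /\<^sub>R h) * norm (z h) * norm (Y h)
     + L 2 * norm (z h /\<^sub>R h - u) * (2 * norm (Y h))
     + L 2 * norm u * (norm (Y h - Y 0) + L 2 * norm (z h) * (2 * norm (Y h))))"
  have Ylim: "(Y \<longlongrightarrow> Y 0) (at 0)"
    using has_vector_derivative_continuous[OF Y] by (simp add: continuous_within)
  have "(b \<longlongrightarrow> L 3 * norm u * norm (0::'a) * norm (Y 0) + L 2 * norm (u - u) * (2 * norm (Y 0))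
     + L 2 * norm u * (norm (Y 0 - Y 0) + L 2 * norm (0::'a) * (2 * norm (Y 0)))) (at 0)"
    unfolding b_def by (intro tendsto_intros z_quot zlim Ylim)
  then have b0: "(b \<longlongrightarrow> 0) (at 0)" by simp
  have main: "\<forall>\<^sub>F h in at 0. norm (perp ((Y h - Y 0) /\<^sub>R h) - perp (H 0 [u, Y 0])) \<le> b h"
    using ev0 ev1 ev2 ev3
  proof eventually_elim
    case (elim h)
    then have zh: "z h \<in> span E" "norm (z h) < r0" by (auto simp: B_def)
    have "Y h \<in> (\<lambda>w. w + H (z h) [w]) ` span E"
      using tangent_space_\<psi>[OF zh] elim by simp
    then obtain w where w: "w \<in> span E" "Y h = w + H (z h) [w]" by blast
    have wY: "norm w \<le> 2 * norm (Y h)" using norm_d\<psi>_ge[OF zh w(1)] norm_ge_zero[of w] unfolding w(2)[symmetric] by linarith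
    have wY0: "norm (w - Y 0) \<le> norm (Y h - Y 0) + L 2 * norm (z h) * (2 * norm (Y h))"
    proof -
      have "norm (H (z h) [w]) \<le> L 2 * norm (z h) * norm w" using dN_bound[OF zh w(1)] .
      also have "\<dots> \<le> L 2 * norm (z h) * (2 * norm (Y h))" using wY L2_pos by (intro mult_left_mono) auto
      finally have "norm (H (z h) [w]) \<le> L 2 * norm (z h) * (2 * norm (Y h))" .
      moreover have eq: "w - Y 0 = (Y h - Y 0) - H (z h) [w]" using w(2) by simp
      ultimately show ?thesis
        unfolding eq using norm_triangle_ineq4[of "Y h - Y 0" "H (z h) [w]"] by linarith
    qed
    have zq: "z h /\<^sub>R h \<in> span E" "z h /\<^sub>R h - u \<in> span E" "w - Y 0 \<in> span E" using zh u w Y0 by (auto simp: span_scale span_diff)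
    have eq: "perp ((Y h - Y 0) /\<^sub>R h) = perp (H (z h) [w]) /\<^sub>R h"
      using perp_span[OF w(1)] perp_span[OF Y0]
      by (simp add: w(2) linear_cmul[OF linear_perp] linear_add[OF linear_perp] linear_diff[OF linear_perp])
    have "norm (perp ((Y h - Y 0) /\<^sub>R h) - perp (H 0 [u, Y 0])) = norm (perp (H (z h) [w] /\<^sub>R h - H 0 [u, Y 0]))"
      unfolding eq by (simp add: linear_cmul[OF linear_perp] linear_diff[OF linear_perp])
    also have "\<dots> \<le> norm (H (z h) [w] /\<^sub>R h - H 0 [u, Y 0])" by (rule norm_perp_le)
    also have "H (z h) [w] /\<^sub>R h - H 0 [u, Y 0] = (H (z h) [w] - H 0 [z h, w]) /\<^sub>R h + H 0 [z h /\<^sub>R h - u, w] + H 0 [u, w - Y 0]"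
    proof -
      have "H 0 [z h /\<^sub>R h - u, w] = H 0 [z h, w] /\<^sub>R h - H 0 [u, w]"
        using d2N_add_left[of "z h /\<^sub>R h" u w "-1"] d2N_add_left[of 0 "z h" w "inverse h"] d2N_add_left[of 0 0 w 1] zq zh u w
        by (simp add: span_zero)
      moreover have "H 0 [u, w - Y 0] = H 0 [u, w] - H 0 [u, Y 0]"
        using d2N_add_right[of w "Y 0" u "-1"] u w Y0 by simp
      ultimately show ?thesis by (simp add: scaleR_right_diff_distrib)
    qed
    also have "norm \<dots> \<le> norm ((H (z h) [w] - H 0 [z h, w]) /\<^sub>R h) + norm (H 0 [z h /\<^sub>R h - u, w]) + norm (H 0 [u, w - Y 0])"
      by (rule order_trans[OF norm_triangle_ineq add_right_mono[OF norm_triangle_ineq]])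
    also have "\<dots> \<le> b h" unfolding b_def
    proof (intro add_mono)
      have "norm ((H (z h) [w] - H 0 [z h, w]) /\<^sub>R h) = norm (H (z h) [w] - H 0 [z h, w]) / \<bar>h\<bar>"
        by (simp add: divide_inverse mult.commute)
      also have "\<dots> \<le> (L 3 * norm (z h) ^ 2 * norm w / 2) / \<bar>h\<bar>"
        using dN_expand[OF zh w(1)] by (intro divide_right_mono) auto
      also have "\<dots> \<le> (L 3 * norm (z h) ^ 2 * (2 * norm (Y h)) / 2) / \<bar>h\<bar>"
        using wY L3_pos by (intro divide_right_mono mult_left_mono) auto
      also have "\<dots> = L 3 * (norm (z h) / \<bar>h\<bar>) * norm (z h) * norm (Y h)"
        by (simp add: power2_eq_square)
      also have "norm (z h) / \<bar>h\<bar> = norm (z h /\<^sub>R h)"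
        by (simp add: divide_inverse mult.commute)
      finally show "norm ((H (z h) [w] - H 0 [z h, w]) /\<^sub>R h) \<le> L 3 * norm (z h /\<^sub>R h) * norm (z h) * norm (Y h)" .
      have "norm (H 0 [z h /\<^sub>R h - u, w]) \<le> L 2 * norm (z h /\<^sub>R h - u) * norm w"
        using d2N_bound[of 0] zq w r0_pos by (simp add: span_zero)
      also have "\<dots> \<le> L 2 * norm (z h /\<^sub>R h - u) * (2 * norm (Y h))" using wY L2_pos by (intro mult_left_mono) auto
      finally show "norm (H 0 [z h /\<^sub>R h - u, w]) \<le> L 2 * norm (z h /\<^sub>R h - u) * (2 * norm (Y h))" .
      have "norm (H 0 [u, w - Y 0]) \<le> L 2 * norm u * norm (w - Y 0)"
        using d2N_bound[of 0] zq u r0_pos by (simp add: span_zero)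
      also have "\<dots> \<le> L 2 * norm u * (norm (Y h - Y 0) + L 2 * norm (z h) * (2 * norm (Y h)))"
        using wY0 L2_pos by (intro mult_left_mono) auto
      finally show "norm (H 0 [u, w - Y 0]) \<le> L 2 * norm u * (norm (Y h - Y 0) + L 2 * norm (z h) * (2 * norm (Y h)))" .
    qed
    finally show ?case .
  qed
  have "((\<lambda>h. perp ((Y h - Y 0) /\<^sub>R h)) \<longlongrightarrow> perp y') (at 0)"
    by (rule bounded_linear.tendsto[OF bounded_linear_perp has_vector_derivative_difference_quotient[OF Y]])
  moreover have "((\<lambda>h. perp ((Y h - Y 0) /\<^sub>R h)) \<longlongrightarrow> perp (H 0 [u, Y 0])) (at 0)"
    by (rule LIM_zero_cancel, rule Lim_null_comparison[OF main b0])
  ultimately show ?thesis by (rule tendsto_unique[OF at_neq_bot])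
qed

end

lemma DERIV_max_square: "((\<lambda>s::real. (max 0 s)\<^sup>2) has_real_derivative 2 * max 0 s) (at s)"
proof -
  consider "s > 0" | "s < 0" | "s = 0" by linarith
  then show ?thesis
  proof cases
    case 1
    have "((\<lambda>s. s\<^sup>2) has_real_derivative 2 * max 0 s) (at s)"
      using 1 by (auto intro!: derivative_eq_intros)
    then show ?thesis
      by (rule has_field_derivative_transform_within_open[of _ _ _ "{0<..}"]) (use 1 in auto)
  next
    case 2
    have "((\<lambda>s. 0) has_real_derivative 2 * max 0 s) (at s)"
      using 2 by (auto intro!: derivative_eq_intros)
    then show ?thesis
      by (rule has_field_derivative_transform_within_open[of _ _ _ "{..<0}"]) (use 2 in auto)
  next
    case 3
    have "((\<lambda>h::real. (max 0 h)\<^sup>2 / h) \<longlongrightarrow> 0) (at 0)"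
    proof (rule Lim_null_comparison)
      have "norm ((max 0 h)\<^sup>2 / h) \<le> \<bar>h\<bar>" for h :: real
        by (cases "h > 0") (auto simp: power2_eq_square max_def)
      then show "\<forall>\<^sub>F h in at 0. norm ((max 0 h)\<^sup>2 / h) \<le> \<bar>h\<bar>" by (intro always_eventually) blast
      show "((\<lambda>h::real. \<bar>h\<bar>) \<longlongrightarrow> 0) (at 0)" by (rule tendsto_rabs_zero) (rule tendsto_ident_at)
    qed
    then show ?thesis using 3 by (simp add: DERIV_def)
  qed
qed

context tangent_chart
begin

lemma open_\<psi>_ball:
  assumes "s \<le> r"
  shows "openin (top_of_set M) (\<psi> ` (span E \<inter> ball 0 s))"
proof -
  obtain g where g: "homeomorphism B (\<psi> ` B) \<psi> g" and op: "openin (top_of_set M) (\<psi> ` B)"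
    using chart_\<psi> unfolding local_parametrization_def by blast
  have "span E \<inter> ball 0 s = B \<inter> ball 0 s" using assms by (auto simp: B_def)
  then have "openin (top_of_set B) (span E \<inter> ball 0 s)" by (simp add: openin_open_Int)
  then have "openin (top_of_set (\<psi> ` B)) (\<psi> ` (span E \<inter> ball 0 s))"
    by (rule homeomorphism_imp_open_map[OF g])
  then show ?thesis using op by (rule openin_trans)
qed

text \<open>The pushforward of the constant field v under the chart, multiplied by a differentiable bump
  function supported in the chart.\<close>

lemma tangent_field_exists:
  assumes v: "v \<in> span E"
  shows "\<exists>X. tangent_field M X \<and> X p = v"
proof -
  let ?B = "span E \<inter> ball 0 r0"
  obtain g where g0: "g p = 0" and g\<psi>: "\<forall>z\<in>B. g (\<psi> z) = z"
    and dg: "\<forall>z\<in>span E. norm z < r0 \<longrightarrow> (\<exists>G. (g has_derivative G) (at (\<psi> z) within M) \<and>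
      (\<forall>w\<in>span E. G (w + H z [w]) = w))"
    using inverse_chart by (elim exE conjE) rule
  have "p \<in> \<psi> ` ?B" using r0_pos \<psi>_0 by (intro image_eqI[of _ _ 0]) (auto simp: span_zero)
  then obtain \<rho>' where \<rho>': "0 < \<rho>'" "\<And>q. q \<in> M \<Longrightarrow> dist q p < \<rho>' \<Longrightarrow> q \<in> \<psi> ` ?B"
    using open_\<psi>_ball[OF r0_le] unfolding openin_euclidean_subtopology_iff by blast
  \<comment> \<open>Half the radius: around points outside the support of the bump function the field must vanish
    on a full neighbourhood, around the other points the chart must be available.\<close>
  define \<rho> where "\<rho> = \<rho>' / 2"
  have \<rho>: "0 < \<rho>" "\<rho>' = 2 * \<rho>" using \<rho>' by (auto simp: \<rho>_def)
  have gq: "g q \<in> span E \<and> norm (g q) < r0 \<and> \<psi> (g q) = q" if q: "q \<in> M" "dist q p < 2 * \<rho>" for q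
  proof -
    obtain z where z: "z \<in> ?B" "q = \<psi> z" using \<rho>'(2)[of q] q \<rho> by auto
    then have "g q = z" using g\<psi> in_B[of z] by simp
    then show ?thesis using z by simp
  qed
  \<comment> \<open>The square of the positive part makes the bump function differentiable where it vanishes.\<close>
  define \<phi> where "\<phi> q = (max 0 (\<rho>\<^sup>2 - inner (q - p) (q - p)))\<^sup>2 / \<rho> ^ 4" for q
  have \<phi>_diff: "\<phi> differentiable (at q within S)" for q S
  proof -
    have "((\<lambda>q. \<rho>\<^sup>2 - inner (q - p) (q - p)) has_derivative (\<lambda>u. - (inner (q - p) u + inner u (q - p)))) (at q within S)"
      by (auto intro!: derivative_eq_intros)
    moreover have "((\<lambda>s::real. (max 0 s)\<^sup>2) has_derivative (*) (2 * max 0 (\<rho>\<^sup>2 - inner (q - p) (q - p)))) (at (\<rho>\<^sup>2 - inner (q - p) (q - p)))"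
      using DERIV_max_square unfolding has_field_derivative_def .
    ultimately have "((\<lambda>q. (max 0 (\<rho>\<^sup>2 - inner (q - p) (q - p)))\<^sup>2) has_derivative
      (\<lambda>u. 2 * max 0 (\<rho>\<^sup>2 - inner (q - p) (q - p)) * - (inner (q - p) u + inner u (q - p)))) (at q within S)"
      by (rule has_derivative_compose)
    then have "(\<lambda>q. (max 0 (\<rho>\<^sup>2 - inner (q - p) (q - p)))\<^sup>2) differentiable (at q within S)"
      by (rule differentiableI)
    then have "(\<lambda>q. (max 0 (\<rho>\<^sup>2 - inner (q - p) (q - p)))\<^sup>2 * (1 / \<rho> ^ 4)) differentiable (at q within S)"
      by (intro differentiable_mult) auto
    then show ?thesis by (simp add: \<phi>_def[abs_def])
  qed
  have \<phi>_0: "\<phi> q = 0" if "\<rho> \<le> dist q p" for q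
  proof -
    have "\<rho>\<^sup>2 \<le> (dist q p)\<^sup>2" using that \<rho> by (intro power_mono) auto
    then show ?thesis by (simp add: \<phi>_def dist_norm power2_norm_eq_inner)
  qed
  have \<phi>_p: "\<phi> p = 1" using \<rho> by (simp add: \<phi>_def)
  define X where "X q = \<phi> q *\<^sub>R (v + H (g q) [v])" for q
  have "X p = v" using \<phi>_p g0 H_0_single[OF v] by (simp add: X_def)
  moreover have "tangent_field M X"
    unfolding tangent_field_def
  proof (intro conjI ballI)
    fix q assume q: "q \<in> M"
    show "X q \<in> tangent_space M q"
    proof (cases "dist q p < \<rho>")
      case True
      then have z: "g q \<in> span E" "norm (g q) < r0" "\<psi> (g q) = q" using gq[OF q] \<rho> by auto
      have "linear (\<lambda>w. w + H (g q) [w])" using \<psi>_derivative[OF in_B[OF z(1,2)]] by (rule has_derivative_linear)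
      from linear_cmul[OF this, of "\<phi> q" v] have "X q = \<phi> q *\<^sub>R v + H (g q) [\<phi> q *\<^sub>R v]" by (simp add: X_def)
      then have "X q \<in> (\<lambda>w. w + H (g q) [w]) ` span E" using v by (auto intro: span_scale)
      then show ?thesis using tangent_space_\<psi>[OF z(1,2)] z(3) by simp
    next
      case False
      then have "X q = 0" using \<phi>_0 by (simp add: X_def)
      then show ?thesis using zero_in_tangent_space[OF q] by simp
    qed
    show "X differentiable (at q within M)"
    proof (cases "dist q p < 2 * \<rho>")
      case True
      let ?U = "M \<inter> ball p (2 * \<rho>)"
      have z: "g q \<in> span E" "norm (g q) < r0" "\<psi> (g q) = q" using gq[OF q True] by auto
      obtain G where "(g has_derivative G) (at q within M)" using dg z by metis
      then have G: "(g has_derivative G) (at q within ?U)" by (rule has_derivative_subset) simp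
      have gU: "g ` ?U \<subseteq> B" using gq in_B by (auto simp: dist_commute)
      have "((\<lambda>y. H y [v]) has_derivative (\<lambda>u. H (g q) [u, v])) (at (g q) within B)"
        unfolding H_def using N_Ck k v in_B[OF z(1,2)]
        by (intro higher_differential_has_derivative[of k "span E"]) (simp_all add: B_def)
      then have "((\<lambda>y. H y [v]) has_derivative (\<lambda>u. H (g q) [u, v])) (at (g q) within g ` ?U)"
        using gU by (rule has_derivative_subset)
      from diff_chain_within[OF G this]
      have "(\<lambda>q. H (g q) [v]) differentiable (at q within ?U)"
        unfolding o_def by (rule differentiableI)
      then have "X differentiable (at q within ?U)"
        unfolding X_def[abs_def] by (intro differentiable_scaleR \<phi>_diff differentiable_add) auto
      moreover have "at q within M = at q within ?U"
        by (rule at_within_nhd[of _ "ball p (2 * \<rho>)"]) (use True in \<open>auto simp: dist_commute\<close>)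
      ultimately show ?thesis by simp
    next
      case False
      have "((\<lambda>q. 0) has_derivative (\<lambda>u. 0)) (at q within M)" by simp
      then have "(X has_derivative (\<lambda>u. 0)) (at q within M)"
      proof (rule has_derivative_transform_within[OF _ \<rho>(1) q])
        fix q' assume "q' \<in> M" "dist q' q < \<rho>"
        then have "\<rho> \<le> dist q' p" using False dist_triangle[of q p q'] by (simp add: dist_commute)
        then show "0 = X q'" using \<phi>_0 by (simp add: X_def)
      qed
      then show ?thesis by (rule differentiableI)
    qed
  qed
  ultimately show ?thesis by blast
qed

text \<open>Any tangent field with value v at p, restricted to the curve with parameters \<open>h u\<close>, falls under
  \<open>perp_derivative_of_tangent_field_along_curve\<close>.\<close>

lemma second_fundamental_form_eq:
  assumes u: "u \<in> span E" and v: "v \<in> span E"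
  shows "second_fundamental_form M p u v = perp (H 0 [u, v])"
proof -
  have perp_D: "perp (frechet_derivative X (at p within M) u) = perp (H 0 [u, v])"
    if X: "tangent_field M X" "X p = v" for X
  proof -
    define c where "c h = \<psi> (0 + h *\<^sub>R u)" for h :: real
    have ev: "\<forall>\<^sub>F h in nhds 0. 0 + h *\<^sub>R u \<in> B"
      using u zero_in_B by (intro eventually_line_in_relatively_open[OF open_B]) (auto simp: span_zero)
    have c0: "c 0 = p" by (simp add: c_def \<psi>_0)
    have cM: "\<forall>\<^sub>F h in nhds 0. c h \<in> M" unfolding c_def using ev by eventually_elim (rule \<psi>_in_M)
    have "((\<lambda>h. 0 + h *\<^sub>R u) has_vector_derivative u) (at 0)"
      by (auto intro!: derivative_eq_intros)
    then have "(c has_vector_derivative u + H 0 [u]) (at 0)"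
      unfolding c_def using has_vector_derivative_compose_within[of \<psi> "\<lambda>w. w + H 0 [w]" "\<lambda>h. 0 + h *\<^sub>R u" 0 B u]
        \<psi>_derivative[OF zero_in_B] ev by simp
    then have dc: "(c has_vector_derivative u) (at 0)" using H_0_single[OF u] by simp
    have "(X has_derivative frechet_derivative X (at p within M)) (at p within M)"
      using X(1) p_in_M frechet_derivative_works unfolding tangent_field_def by blast
    then have dY: "((\<lambda>h. X (c h)) has_vector_derivative frechet_derivative X (at p within M) u) (at 0)"
      using has_vector_derivative_compose_within[OF _ dc cM, of X] c0 by simp
    have "\<forall>\<^sub>F h in nhds 0. X (c h) \<in> tangent_space M (c h)"
      using cM by eventually_elim (use X(1) in \<open>simp add: tangent_field_def\<close>)
    from perp_derivative_of_tangent_field_along_curve[OF c0 cM dc dY this] show ?thesis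
      using c0 X(2) by simp
  qed
  show ?thesis
    unfolding second_fundamental_form_def tangent_space_p
  proof (rule the_equality)
    obtain X where X: "tangent_field M X" "X p = v" using tangent_field_exists[OF v] by blast
    have "frechet_derivative X (at p within M) u - perp (H 0 [u, v]) \<in> span E"
      using diff_perp_in_span[of "frechet_derivative X (at p within M) u"] perp_D[OF X] by simp
    then show "\<exists>X. tangent_field M X \<and> X p = v \<and> (\<forall>z\<in>span E. orthogonal (perp (H 0 [u, v])) z) \<and>
      frechet_derivative X (at p within M) u - perp (H 0 [u, v]) \<in> span E"
      using X inner_perp by (auto simp: orthogonal_def)
  next
    fix w assume "\<exists>X. tangent_field M X \<and> X p = v \<and> (\<forall>z\<in>span E. orthogonal w z) \<and>
      frechet_derivative X (at p within M) u - w \<in> span E"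
    then obtain X where X: "tangent_field M X" "X p = v" and w: "\<forall>z\<in>span E. orthogonal w z"
      "frechet_derivative X (at p within M) u - w \<in> span E" by blast
    have "w = perp (frechet_derivative X (at p within M) u)"
      using w by (intro perp_unique) (auto simp: orthogonal_def)
    then show "w = perp (H 0 [u, v])" using perp_D[OF X] by simp
  qed
qed

lemma second_fundamental_norm_eq: "second_fundamental_norm M p = multilinear_norm (span E) 2 (\<lambda>us. perp (H 0 us))"
  unfolding second_fundamental_norm_def multilinear_norm_def tangent_space_p
proof (rule SUP_cong[OF refl])
  fix us assume us: "us \<in> {us. length us = 2 \<and> set us \<subseteq> span E \<inter> cball 0 1}"
  then obtain a b where "us = [a, b]" by (auto simp: numeral_2_eq_2 length_Suc_conv)
  then show "norm (second_fundamental_form M p (us ! 0) (us ! 1)) = norm (perp (H 0 us))"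
    using second_fundamental_form_eq[of a b] us by simp
qed

lemma perp_H_multilinear: "multilinear_on (span E) 2 (\<lambda>us. perp (H 0 us))"
  using H_multilinear[OF zero_in_B, of 2] k unfolding multilinear_on_def
  by (simp add: linear_add[OF linear_perp] linear_cmul[OF linear_perp])

lemma second_fundamental_form_bound:
  assumes "u \<in> span E" "v \<in> span E"
  shows "norm (perp (H 0 [u, v])) \<le> second_fundamental_norm M p * norm u * norm v"
  using norm_le_multilinear_norm[OF onb perp_H_multilinear, of "[u, v]"] assms
  by (simp add: second_fundamental_norm_eq mult_ac)

lemma second_fundamental_norm_leI:
  assumes "\<And>u v. u \<in> span E \<Longrightarrow> v \<in> span E \<Longrightarrow> norm u \<le> 1 \<Longrightarrow> norm v \<le> 1 \<Longrightarrow> norm (perp (H 0 [u, v])) \<le> \<mu>"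
  shows "second_fundamental_norm M p \<le> \<mu>"
  unfolding second_fundamental_norm_eq multilinear_norm_def
proof (rule cSUP_least)
  have "[0, 0] \<in> {us. length us = 2 \<and> set us \<subseteq> span E \<inter> cball 0 1}" by (simp add: span_zero)
  then show "{us. length us = 2 \<and> set us \<subseteq> span E \<inter> cball 0 1} \<noteq> {}" by blast
  fix us assume us: "us \<in> {us. length us = 2 \<and> set us \<subseteq> span E \<inter> cball 0 1}"
  then obtain a b where "us = [a, b]" by (auto simp: numeral_2_eq_2 length_Suc_conv)
  then show "norm (perp (H 0 us)) \<le> \<mu>" using assms[of a b] us by simp
qed

lemma second_fundamental_norm_nonneg: "0 \<le> second_fundamental_norm M p"
proof -
  let ?I = "{us. length us = 2 \<and> set us \<subseteq> span E \<inter> cball 0 1}"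
  have I: "[0, 0] \<in> ?I" by (simp add: span_zero)
  have "bdd_above ((\<lambda>us. norm (perp (H 0 us))) ` ?I)"
    using multilinear_on_bounded[OF onb perp_H_multilinear] by (auto simp: bdd_above_def)
  then have "norm (perp (H 0 [0, 0])) \<le> multilinear_norm (span E) 2 (\<lambda>us. perp (H 0 us))"
    unfolding multilinear_norm_def by (rule cSUP_upper[OF I])
  then show ?thesis using second_fundamental_norm_eq norm_ge_zero order_trans by metis
qed

lemma second_fundamental_norm_le: "second_fundamental_norm M p \<le> L 2"
proof (rule second_fundamental_norm_leI)
  fix u v assume uv: "u \<in> span E" "v \<in> span E" "norm u \<le> 1" "norm v \<le> 1"
  have "norm (perp (H 0 [u, v])) \<le> norm (H 0 [u, v])" by (rule norm_perp_le)
  also have "\<dots> \<le> L 2 * norm u * norm v" using d2N_bound[of 0 u v] uv r0_pos by (simp add: span_zero)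
  also have "\<dots> = L 2 * (norm u * norm v)" by simp
  also have "\<dots> \<le> L 2 * (1 * 1)" using uv L2_pos by (intro mult_left_mono mult_mono) auto
  finally show "norm (perp (H 0 [u, v])) \<le> L 2" by simp
qed

text \<open>The second difference on the left is symmetric in a and b, whereas the approximation \<open>H 0 [b, a]\<close>
  depends on the order of differentiation; comparing both orders yields the symmetry of the second
  differential.\<close>

lemma second_difference_N:
  assumes a: "a \<in> span E" and b: "b \<in> span E" and ab: "norm a + norm b < r0"
  shows "norm (N (a + b) - N a - N b - H 0 [b, a]) \<le> L 3 * (norm a + norm b)\<^sup>2 * norm a"
proof -
  \<comment> \<open>The defect along the segment from 0 to a, and its derivative.\<close>
  define D where "D m s = (if m = 0 then N (b + s *\<^sub>R a) - N (0 + s *\<^sub>R a) - s *\<^sub>R H 0 [b, a]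
    else H (b + s *\<^sub>R a) [a] - H (0 + s *\<^sub>R a) [a] - H 0 [b, a])" for m :: nat and s
  have small: "norm (b + s *\<^sub>R a) \<le> norm a + norm b" "norm (0 + s *\<^sub>R a) \<le> norm a + norm b" if "0 \<le> s" "s \<le> 1" for s
  proof -
    have "norm (s *\<^sub>R a) \<le> 1 * norm a" unfolding norm_scaleR using that by (intro mult_right_mono) auto
    then show "norm (b + s *\<^sub>R a) \<le> norm a + norm b" "norm (0 + s *\<^sub>R a) \<le> norm a + norm b"
      using norm_triangle_ineq[of b "s *\<^sub>R a"] norm_ge_zero[of b]
      unfolding add_0_left by linarith+
  qed
  have "norm (D 0 1 - (\<Sum>m<1. D m 0 /\<^sub>R fact m)) \<le> L 3 * (norm a + norm b)\<^sup>2 * norm a / fact 1"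
  proof (rule vector_Maclaurin_bound)
    fix m and s :: real assume m: "m < (1::nat)" and s: "0 \<le> s" "s \<le> 1"
    have "((\<lambda>s. H (b + s *\<^sub>R a) [] - H (0 + s *\<^sub>R a) [] - s *\<^sub>R H 0 [b, a]) has_vector_derivative
      H (b + s *\<^sub>R a) [a] - H (0 + s *\<^sub>R a) [a] - H 0 [b, a]) (at s)"
      using small[OF s] ab a b k
      by (intro has_vector_derivative_diff H_line) (auto simp: span_zero intro!: derivative_eq_intros)
    then show "(D m has_vector_derivative D (Suc m) s) (at s)"
      using m by (simp add: D_def[abs_def] H_Nil)
  next
    fix s :: real assume s: "0 \<le> s" "s \<le> 1"
    let ?z = "b + s *\<^sub>R a" and ?z' = "0 + s *\<^sub>R a"
    have z: "?z \<in> span E" "?z' \<in> span E" using a b by (auto intro: span_add span_scale)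
    have sm: "norm ?z < r0" "norm ?z' < r0" using small[OF s] ab by auto
    have sq: "(norm ?z)\<^sup>2 \<le> (norm a + norm b)\<^sup>2" "(norm ?z')\<^sup>2 \<le> (norm a + norm b)\<^sup>2"
      using small[OF s] by (auto intro!: power_mono)
    have "H 0 [?z, a] - H 0 [?z', a] = H 0 [b, a]"
      using d2N_add_left[of b a a s] d2N_add_left[of 0 a a s] d2N_add_left[of 0 0 a 1] a b by (simp add: span_zero)
    then have "D 1 s = (H ?z [a] - H 0 [?z, a]) - (H ?z' [a] - H 0 [?z', a])" by (simp add: D_def algebra_simps)
    also have "norm \<dots> \<le> norm (H ?z [a] - H 0 [?z, a]) + norm (H ?z' [a] - H 0 [?z', a])" by (rule norm_triangle_ineq4)
    also have "\<dots> \<le> L 3 * (norm ?z)\<^sup>2 * norm a / 2 + L 3 * (norm ?z')\<^sup>2 * norm a / 2"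
      using dN_expand[OF z(1) sm(1) a] dN_expand[OF z(2) sm(2) a] by (rule add_mono)
    also have "\<dots> \<le> L 3 * (norm a + norm b)\<^sup>2 * norm a / 2 + L 3 * (norm a + norm b)\<^sup>2 * norm a / 2"
      using sq L3_pos by (intro add_mono divide_right_mono mult_right_mono mult_left_mono) auto
    also have "\<dots> = L 3 * (norm a + norm b)\<^sup>2 * norm a" by simp
    finally show "norm (D 1 s) \<le> L 3 * (norm a + norm b)\<^sup>2 * norm a" .
  qed simp
  moreover have "D 0 1 - (\<Sum>m<1. D m 0 /\<^sub>R fact m) = N (a + b) - N a - N b - H 0 [b, a]"
    by (simp add: D_def N_0 algebra_simps)
  ultimately show ?thesis by simp
qed

lemma d2N_symmetric:
  assumes u: "u \<in> span E" and v: "v \<in> span E"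
  shows "H 0 [u, v] = H 0 [v, u]"
proof (rule ccontr)
  assume neq: "H 0 [u, v] \<noteq> H 0 [v, u]"
  define n where "n = norm (H 0 [u, v] - H 0 [v, u])"
  have n: "0 < n" using neq by (simp add: n_def)
  define S where "S = norm u + norm v + 1"
  have S: "1 \<le> S" by (simp add: S_def)
  \<comment> \<open>The first bound keeps the arguments in the chart, the second makes the cubic error smaller than
    the assumed quadratic discrepancy.\<close>
  define h where "h = min (r0 / (2 * S)) (n / (2 * L 3 * S ^ 3))"
  have h: "0 < h" using S n r0_pos L3_pos by (auto simp: h_def)
  have "h * S \<le> r0 / (2 * S) * S" using S by (intro mult_right_mono) (auto simp: h_def)
  then have hS: "h * S < r0" using S r0_pos by auto
  have scale: "H 0 [h *\<^sub>R x, h *\<^sub>R y] = h\<^sup>2 *\<^sub>R H 0 [x, y]" if "x \<in> span E" "y \<in> span E" for x y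
    using d2N_add_left[of 0 x "h *\<^sub>R y" h] d2N_add_left[of 0 0 "h *\<^sub>R y" 1] d2N_add_right[of 0 y x h] d2N_add_right[of 0 0 x 1] that
    by (simp add: span_zero span_scale power2_eq_square)
  have nn: "norm (h *\<^sub>R u) + norm (h *\<^sub>R v) \<le> h * S" using h by (simp add: S_def algebra_simps)
  have mem: "h *\<^sub>R u \<in> span E" "h *\<^sub>R v \<in> span E" using u v by (auto intro: span_scale)
  have 1: "norm (N (h *\<^sub>R u + h *\<^sub>R v) - N (h *\<^sub>R u) - N (h *\<^sub>R v) - H 0 [h *\<^sub>R v, h *\<^sub>R u]) \<le> L 3 * (norm (h *\<^sub>R u) + norm (h *\<^sub>R v))\<^sup>2 * norm (h *\<^sub>R u)"
    using nn hS by (intro second_difference_N mem) auto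
  have 2: "norm (N (h *\<^sub>R v + h *\<^sub>R u) - N (h *\<^sub>R v) - N (h *\<^sub>R u) - H 0 [h *\<^sub>R u, h *\<^sub>R v]) \<le> L 3 * (norm (h *\<^sub>R v) + norm (h *\<^sub>R u))\<^sup>2 * norm (h *\<^sub>R v)"
    using nn hS by (intro second_difference_N mem) auto
  have "norm (H 0 [h *\<^sub>R u, h *\<^sub>R v] - H 0 [h *\<^sub>R v, h *\<^sub>R u]) =
    norm ((N (h *\<^sub>R u + h *\<^sub>R v) - N (h *\<^sub>R u) - N (h *\<^sub>R v) - H 0 [h *\<^sub>R v, h *\<^sub>R u]) - (N (h *\<^sub>R v + h *\<^sub>R u) - N (h *\<^sub>R v) - N (h *\<^sub>R u) - H 0 [h *\<^sub>R u, h *\<^sub>R v]))"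
    by (simp add: algebra_simps)
  also have "\<dots> \<le> L 3 * (norm (h *\<^sub>R u) + norm (h *\<^sub>R v))\<^sup>2 * norm (h *\<^sub>R u) + L 3 * (norm (h *\<^sub>R v) + norm (h *\<^sub>R u))\<^sup>2 * norm (h *\<^sub>R v)"
    by (rule order_trans[OF norm_triangle_ineq4 add_mono[OF 1 2]])
  also have "\<dots> = L 3 * (norm (h *\<^sub>R u) + norm (h *\<^sub>R v)) ^ 3"
    by (simp add: power2_eq_square power3_eq_cube algebra_simps)
  also have "\<dots> \<le> L 3 * (h * S) ^ 3" using nn L3_pos by (intro mult_left_mono power_mono) auto
  finally have "h\<^sup>2 * n \<le> L 3 * (h * S) ^ 3"
    using scale[OF u v] scale[OF v u] by (simp add: n_def scaleR_right_diff_distrib[symmetric])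
  then have "h\<^sup>2 * n \<le> h\<^sup>2 * (L 3 * h * S ^ 3)" by (simp add: power2_eq_square power3_eq_cube mult_ac)
  then have "n \<le> L 3 * h * S ^ 3" using h by simp
  also have "\<dots> = h * (L 3 * S ^ 3)" by simp
  also have "\<dots> \<le> n / (2 * L 3 * S ^ 3) * (L 3 * S ^ 3)"
    using L3_pos S by (intro mult_right_mono) (auto simp: h_def)
  also have "\<dots> = n / 2" using L3_pos S by simp
  finally show False using n by simp
qed

text \<open>By polarization, the operator norm of the second fundamental form is already approached on the
  diagonal.\<close>

lemma second_fundamental_norm_diagonal:
  assumes \<mu>: "\<And>u. u \<in> span E \<Longrightarrow> norm u = 1 \<Longrightarrow> norm (perp (H 0 [u, u])) \<le> \<mu>" and "0 \<le> \<mu>"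
  shows "second_fundamental_norm M p \<le> \<mu>"
proof (rule second_fundamental_norm_leI)
  have diag: "norm (perp (H 0 [w, w])) \<le> \<mu> * (norm w)\<^sup>2" if w: "w \<in> span E" for w
  proof (cases "w = 0")
    case True
    then have "norm (perp (H 0 [w, w])) \<le> second_fundamental_norm M p * norm w * norm w"
      using second_fundamental_form_bound w by blast
    then show ?thesis using True by simp
  next
    case False
    have s: "sgn w \<in> span E" "norm (sgn w) = 1" using w False by (auto simp: sgn_div_norm span_scale)
    have "perp (H 0 [w, w]) = prod_list (map norm [w, w]) *\<^sub>R perp (H 0 (map sgn [w, w]))"
      using w by (intro multilinear_on_normalize[OF perp_H_multilinear subspace_span]) auto
    then have "norm (perp (H 0 [w, w])) = (norm w)\<^sup>2 * norm (perp (H 0 [sgn w, sgn w]))"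
      by (simp add: power2_eq_square)
    then show ?thesis using mult_left_mono[OF \<mu>[OF s], of "(norm w)\<^sup>2"] by (simp add: mult.commute)
  qed
  fix u v assume uv: "u \<in> span E" "v \<in> span E" "norm u \<le> 1" "norm v \<le> 1"
  let ?P = "\<lambda>a b. perp (H 0 [a, b])"
  have m: "u + v \<in> span E" "u - v \<in> span E" using uv by (auto simp: span_add span_diff)
  have "H 0 [u + v, u + v] - H 0 [u - v, u - v] = 4 *\<^sub>R H 0 [u, v]"
  proof -
    have "H 0 [u + v, u + v] = H 0 [u, u] + H 0 [u, v] + (H 0 [v, u] + H 0 [v, v])"
      using d2N_add_left[of u v "u + v" 1] d2N_add_right[of u v u 1] d2N_add_right[of u v v 1] uv m by simp
    moreover have "H 0 [u - v, u - v] = H 0 [u, u] - H 0 [u, v] - (H 0 [v, u] - H 0 [v, v])"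
      using d2N_add_left[of u v "u - v" "-1"] d2N_add_right[of u v u "-1"] d2N_add_right[of u v v "-1"] uv m by simp
    moreover have "4 *\<^sub>R x = x + x + (x + x)" for x :: 'a
      using scaleR_left_distrib[of 2 2 x] by (simp add: scaleR_2)
    ultimately show ?thesis using d2N_symmetric[OF uv(1,2)] by simp
  qed
  then have "4 *\<^sub>R ?P u v = ?P (u + v) (u + v) - ?P (u - v) (u - v)"
    by (metis linear_cmul[OF linear_perp] linear_diff[OF linear_perp])
  then have "4 * norm (?P u v) = norm (?P (u + v) (u + v) - ?P (u - v) (u - v))"
    by (metis norm_scaleR abs_numeral)
  also have "\<dots> \<le> norm (?P (u + v) (u + v)) + norm (?P (u - v) (u - v))" by (rule norm_triangle_ineq4)
  also have "\<dots> \<le> \<mu> * (norm (u + v))\<^sup>2 + \<mu> * (norm (u - v))\<^sup>2" by (intro add_mono diag m)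
  also have "\<dots> = \<mu> * (2 * ((norm u)\<^sup>2 + (norm v)\<^sup>2))"
    by (simp add: power2_norm_eq_inner inner_simps inner_commute algebra_simps)
  also have "\<dots> \<le> \<mu> * (2 * (1 + 1))"
    using uv \<open>0 \<le> \<mu>\<close> by (intro mult_left_mono add_mono) (auto simp: power_le_one)
  finally show "norm (?P u v) \<le> \<mu>" by simp
qed

end

section \<open>Curvature bound, nearest points and reach\<close>

lemma second_order_upper_bound:
  fixes f f' f'' :: "real \<Rightarrow> real"
  assumes f: "\<And>s. 0 \<le> s \<Longrightarrow> s \<le> 1 \<Longrightarrow> (f has_real_derivative f' s) (at s)"
    and f': "\<And>s. 0 \<le> s \<Longrightarrow> s \<le> 1 \<Longrightarrow> (f' has_real_derivative f'' s) (at s)"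
    and K: "\<And>s. 0 \<le> s \<Longrightarrow> s \<le> 1 \<Longrightarrow> f'' s \<le> K"
  shows "f 1 \<le> f 0 + f' 0 + K / 2"
proof -
  define D where "D m = (if m = 0 then f else if m = 1 then f' else f'')" for m :: nat
  have "\<exists>t>0. t < 1 \<and> f 1 = (\<Sum>m<2. D m 0 / fact m * 1 ^ m) + D 2 t / fact 2 * 1 ^ 2"
    by (rule Maclaurin) (use f f' in \<open>auto simp: D_def less_2_cases_iff\<close>)
  then obtain t where "0 < t" "t < 1" "f 1 = f 0 + f' 0 + f'' t / 2"
    by (auto simp: D_def numeral_2_eq_2)
  then show ?thesis using K[of t] by simp
qed

text \<open>The estimates below see a member of the class only through its tangent charts and through the
  uniqueness of nearest points at distance less than \<open>R\<close>.\<close>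

locale reach_manifold =
  fixes M A :: "'a::real_inner set" and k :: nat and L :: "nat \<Rightarrow> real" and R :: real
  assumes compact_M: "compact M" and M_nonempty: "M \<noteq> {}"
    and M_sub: "M \<subseteq> A" and A_subspace: "subspace A"
    and charts: "\<And>q. q \<in> M \<Longrightarrow> \<exists>E r N. tangent_chart M q E r N k L"
    and R_pos: "0 < R"
    and unique_nearest: "\<And>x. x \<in> A \<Longrightarrow> infdist x M < R \<Longrightarrow> \<exists>!p. p \<in> M \<and> (\<forall>q\<in>M. dist x p \<le> dist x q)"
begin

text \<open>The inverse of the local reach.\<close>

definition \<kappa> where "\<kappa> = (SUP q\<in>M. second_fundamental_norm M q)"

lemma second_fundamental_norm_le_L2: "q \<in> M \<Longrightarrow> second_fundamental_norm M q \<le> L 2"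
  using charts tangent_chart.second_fundamental_norm_le by blast

lemma bdd_second_fundamental_norm: "bdd_above (second_fundamental_norm M ` M)"
  using second_fundamental_norm_le_L2 by (auto simp: bdd_above_def)

lemma second_fundamental_norm_le_\<kappa>: "q \<in> M \<Longrightarrow> second_fundamental_norm M q \<le> \<kappa>"
  unfolding \<kappa>_def using bdd_second_fundamental_norm by (rule cSUP_upper[rotated])

lemma \<kappa>_le: "\<kappa> \<le> L 2"
  unfolding \<kappa>_def using M_nonempty second_fundamental_norm_le_L2 by (rule cSUP_least)

lemma second_fundamental_norm_nonneg_at: "q \<in> M \<Longrightarrow> 0 \<le> second_fundamental_norm M q"
  using charts tangent_chart.second_fundamental_norm_nonneg by blast

lemma \<kappa>_nonneg: "0 \<le> \<kappa>"
  using M_nonempty second_fundamental_norm_nonneg_at second_fundamental_norm_le_\<kappa> order_trans by blast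

lemma L_positive: "i \<in> {2..k} \<Longrightarrow> 0 < L i" and k_ge: "3 \<le> k"
  using M_nonempty charts tangent_chart.L_pos tangent_chart.k by blast+

text \<open>The velocity of a curve is a tangent field along the curve, so the normal part of its derivative
  is the second fundamental form at the velocity.\<close>

lemma curve_acceleration:
  assumes \<gamma>M: "\<forall>\<^sub>F s in nhds (t::real). \<gamma> s \<in> M"
    and \<gamma>: "\<forall>\<^sub>F s in nhds t. (\<gamma> has_vector_derivative \<gamma>' s) (at s)"
    and \<gamma>': "(\<gamma>' has_vector_derivative a) (at t)"
  shows "\<exists>\<tau> \<nu>. a = \<tau> + \<nu> \<and> \<tau> \<in> tangent_space M (\<gamma> t) \<and> (\<forall>w\<in>tangent_space M (\<gamma> t). inner w \<nu> = 0) \<and>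
    norm \<nu> \<le> \<kappa> * (norm (\<gamma>' t))\<^sup>2"
proof -
  have q: "\<gamma> t \<in> M" using eventually_nhds_x_imp_x[OF \<gamma>M] .
  obtain E r N where "tangent_chart M (\<gamma> t) E r N k L" using charts[OF q] by blast
  then interpret tangent_chart M "\<gamma> t" E r N k L .
  have shift: "\<forall>\<^sub>F h in nhds 0. P (t + h)" if P: "\<forall>\<^sub>F s in nhds t. P s" for P
  proof -
    obtain d where "0 < d" "\<And>s. dist s t < d \<Longrightarrow> P s"
      using P unfolding eventually_nhds_metric by blast
    then show ?thesis unfolding eventually_nhds_metric
      by (intro exI[of _ d]) (simp add: dist_real_def)
  qed
  have shift': "((\<lambda>h. f (t + h)) has_vector_derivative D) (at 0)" if "(f has_vector_derivative D) (at t)" for f :: "real \<Rightarrow> 'a" and D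
  proof -
    have s: "((\<lambda>s. t + s) has_vector_derivative 1) (at 0)" by (auto intro!: derivative_eq_intros)
    show ?thesis using vector_diff_chain_at[OF s, of f D] that by (simp add: o_def)
  qed
  have vel: "\<forall>\<^sub>F s in nhds t. \<gamma>' s \<in> tangent_space M (\<gamma> s)"
  proof -
    have "\<forall>\<^sub>F s in nhds t. \<forall>\<^sub>F s' in nhds s. \<gamma> s' \<in> M" using \<gamma>M by (simp add: eventually_eventually)
    then show ?thesis using \<gamma> by eventually_elim (rule curve_velocity_in_tangent_space)
  qed
  have d\<gamma>: "(\<gamma> has_vector_derivative \<gamma>' t) (at t)" using eventually_nhds_x_imp_x[OF \<gamma>] .
  have \<gamma>'t: "\<gamma>' t \<in> span E" using eventually_nhds_x_imp_x[OF vel] tangent_space_p by simp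
  have eq: "perp a = perp (H 0 [\<gamma>' t, \<gamma>' t])"
    using perp_derivative_of_tangent_field_along_curve[OF _ shift[OF \<gamma>M] shift'[OF d\<gamma>] shift'[OF \<gamma>'] shift[OF vel]] by simp
  have "norm (perp a) \<le> second_fundamental_norm M (\<gamma> t) * norm (\<gamma>' t) * norm (\<gamma>' t)"
    unfolding eq by (rule second_fundamental_form_bound[OF \<gamma>'t \<gamma>'t])
  also have "\<dots> = second_fundamental_norm M (\<gamma> t) * (norm (\<gamma>' t))\<^sup>2" by (simp add: power2_eq_square)
  also have "\<dots> \<le> \<kappa> * (norm (\<gamma>' t))\<^sup>2"
    using second_fundamental_norm_le_\<kappa>[OF q] by (intro mult_right_mono) auto
  finally have "norm (perp a) \<le> \<kappa> * (norm (\<gamma>' t))\<^sup>2" .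
  moreover have "a = (a - perp a) + perp a" "a - perp a \<in> span E" using diff_perp_in_span by auto
  moreover have "\<forall>w\<in>span E. inner w (perp a) = 0" using inner_perp by (simp add: inner_commute)
  ultimately show ?thesis unfolding tangent_space_p by blast
qed

text \<open>First-order condition for the squared distance along curves. It is applied to global nearest
  points and to nearest points of a chart.\<close>

lemma nearest_point_orthogonal:
  assumes near: "\<And>m. m \<in> U \<Longrightarrow> dist x q \<le> dist x m" and U: "openin (top_of_set M) U" "q \<in> U"
    and w: "w \<in> tangent_space M q"
  shows "inner (x - q) w = 0"
proof -
  obtain c e where c: "0 < e" "c 0 = q" "c ` {-e<..<e} \<subseteq> M" "(c has_vector_derivative w) (at (0::real))"
    using w unfolding tangent_space_def by blast
  have "\<forall>\<^sub>F s in nhds 0. c s \<in> M"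
    unfolding eventually_nhds using c by (intro exI[of _ "{-e<..<e}"]) auto
  then have "\<forall>\<^sub>F s in nhds 0. c s \<in> U"
    using has_vector_derivative_continuous[OF c(4)] U c(2) by (intro eventually_in_relatively_open[where c = c, OF U(1)]) auto
  then obtain d where d: "0 < d" "\<And>s. \<bar>s\<bar> < d \<Longrightarrow> c s \<in> U"
    unfolding eventually_nhds_metric by (auto simp: dist_real_def)
  define f where "f s = inner (c s - x) (c s - x)" for s
  have cd: "(c has_derivative (\<lambda>h. h *\<^sub>R w)) (at 0)" using c(4) by (simp add: has_vector_derivative_def)
  have "((\<lambda>s. c s - x) has_derivative (\<lambda>h. h *\<^sub>R w)) (at 0)"
    using has_derivative_diff[OF cd has_derivative_const[of x]] by simp
  from has_derivative_inner[OF this this]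
  have "(f has_derivative (\<lambda>h. h * (2 * inner (q - x) w))) (at 0)"
    unfolding f_def c(2) by (simp add: inner_commute algebra_simps)
  then have "(f has_real_derivative 2 * inner (q - x) w) (at 0)"
    by (simp add: has_field_derivative_def mult_commute_abs)
  moreover have "\<forall>s. \<bar>0 - s\<bar> < d \<longrightarrow> f 0 \<le> f s"
  proof (intro allI impI)
    fix s assume "\<bar>0 - s\<bar> < d"
    then have "dist x q \<le> dist x (c s)" using near d(2)[of s] by simp
    then have "(norm (x - q))\<^sup>2 \<le> (norm (x - c s))\<^sup>2" by (simp add: dist_norm power_mono)
    then show "f 0 \<le> f s" by (simp add: f_def c(2) power2_norm_eq_inner[symmetric] norm_minus_commute)
  qed
  ultimately have "2 * inner (q - x) w = 0" using d(1) by (intro DERIV_local_min)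
  then show ?thesis by (simp add: inner_diff_left)
qed

end

context tangent_chart
begin

text \<open>The manifold lies near p outside the balls of radius at most \<open>1 / (4 * L 2)\<close> that touch it at p:
  the normal displacement \<open>O(|v|\<^sup>2)\<close> of the graph cannot make up for the tangential one.\<close>

lemma chart_avoids_tangent_ball:
  assumes v: "v \<in> span E" "norm v < r0" and y: "\<And>w. w \<in> span E \<Longrightarrow> inner (y - p) w = 0"
    and small: "L 2 * norm (y - p) \<le> 1 / 4"
  shows "norm (y - p) \<le> norm (y - \<psi> v)"
proof -
  let ?n = "norm v"
  have N: "norm (N v) \<le> L 2 * ?n ^ 2 / 2" by (rule N_bound[OF v])
  have "L 2 * ?n \<le> L 2 * r0" using v L2_pos by (intro mult_left_mono) auto
  then have "L 2 * ?n \<le> 1 / 4" by (simp add: L2_r0)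
  then have "(L 2 * ?n) * ?n \<le> 1 / 4 * ?n" by (rule mult_right_mono) simp
  then have "norm (N v) \<le> 1 / 8 * ?n" using N by (simp add: power2_eq_square)
  then have "7 / 8 * ?n \<le> norm (v + N v)" using norm_triangle_ineq4[of "v + N v" "N v"] by simp
  then have 1: "(7 / 8 * ?n)\<^sup>2 \<le> (norm (v + N v))\<^sup>2" by (intro power_mono) auto
  have "inner (y - p) (v + N v) = inner (y - p) (N v)" using y[OF v(1)] by (simp add: inner_add_right)
  also have "\<dots> \<le> norm (y - p) * norm (N v)" by (rule norm_cauchy_schwarz)
  also have "\<dots> \<le> norm (y - p) * (L 2 * ?n ^ 2 / 2)" using N by (intro mult_left_mono) auto
  also have "\<dots> = (L 2 * norm (y - p)) * (?n ^ 2 / 2)" by simp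
  also have "\<dots> \<le> 1 / 4 * (?n ^ 2 / 2)" using small by (intro mult_right_mono) auto
  finally have 2: "2 * inner (y - p) (v + N v) \<le> ?n ^ 2 / 4" by simp
  have 3: "?n ^ 2 / 4 \<le> (7 / 8 * ?n)\<^sup>2" by (simp add: power_mult_distrib power2_eq_square)
  have sq: "(norm (a - b))\<^sup>2 = (norm a)\<^sup>2 - 2 * inner a b + (norm b)\<^sup>2" for a b :: 'a
    by (simp add: power2_norm_eq_inner inner_diff_left inner_diff_right inner_commute)
  have eq: "y - \<psi> v = (y - p) - (v + N v)" by (simp add: \<psi>_def)
  have "(norm (y - \<psi> v))\<^sup>2 = (norm (y - p))\<^sup>2 - 2 * inner (y - p) (v + N v) + (norm (v + N v))\<^sup>2"
    unfolding eq by (rule sq)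
  then have "(norm (y - p))\<^sup>2 \<le> (norm (y - \<psi> v))\<^sup>2" using 1 2 3 by linarith
  then show ?thesis by (rule power2_le_imp_le) simp
qed

end

context reach_manifold
begin

text \<open>Walk from q to x along the chord. The set of times at which q is still a nearest point of M is
  closed; it is also open, because q is the unique nearest point at such a time, so points of M
  outside the chart at q are farther away by a positive margin, while points inside the chart never
  come closer than q. Hence q is a nearest point of x, which lies on M.\<close>

lemma normal_chord_trivial:
  assumes q: "q \<in> M" and x: "x \<in> M" and orth: "\<And>w. w \<in> tangent_space M q \<Longrightarrow> inner (x - q) w = 0"
    and small: "norm (x - q) < R" "L 2 * norm (x - q) \<le> 1 / 4"
  shows "x = q"
proof -
  obtain E r N where "tangent_chart M q E r N k L" using charts[OF q] by blast
  then interpret tangent_chart M q E r N k L .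
  define y where "y \<tau> = q + \<tau> *\<^sub>R (x - q)" for \<tau> :: real
  let ?I = "{0..1::real}"
  let ?U = "\<psi> ` (span E \<inter> ball 0 r0)"
  define S where "S = {\<tau>\<in>?I. \<forall>m\<in>M. dist (y \<tau>) q \<le> dist (y \<tau>) m}"
  have cont: "continuous_on ?I (\<lambda>\<tau>. dist (y \<tau>) m)" for m unfolding y_def by (intro continuous_intros)
  have yq: "norm (y \<tau> - q) \<le> norm (x - q)" if "\<tau> \<in> ?I" for \<tau>
    using that mult_right_mono[of \<tau> 1 "norm (x - q)"] by (simp add: y_def)
  have U: "openin (top_of_set M) ?U" "q \<in> ?U"
    using open_\<psi>_ball[OF r0_le] r0_pos \<psi>_0 by (auto intro!: image_eqI[of _ _ 0] simp: span_zero)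
  have "closedin (top_of_set ?I) S"
  proof -
    have "S = (\<Inter>m\<in>M. {\<tau>\<in>?I. dist (y \<tau>) q \<le> dist (y \<tau>) m})" using M_nonempty by (auto simp: S_def)
    moreover have "closedin (top_of_set ?I) {\<tau>\<in>?I. dist (y \<tau>) q \<le> dist (y \<tau>) m}" for m
    proof -
      have "closedin (top_of_set ?I) (?I \<inter> (\<lambda>\<tau>. dist (y \<tau>) m - dist (y \<tau>) q) -` {0..})"
        by (rule continuous_closedin_preimage[OF continuous_on_diff[OF cont cont]]) simp
      moreover have "?I \<inter> (\<lambda>\<tau>. dist (y \<tau>) m - dist (y \<tau>) q) -` {0..} = {\<tau>\<in>?I. dist (y \<tau>) q \<le> dist (y \<tau>) m}"
        by auto
      ultimately show ?thesis by simp
    qed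
    ultimately show ?thesis using M_nonempty by (simp only:) (rule closedin_INT; simp)
  qed
  moreover have "openin (top_of_set ?I) S"
    unfolding openin_euclidean_subtopology_iff
  proof (intro conjI ballI)
    show "S \<subseteq> ?I" by (auto simp: S_def)
    fix \<tau> assume \<tau>: "\<tau> \<in> S"
    then have \<tau>I: "\<tau> \<in> ?I" and nearq: "\<forall>m\<in>M. dist (y \<tau>) q \<le> dist (y \<tau>) m" by (auto simp: S_def)
    have yA: "y \<tau> \<in> A" using q x M_sub A_subspace unfolding y_def
      by (intro subspace_add subspace_scale subspace_diff) auto
    have "infdist (y \<tau>) M \<le> dist (y \<tau>) q" by (rule infdist_le[OF q])
    also have "\<dots> < R" using yq[OF \<tau>I] small by (simp add: dist_norm)
    finally have uniq: "\<exists>!p. p \<in> M \<and> (\<forall>m\<in>M. dist (y \<tau>) p \<le> dist (y \<tau>) m)" by (rule unique_nearest[OF yA])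
    have K: "compact (M - ?U)"
    proof -
      obtain V where "open V" "?U = M \<inter> V" using U(1) unfolding openin_open by blast
      then have "M - ?U = M - V" by blast
      then show ?thesis using compact_M \<open>open V\<close> by (simp add: compact_diff)
    qed
    have "\<exists>\<epsilon>>0. \<forall>m\<in>M - ?U. dist (y \<tau>) q + \<epsilon> \<le> dist (y \<tau>) m"
    proof (cases "M - ?U = {}")
      case True
      then show ?thesis by (intro exI[of _ 1]) auto
    next
      case False
      obtain m0 where m0: "m0 \<in> M - ?U" "\<forall>m\<in>M - ?U. dist (y \<tau>) m0 \<le> dist (y \<tau>) m"
        using continuous_attains_inf[OF K False continuous_on_dist[OF continuous_on_const continuous_on_id]] by blast
      have "m0 \<noteq> q" using m0 U(2) by blast
      have "dist (y \<tau>) q < dist (y \<tau>) m0"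
      proof (rule ccontr)
        assume "\<not> dist (y \<tau>) q < dist (y \<tau>) m0"
        then have "\<forall>m\<in>M. dist (y \<tau>) m0 \<le> dist (y \<tau>) m" using nearq by (meson linorder_not_less order_trans)
        then have "m0 = q" using uniq m0(1) q nearq by auto
        then show False using \<open>m0 \<noteq> q\<close> by simp
      qed
      then show ?thesis using m0(2) by (intro exI[of _ "dist (y \<tau>) m0 - dist (y \<tau>) q"]) auto
    qed
    then obtain \<epsilon> where \<epsilon>: "0 < \<epsilon>" "\<And>m. m \<in> M - ?U \<Longrightarrow> dist (y \<tau>) q + \<epsilon> \<le> dist (y \<tau>) m" by blast
    show "\<exists>e>0. \<forall>\<tau>'\<in>?I. dist \<tau>' \<tau> < e \<longrightarrow> \<tau>' \<in> S"
    proof (intro exI[of _ "\<epsilon> / (2 * (norm (x - q) + 1))"] conjI ballI impI)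
      have S: "0 < norm (x - q) + 1" by (intro add_nonneg_pos) auto
      then show "0 < \<epsilon> / (2 * (norm (x - q) + 1))" using \<epsilon>(1) by simp
      fix \<tau>' assume \<tau>': "\<tau>' \<in> ?I" "dist \<tau>' \<tau> < \<epsilon> / (2 * (norm (x - q) + 1))"
      have "y \<tau>' - y \<tau> = (\<tau>' - \<tau>) *\<^sub>R (x - q)" by (simp add: y_def scaleR_left_diff_distrib)
      then have "dist (y \<tau>') (y \<tau>) = dist \<tau>' \<tau> * norm (x - q)" by (simp add: dist_norm dist_real_def)
      also have "\<dots> \<le> dist \<tau>' \<tau> * (norm (x - q) + 1)" by (intro mult_left_mono) auto
      also have "\<dots> \<le> \<epsilon> / (2 * (norm (x - q) + 1)) * (norm (x - q) + 1)"
        using \<tau>'(2) S by (intro mult_right_mono) auto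
      also have "\<dots> = \<epsilon> / 2"
      proof -
        have "\<epsilon> / (2 * s) * s = \<epsilon> / 2" if "0 < s" for s using that by simp
        then show ?thesis using S by blast
      qed
      finally have close: "dist (y \<tau>') (y \<tau>) \<le> \<epsilon> / 2" .
      have "dist (y \<tau>') q \<le> dist (y \<tau>') m" if m: "m \<in> M" for m
      proof (cases "m \<in> ?U")
        case True
        then obtain v where v: "v \<in> span E" "norm v < r0" "m = \<psi> v" by auto
        have "norm (y \<tau>' - q) \<le> norm (y \<tau>' - \<psi> v)"
        proof (rule chart_avoids_tangent_ball[OF v(1,2)])
          show "inner (y \<tau>' - q) w = 0" if "w \<in> span E" for w
            using orth[of w] that tangent_space_p by (simp add: y_def)
          have "L 2 * norm (y \<tau>' - q) \<le> L 2 * norm (x - q)" using yq[OF \<tau>'(1)] L2_pos by (intro mult_left_mono) auto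
          then show "L 2 * norm (y \<tau>' - q) \<le> 1 / 4" using small by simp
        qed
        then show ?thesis using v(3) by (simp add: dist_norm)
      next
        case False
        then have "dist (y \<tau>) q + \<epsilon> \<le> dist (y \<tau>) m" using m \<epsilon>(2) by blast
        then show ?thesis
          using close dist_triangle[of "y \<tau>'" q "y \<tau>"] dist_triangle[of "y \<tau>" m "y \<tau>'"] by (simp add: dist_commute)
      qed
      then show "\<tau>' \<in> S" using \<tau>'(1) by (simp add: S_def)
    qed
  qed
  moreover have "0 \<in> S" by (simp add: S_def y_def)
  ultimately have "S = ?I"
    using connected_Icc[of 0 "1::real", unfolded connected_clopen, rule_format, of S] by auto
  then have "1 \<in> S" by simp
  then have "dist (y 1) q \<le> dist (y 1) x" using x by (simp add: S_def)
  then show ?thesis by (simp add: y_def)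
qed

text \<open>Let q be the point closest to x in a compact piece of the chart. It lies in the interior of that
  piece because it is close to p, so \<open>x - q\<close> is normal to M at q, and short normal chords are trivial.\<close>

lemma nearby_points_in_chart:
  assumes chart: "tangent_chart M p E r N k L" and x: "x \<in> M"
    and close: "norm (x - p) < R" "L 2 * norm (x - p) < 1 / 32"
  shows "\<exists>v\<in>span E. L 2 * norm v < 1 / 4 \<and> norm v \<le> 2 * norm (x - p) \<and> x = p + v + N v"
proof -
  interpret tangent_chart M p E r N k L by (rule chart)
  have N_small: "7 / 8 * norm v \<le> norm (\<psi> v - p)" if v: "v \<in> span E" "norm v < r0" for v
  proof -
    have "L 2 * norm v \<le> L 2 * r0" using v L2_pos by (intro mult_left_mono) auto
    then have "(L 2 * norm v) * norm v \<le> 1 / 4 * norm v" unfolding L2_r0 by (rule mult_right_mono) simp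
    then have "norm (N v) \<le> 1 / 8 * norm v" using N_bound[OF v] by (simp add: power2_eq_square)
    then show ?thesis using norm_triangle_ineq4[of "v + N v" "N v"] by (simp add: \<psi>_def add.assoc)
  qed
  have small: "norm (x - p) < r0 / 8" using close L2_pos by (simp add: r0_def field_simps)
  let ?D = "span E \<inter> cball 0 (r0 / 2)"
  have D_B: "?D \<subseteq> B" using in_B r0_pos by fastforce
  have "continuous_on B \<psi>"
  proof -
    have "continuous_on B N"
    proof -
      obtain k' where "k = Suc k'" using k by (cases k) auto
      then have "\<forall>x\<in>B. N differentiable (at x within B)" using N_Ck by (simp add: B_def)
      then show ?thesis by (intro differentiable_imp_continuous_on) (simp add: differentiable_on_def)
    qed
    then show ?thesis unfolding \<psi>_def[abs_def] by (intro continuous_intros)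
  qed
  then have "continuous_on ?D \<psi>" by (rule continuous_on_subset) (rule D_B)
  then have cpt: "compact (\<psi> ` ?D)" by (rule compact_continuous_image) (rule compact_span_cball[OF onb])
  have "0 \<in> ?D" using r0_pos by (simp add: span_zero)
  then have p_im: "p \<in> \<psi> ` ?D" using \<psi>_0 by (metis imageI)
  then have "\<psi> ` ?D \<noteq> {}" by blast
  from continuous_attains_inf[OF cpt this continuous_on_dist[OF continuous_on_const[of _ x] continuous_on_id]]
  obtain q where q: "q \<in> \<psi> ` ?D" "\<forall>m\<in>\<psi> ` ?D. dist x q \<le> dist x m" ..
  then obtain v where v: "v \<in> span E" "norm v \<le> r0 / 2" "q = \<psi> v" by auto
  have xq: "norm (x - q) \<le> norm (x - p)" using q(2) p_im by (metis dist_norm)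
  have v_r0: "norm v < r0" using v r0_pos by simp
  have "7 / 8 * norm v \<le> norm (q - p)" using N_small[OF v(1) v_r0] v(3) by simp
  also have "\<dots> \<le> norm (x - q) + norm (x - p)" using norm_triangle_ineq4[of "x - p" "x - q"] by simp
  finally have "norm v < r0 / 2" using xq small r0_pos by simp
  then have qU: "q \<in> \<psi> ` (span E \<inter> ball 0 (r0 / 2))" using v by auto
  have qM: "q \<in> M" using v \<psi>_in_M in_B[OF v(1) v_r0] by simp
  have "inner (x - q) w = 0" if "w \<in> tangent_space M q" for w
  proof (rule nearest_point_orthogonal[OF _ _ qU that])
    show "openin (top_of_set M) (\<psi> ` (span E \<inter> ball 0 (r0 / 2)))" using r0_le r0_pos by (intro open_\<psi>_ball) auto
    show "dist x q \<le> dist x m" if "m \<in> \<psi> ` (span E \<inter> ball 0 (r0 / 2))" for m using q(2) that by auto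
  qed
  moreover have "L 2 * norm (x - q) \<le> 1 / 4"
  proof -
    have "L 2 * norm (x - q) \<le> L 2 * norm (x - p)" using xq L2_pos by (intro mult_left_mono) auto
    then show ?thesis using close(2) by linarith
  qed
  ultimately have "x = q" using normal_chord_trivial[OF qM x] xq close(1) by simp
  then have xv: "x = \<psi> v" using v(3) by simp
  moreover have "norm v \<le> 2 * norm (x - p)" using N_small[OF v(1) v_r0] norm_ge_zero[of v] unfolding xv by linarith
  moreover have "L 2 * norm v < 1 / 4" using mult_strict_left_mono[OF v_r0 L2_pos] L2_r0 by simp
  ultimately show ?thesis using v(1) by (auto simp: \<psi>_def)
qed

end

section \<open>Height of the manifold over its tangent spaces\<close>

lemma sum_minus_eq_halves: "a + b - h = (a - h /\<^sub>R 2) + (b - h /\<^sub>R 2)" for a b h :: "'a::real_vector"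
proof -
  have "h /\<^sub>R 2 + h /\<^sub>R 2 = h" using scaleR_half_double[of h] by (simp add: scaleR_right_distrib)
  then show ?thesis by (simp add: algebra_simps)
qed

context tangent_chart
begin

lemma dN_linear:
  assumes "z \<in> B" "v \<in> span E" "w \<in> span E"
  shows "H z [v + c *\<^sub>R w] = H z [v] + c *\<^sub>R H z [w]"
  using multilinear_onD[OF H_multilinear[OF assms(1), of 1], of "[]" "[]" v w c] assms k by simp

lemma d2N_linear_right:
  assumes "z \<in> B" "x \<in> span E" "v \<in> span E" "w \<in> span E"
  shows "H z [x, v + c *\<^sub>R w] = H z [x, v] + c *\<^sub>R H z [x, w]"
  using multilinear_onD[OF H_multilinear[OF assms(1), of 2], of "[x]" "[]" v w c] assms k by simp

lemma d2N_uminus: "z \<in> span E \<Longrightarrow> H 0 [- z, - z] = H 0 [z, z]"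
  using multilinear_on_uminus[OF H_multilinear[OF zero_in_B, of 2] subspace_span, of "[]" "[- z]" z]
    multilinear_on_uminus[OF H_multilinear[OF zero_in_B, of 2] subspace_span, of "[z]" "[]" z] k
  by (simp add: span_neg)

lemma d3N_uminus: "z \<in> span E \<Longrightarrow> H 0 [- z, - z, - z] = - H 0 [z, z, z]"
  using multilinear_on_uminus[OF H_multilinear[OF zero_in_B, of 3] subspace_span, of "[]" "[- z, - z]" z]
    multilinear_on_uminus[OF H_multilinear[OF zero_in_B, of 3] subspace_span, of "[z]" "[- z]" z]
    multilinear_on_uminus[OF H_multilinear[OF zero_in_B, of 3] subspace_span, of "[z, z]" "[]" z] k
  by (simp add: span_neg)

lemma N_expand: "z \<in> span E \<Longrightarrow> norm z < r0 \<Longrightarrow> norm (N z - H 0 [z, z] /\<^sub>R 2) \<le> L 3 * norm z ^ 3 / 6"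
  using H_Taylor[of 3 "[]" z] k by (simp add: H_0_single H_Nil N_0 eval_nat_numeral)

text \<open>The quadratic terms at z and \<open>- z\<close> agree; only Taylor remainders of third order are left.\<close>

lemma even_part_of_N_C3:
  assumes z: "z \<in> span E" "norm z < r0"
  shows "norm (N z + N (- z) - H 0 [z, z]) \<le> L 3 * norm z ^ 3 / 3"
proof -
  have "N z + N (- z) - H 0 [z, z] = (N z - H 0 [z, z] /\<^sub>R 2) + (N (- z) - H 0 [- z, - z] /\<^sub>R 2)"
    using d2N_uminus[OF z(1)] sum_minus_eq_halves[of "N z" "N (- z)" "H 0 [z, z]"] by simp
  also have "norm \<dots> \<le> L 3 * norm z ^ 3 / 6 + L 3 * norm (- z) ^ 3 / 6"
    using z by (intro order_trans[OF norm_triangle_ineq] add_mono N_expand) (auto simp: span_neg)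
  finally show ?thesis by simp
qed

text \<open>One order is gained because the cubic terms at z and \<open>- z\<close> cancel.\<close>

lemma even_part_of_N_C4:
  assumes z: "z \<in> span E" "norm z < r0" and k4: "4 \<le> k"
  shows "norm (N z + N (- z) - H 0 [z, z]) \<le> L 4 * norm z ^ 4 / 12"
proof -
  have T: "norm (N z - (H 0 [z, z] /\<^sub>R 2 + H 0 [z, z, z] /\<^sub>R 6)) \<le> L 4 * norm z ^ 4 / 24" if "z \<in> span E" "norm z < r0" for z
    using H_Taylor[of 4 "[]" z] k4 that by (simp add: H_0_single H_Nil N_0 eval_nat_numeral)
  have "N z + N (- z) - H 0 [z, z] = (N z - (H 0 [z, z] /\<^sub>R 2 + H 0 [z, z, z] /\<^sub>R 6))
      + (N (- z) - (H 0 [- z, - z] /\<^sub>R 2 + H 0 [- z, - z, - z] /\<^sub>R 6))"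
    using d2N_uminus[OF z(1)] d3N_uminus[OF z(1)] sum_minus_eq_halves[of "N z" "N (- z)" "H 0 [z, z]"] by simp
  also have "norm \<dots> \<le> L 4 * norm z ^ 4 / 24 + L 4 * norm (- z) ^ 4 / 24"
    using z by (intro order_trans[OF norm_triangle_ineq] add_mono T) (auto simp: span_neg)
  finally show ?thesis by simp
qed

end

context reach_manifold
begin

text \<open>The curve \<open>\<gamma> s = \<psi> (s v + (s - s\<^sup>2) u)\<close> joins p to x. Half the tangential part of \<open>H 0 [v, v]\<close> is
  the choice of u for which the acceleration at p is the normal vector \<open>G\<close> up to third order in
  \<open>\<rho> = |v|\<close>. All further errors are of fourth order: the speed is constant up to \<open>O(\<rho>\<^sup>4)\<close>, the
  part of the acceleration normal to M is at most \<open>\<kappa>\<close> times the squared speed, and the initial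
  speed \<open>|w|\<close> satisfies \<open>|w|\<^sup>2 \<le> |x - y|\<^sup>2 + O(\<rho>\<^sup>4)\<close> since \<open>y - p\<close> is normal.\<close>

lemma osculating_bound:
  assumes chart: "tangent_chart M p E r N k L" and v: "v \<in> span E" and v_small: "L 2 * norm v \<le> 1 / 16"
    and x: "x = p + v + N v"
    and n: "norm n \<le> 1" "\<And>w. w \<in> span E \<Longrightarrow> inner w n = 0"
    and y: "\<And>w. w \<in> span E \<Longrightarrow> inner (y - p) w = 0"
  shows "inner (x - p) n \<le> \<kappa> / 2 * (norm (x - y))\<^sup>2 + 6 * L 2 * (8 * L 3 + 9 * (L 2)\<^sup>2) * norm v ^ 4"
proof -
  interpret tangent_chart M p E r N k L by (rule chart)
  \<comment> \<open>In C, the part \<open>8 b + 5 a\<^sup>2\<close> bounds the distance of the acceleration to G, and \<open>4 a\<^sup>2\<close> the inner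
    product of G with unit tangent vectors along the curve, each in units of \<open>\<rho>\<^sup>3\<close>.\<close>
  define a b \<rho> C where "a = L 2" and "b = L 3" and "\<rho> = norm v" and "C = 8 * b + 9 * a\<^sup>2"
  have pos: "0 < a" "0 < b" "0 \<le> \<rho>" "0 < C"
    using L2_pos L3_pos by (auto simp: a_def b_def \<rho>_def C_def add_pos_nonneg)
  have a\<rho>: "a * \<rho> \<le> 1 / 16" using v_small by (simp add: a_def \<rho>_def)
  have \<rho>_r0: "2 * \<rho> < r0" using a\<rho> pos(1) by (simp add: r0_def a_def[symmetric] field_simps)
  define P where "P = H 0 [v, v]"
  define G where "G = perp P"
  have P: "norm P \<le> a * \<rho>\<^sup>2"
    using d2N_bound[of 0 v v] v r0_pos by (simp add: P_def a_def \<rho>_def span_zero power2_eq_square)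
  have G: "norm G \<le> a * \<rho>\<^sup>2" using norm_perp_le[of P] P by (simp add: G_def)
  define u where "u = (1 / 2) *\<^sub>R proj E P"
  define w where "w = v + u"
  have u: "u \<in> span E" unfolding u_def by (intro span_scale proj_in_span)
  have w: "w \<in> span E" unfolding w_def using v u by (rule span_add)
  have u_le: "norm u \<le> a * \<rho>\<^sup>2 / 2" using norm_proj_le[OF onb, of P] P by (simp add: u_def)
  have "(a * \<rho>) * \<rho> \<le> 1 / 16 * \<rho>" using a\<rho> pos by (intro mult_right_mono) auto
  then have u_\<rho>: "norm u \<le> \<rho> / 32" using u_le by (simp add: power2_eq_square)
  have w_\<rho>: "norm w \<le> \<rho> + \<rho> / 32" unfolding w_def using norm_triangle_ineq[of v u] u_\<rho> by (simp add: \<rho>_def)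
  define z z' where "z s = s *\<^sub>R w - (s\<^sup>2) *\<^sub>R u" and "z' s = w - (2 * s) *\<^sub>R u" for s :: real
  \<comment> \<open>An open interval around [0, 1], so that derivatives at the end points are two-sided.\<close>
  let ?J = "{-1/4<..<5/4::real}"
  have zT: "z s \<in> span E" "z' s \<in> span E" for s unfolding z_def z'_def using u w by (auto intro: span_diff span_scale)
  have z_le: "norm (z s) \<le> 2 * \<rho>" and z'_le: "norm (z' s) \<le> 2 * \<rho>" if s: "s \<in> ?J" for s
  proof -
    have s1: "\<bar>s\<bar> \<le> 5 / 4" using s by auto
    then have s2: "s\<^sup>2 \<le> 2" using power_mono[of "\<bar>s\<bar>" "5 / 4" 2] by (simp add: power2_eq_square)
    have "norm (z s) \<le> \<bar>s\<bar> * norm w + s\<^sup>2 * norm u" unfolding z_def using norm_triangle_ineq4[of "s *\<^sub>R w" "s\<^sup>2 *\<^sub>R u"] by simp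
    also have "\<dots> \<le> 5 / 4 * (\<rho> + \<rho> / 32) + 2 * (\<rho> / 32)" using s1 s2 w_\<rho> u_\<rho> by (intro add_mono mult_mono) auto
    also have "\<dots> \<le> 2 * \<rho>" using pos by simp
    finally show "norm (z s) \<le> 2 * \<rho>" .
    have "norm (z' s) \<le> norm w + (2 * \<bar>s\<bar>) * norm u" unfolding z'_def using norm_triangle_ineq4[of w "(2 * s) *\<^sub>R u"] by (simp add: abs_mult)
    also have "\<dots> \<le> (\<rho> + \<rho> / 32) + 5 / 2 * (\<rho> / 32)" using s1 w_\<rho> u_\<rho> by (intro add_mono mult_mono) auto
    also have "\<dots> \<le> 2 * \<rho>" using pos by simp
    finally show "norm (z' s) \<le> 2 * \<rho>" .
  qed
  have z_r0: "norm (z s) < r0" if "s \<in> ?J" for s using z_le[OF that] \<rho>_r0 by simp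
  have zB: "z s \<in> B" if "s \<in> ?J" for s using in_B zT z_r0[OF that] by blast
  have dz: "(z has_vector_derivative z' s) (at s)" for s
    unfolding z_def[abs_def] z'_def by (auto intro!: derivative_eq_intros simp: power2_eq_square)
  define \<gamma> where "\<gamma> s = p + z s + H (z s) []" for s
  define \<gamma>' where "\<gamma>' s = z' s + (H (z s) [w] - (2 * s) *\<^sub>R H (z s) [u])" for s
  define \<gamma>'' where "\<gamma>'' s = - (2 *\<^sub>R u) + (H (z s) [z' s, z' s] - 2 *\<^sub>R H (z s) [u])" for s
  have \<gamma>_\<psi>: "\<gamma> s = \<psi> (z s)" for s by (simp add: \<gamma>_def \<psi>_def H_Nil)
  have \<gamma>'_eq: "\<gamma>' s = z' s + H (z s) [z' s]" if "s \<in> ?J" for s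
    using dN_linear[OF zB[OF that] w u, of "- (2 * s)"] by (simp add: \<gamma>'_def z'_def)
  have Hc: "((\<lambda>s. H (z s) us) has_vector_derivative H (z s) (z' s # us)) (at s)"
    if "set us \<subseteq> span E" "length us < k" "s \<in> ?J" for us s
    using that zT z_r0 by (intro H_curve dz) auto
  have d\<gamma>: "(\<gamma> has_vector_derivative \<gamma>' s) (at s)" if s: "s \<in> ?J" for s
  proof -
    have "((\<lambda>s. p + z s + H (z s) []) has_vector_derivative 0 + z' s + H (z s) [z' s]) (at s)"
      using s k by (intro has_vector_derivative_add has_vector_derivative_const dz Hc) auto
    then show ?thesis using \<gamma>'_eq[OF s] by (simp add: \<gamma>_def[abs_def])
  qed
  have d\<gamma>': "(\<gamma>' has_vector_derivative \<gamma>'' s) (at s)" if s: "s \<in> ?J" for s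
  proof -
    have 1: "(z' has_vector_derivative - (2 *\<^sub>R u)) (at s)"
      unfolding z'_def[abs_def] by (auto intro!: derivative_eq_intros)
    have 2: "((\<lambda>s. H (z s) [w]) has_vector_derivative H (z s) [z' s, w]) (at s)"
      using s k w by (intro Hc) auto
    have 3: "((\<lambda>s. H (z s) [u]) has_vector_derivative H (z s) [z' s, u]) (at s)"
      using s k u by (intro Hc) auto
    have 4: "((\<lambda>s. 2 * s) has_real_derivative 2) (at s)" by (auto intro!: derivative_eq_intros)
    have "(\<gamma>' has_vector_derivative - (2 *\<^sub>R u) + (H (z s) [z' s, w] - ((2 * s) *\<^sub>R H (z s) [z' s, u] + 2 *\<^sub>R H (z s) [u]))) (at s)"
      unfolding \<gamma>'_def[abs_def]
      by (intro has_vector_derivative_add has_vector_derivative_diff has_vector_derivative_scaleR 1 2 3 4)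
    moreover have eq: "H (z s) [z' s, z' s] = H (z s) [z' s, w] - (2 * s) *\<^sub>R H (z s) [z' s, u]"
      using d2N_linear_right[OF zB[OF s] zT(2)[of s] w u, of "- (2 * s)"] by (simp add: z'_def)
    have "- (2 *\<^sub>R u) + (H (z s) [z' s, w] - ((2 * s) *\<^sub>R H (z s) [z' s, u] + 2 *\<^sub>R H (z s) [u])) = \<gamma>'' s"
      unfolding \<gamma>''_def eq by (simp add: algebra_simps)
    ultimately show ?thesis by simp
  qed
  have err: "norm (\<gamma>'' s - G) \<le> (8 * b + 5 * a\<^sup>2) * \<rho> ^ 3" if s: "s \<in> {0..1}" for s
  proof -
    have sJ: "s \<in> ?J" using s by auto
    define e where "e = (1 - 2 * s) *\<^sub>R u"
    have eT: "e \<in> span E" unfolding e_def using u by (rule span_scale)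
    have "\<bar>1 - 2 * s\<bar> \<le> 1" using s by (auto simp: abs_if)
    then have "norm e \<le> 1 * norm u" unfolding e_def norm_scaleR by (intro mult_right_mono) auto
    then have e_le: "norm e \<le> a * \<rho>\<^sup>2 / 2" using u_le by simp
    have z'e: "z' s = v + 1 *\<^sub>R e" by (simp add: z'_def e_def w_def algebra_simps)
    have "- (2 *\<^sub>R u) + P = G" by (simp add: u_def G_def perp_def)
    then have eq: "\<gamma>'' s - G = (H (z s) [z' s, z' s] - H 0 [z' s, z' s]) + (H 0 [z' s, z' s] - P) - 2 *\<^sub>R H (z s) [u]"
      by (simp add: \<gamma>''_def algebra_simps)
    have 1: "norm (H (z s) [z' s, z' s] - H 0 [z' s, z' s]) \<le> 8 * b * \<rho> ^ 3"
    proof -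
      have "norm (H (z s) [z' s, z' s] - H 0 [z' s, z' s]) \<le> L 3 * norm (z s) * norm (z' s) * norm (z' s)"
        using zT z_r0[OF sJ] by (intro d2N_expand)
      also have "\<dots> \<le> L 3 * (2 * \<rho>) * (2 * \<rho>) * (2 * \<rho>)"
        using z_le[OF sJ] z'_le[OF sJ] L3_pos pos by (intro mult_mono) auto
      finally show ?thesis by (simp add: b_def power3_eq_cube)
    qed
    have 2: "norm (H 0 [z' s, z' s] - P) \<le> 3 / 2 * a\<^sup>2 * \<rho> ^ 3"
    proof -
      have "H 0 [z' s, z' s] = H 0 [v, z' s] + 1 *\<^sub>R H 0 [e, z' s]"
        using d2N_add_left[OF v eT zT(2)[of s], of 1] z'e by simp
      moreover have "H 0 [v, z' s] = P + 1 *\<^sub>R H 0 [v, e]"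
        using d2N_add_right[OF v eT v, of 1] z'e by (simp add: P_def)
      ultimately have "H 0 [z' s, z' s] - P = H 0 [v, e] + H 0 [e, z' s]" by simp
      also have "norm \<dots> \<le> a * \<rho> * norm e + a * norm e * (2 * \<rho>)"
      proof (intro order_trans[OF norm_triangle_ineq] add_mono)
        show "norm (H 0 [v, e]) \<le> a * \<rho> * norm e"
          using d2N_bound[of 0 v e] v eT r0_pos by (simp add: a_def \<rho>_def span_zero)
        have "norm (H 0 [e, z' s]) \<le> a * norm e * norm (z' s)"
          using d2N_bound[of 0 e "z' s"] zT eT r0_pos by (simp add: a_def span_zero)
        also have "\<dots> \<le> a * norm e * (2 * \<rho>)" using z'_le[OF sJ] pos by (intro mult_left_mono) auto
        finally show "norm (H 0 [e, z' s]) \<le> a * norm e * (2 * \<rho>)" .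
      qed
      also have "\<dots> = 3 * a * \<rho> * norm e" by simp
      also have "\<dots> \<le> 3 * a * \<rho> * (a * \<rho>\<^sup>2 / 2)" using e_le pos by (intro mult_left_mono) auto
      finally show ?thesis by (simp add: power2_eq_square power3_eq_cube mult_ac)
    qed
    have 3: "norm (2 *\<^sub>R H (z s) [u]) \<le> 2 * a\<^sup>2 * \<rho> ^ 3"
    proof -
      have "norm (H (z s) [u]) \<le> a * norm (z s) * norm u"
        using dN_bound[OF zT(1) z_r0[OF sJ] u] by (simp add: a_def)
      also have "\<dots> \<le> a * (2 * \<rho>) * (a * \<rho>\<^sup>2 / 2)" using z_le[OF sJ] u_le pos by (intro mult_mono) auto
      finally show ?thesis by (simp add: power2_eq_square power3_eq_cube mult_ac)
    qed
    have "norm (\<gamma>'' s - G) \<le> 8 * b * \<rho> ^ 3 + 3 / 2 * a\<^sup>2 * \<rho> ^ 3 + 2 * a\<^sup>2 * \<rho> ^ 3"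
      unfolding eq
      by (rule order_trans[OF norm_triangle_ineq4 add_mono[OF order_trans[OF norm_triangle_ineq add_mono[OF 1 2]] 3]])
    also have "\<dots> \<le> (8 * b + 5 * a\<^sup>2) * \<rho> ^ 3" using pos by (simp add: algebra_simps)
    finally show ?thesis .
  qed
  have err_C: "norm (\<gamma>'' s - G) \<le> C * \<rho> ^ 3" if "s \<in> {0..1}" for s
  proof -
    have "(8 * b + 5 * a\<^sup>2) * \<rho> ^ 3 \<le> C * \<rho> ^ 3" using pos by (intro mult_right_mono) (auto simp: C_def)
    then show ?thesis using err[OF that] by simp
  qed
  have tangent: "\<exists>h. norm h \<le> 4 * a * \<rho> * norm q \<and> q - h \<in> span E"
    if s: "s \<in> {0..1}" and q: "q \<in> tangent_space M (\<gamma> s)" for s q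
  proof -
    have sJ: "s \<in> ?J" using s by auto
    have "q \<in> (\<lambda>w. w + H (z s) [w]) ` span E"
      using q tangent_space_\<psi>[OF zT(1) z_r0[OF sJ]] by (simp add: \<gamma>_\<psi>)
    then obtain \<xi> where \<xi>: "\<xi> \<in> span E" "q = \<xi> + H (z s) [\<xi>]" by blast
    have \<xi>q: "norm \<xi> \<le> 2 * norm q" using norm_d\<psi>_ge[OF zT(1) z_r0[OF sJ] \<xi>(1)] norm_ge_zero[of \<xi>] unfolding \<xi>(2)[symmetric] by linarith
    have "norm (H (z s) [\<xi>]) \<le> a * norm (z s) * norm \<xi>" using dN_bound[OF zT(1) z_r0[OF sJ] \<xi>(1)] by (simp add: a_def)
    also have "\<dots> \<le> a * (2 * \<rho>) * (2 * norm q)" using z_le[OF sJ] \<xi>q pos by (intro mult_mono) auto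
    finally show ?thesis using \<xi> by (intro exI[of _ "H (z s) [\<xi>]"]) simp
  qed
  have almost_normal: "\<bar>inner q m\<bar> \<le> 4 * a * \<rho> * norm m * norm q"
    if s: "s \<in> {0..1}" and q: "q \<in> tangent_space M (\<gamma> s)" and m: "\<And>w. w \<in> span E \<Longrightarrow> inner w m = 0" for s q m
  proof -
    obtain h where h: "norm h \<le> 4 * a * \<rho> * norm q" "q - h \<in> span E" using tangent[OF s q] by blast
    have "inner q m = inner h m" using m[OF h(2)] by (simp add: inner_diff_left)
    also have "\<bar>\<dots>\<bar> \<le> norm h * norm m" by (rule Cauchy_Schwarz_ineq2)
    also have "\<dots> \<le> (4 * a * \<rho> * norm q) * norm m" using h(1) by (rule mult_right_mono) simp
    finally show ?thesis by (simp add: mult_ac)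
  qed
  have G_perp: "inner q G = 0" if "q \<in> span E" for q using inner_perp[OF that] by (simp add: G_def inner_commute)
  have tangential: "\<bar>inner q (\<gamma>'' s)\<bar> \<le> C * \<rho> ^ 3 * norm q" if s: "s \<in> {0..1}" and q: "q \<in> tangent_space M (\<gamma> s)" for s q
  proof -
    have "\<bar>inner q G\<bar> \<le> 4 * a * \<rho> * norm G * norm q" using almost_normal[OF s q G_perp] .
    also have "\<dots> \<le> 4 * a * \<rho> * (a * \<rho>\<^sup>2) * norm q" using G pos by (intro mult_right_mono mult_left_mono) auto
    finally have 1: "\<bar>inner q G\<bar> \<le> 4 * a\<^sup>2 * \<rho> ^ 3 * norm q" by (simp add: power2_eq_square power3_eq_cube mult_ac)
    have "\<bar>inner q (\<gamma>'' s - G)\<bar> \<le> norm q * norm (\<gamma>'' s - G)" by (rule Cauchy_Schwarz_ineq2)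
    also have "\<dots> \<le> norm q * ((8 * b + 5 * a\<^sup>2) * \<rho> ^ 3)" using err[OF s] by (intro mult_left_mono) auto
    finally have 2: "\<bar>inner q (\<gamma>'' s - G)\<bar> \<le> norm q * ((8 * b + 5 * a\<^sup>2) * \<rho> ^ 3)" .
    have "inner q (\<gamma>'' s) = inner q G + inner q (\<gamma>'' s - G)" by (simp add: inner_diff_right)
    then have "\<bar>inner q (\<gamma>'' s)\<bar> \<le> 4 * a\<^sup>2 * \<rho> ^ 3 * norm q + norm q * ((8 * b + 5 * a\<^sup>2) * \<rho> ^ 3)" using 1 2 by linarith
    also have "\<dots> = C * \<rho> ^ 3 * norm q" by (simp add: C_def algebra_simps)
    finally show ?thesis .
  qed
  have ev: "\<forall>\<^sub>F s in nhds t. s \<in> ?J" if "t \<in> {0..1}" for t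
    by (rule eventually_nhds_in_open) (use that in auto)
  have \<gamma>M: "\<forall>\<^sub>F s in nhds t. \<gamma> s \<in> M" if "t \<in> {0..1}" for t
    using ev[OF that] by (rule eventually_mono) (simp add: \<gamma>_\<psi> \<psi>_in_M zB)
  have d\<gamma>_ev: "\<forall>\<^sub>F s in nhds t. (\<gamma> has_vector_derivative \<gamma>' s) (at s)" if "t \<in> {0..1}" for t
    using ev[OF that] by (rule eventually_mono) (rule d\<gamma>)
  have \<gamma>'T: "\<gamma>' s \<in> tangent_space M (\<gamma> s)" if "s \<in> {0..1}" for s
    by (rule curve_velocity_in_tangent_space[OF d\<gamma> \<gamma>M[OF that]]) (use that in auto)
  have \<gamma>0: "\<gamma> 0 = p" "\<gamma>' 0 = w" and \<gamma>1: "\<gamma> 1 = x"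
    using H_0_single[OF w] H_0_single[OF u] by (auto simp: \<gamma>_\<psi> \<gamma>'_def z_def z'_def \<psi>_def N_0 x w_def)
  have \<gamma>'_le: "norm (\<gamma>' s) \<le> 3 * \<rho>" if s: "s \<in> {0..1}" for s
  proof -
    have sJ: "s \<in> ?J" using s by auto
    have "norm (H (z s) [z' s]) \<le> a * norm (z s) * norm (z' s)" using dN_bound[OF zT(1) z_r0[OF sJ] zT(2)] by (simp add: a_def)
    also have "\<dots> \<le> a * (2 * \<rho>) * (2 * \<rho>)" using z_le[OF sJ] z'_le[OF sJ] pos by (intro mult_mono) auto
    also have "\<dots> = 4 * (a * \<rho>) * \<rho>" by simp
    also have "\<dots> \<le> 4 * (1 / 16) * \<rho>" using a\<rho> pos by (intro mult_right_mono mult_left_mono) auto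
    finally show ?thesis using norm_triangle_ineq[of "z' s" "H (z s) [z' s]"] z'_le[OF sJ] \<gamma>'_eq[OF sJ] pos(3) by simp
  qed
  have speed: "(norm (\<gamma>' s))\<^sup>2 \<le> (norm w)\<^sup>2 + 6 * C * \<rho> ^ 4" if s: "s \<in> {0..1}" for s
  proof (cases "s = 0")
    case True
    then show ?thesis using \<gamma>0 pos by simp
  next
    case False
    let ?g = "\<lambda>s. inner (\<gamma>' s) (\<gamma>' s)"
    have dg: "(?g has_real_derivative 2 * inner (\<gamma>' t) (\<gamma>'' t)) (at t)" if "t \<in> ?J" for t
    proof -
      have "(\<gamma>' has_derivative (\<lambda>h. h *\<^sub>R \<gamma>'' t)) (at t)" using d\<gamma>'[OF that] by (simp add: has_vector_derivative_def)
      from has_derivative_inner[OF this this] show ?thesis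
        unfolding has_field_derivative_def by (rule has_derivative_eq_rhs) (auto simp: inner_commute algebra_simps)
    qed
    have "\<exists>t>0. t < s \<and> ?g s - ?g 0 = (s - 0) * (2 * inner (\<gamma>' t) (\<gamma>'' t))"
      by (rule MVT2) (use False s dg in auto)
    then obtain t where t: "0 < t" "t < s" "?g s - ?g 0 = s * (2 * inner (\<gamma>' t) (\<gamma>'' t))" by auto
    have tI: "t \<in> {0..1}" using t s by auto
    have "inner (\<gamma>' t) (\<gamma>'' t) \<le> C * \<rho> ^ 3 * norm (\<gamma>' t)" using tangential[OF tI \<gamma>'T[OF tI]] by linarith
    also have "\<dots> \<le> C * \<rho> ^ 3 * (3 * \<rho>)" using \<gamma>'_le[OF tI] pos by (intro mult_left_mono) auto
    finally have "2 * inner (\<gamma>' t) (\<gamma>'' t) \<le> 6 * C * \<rho> ^ 4" by (simp add: eval_nat_numeral mult_ac)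
    then have "s * (2 * inner (\<gamma>' t) (\<gamma>'' t)) \<le> 1 * (6 * C * \<rho> ^ 4)"
    proof -
      assume le: "2 * inner (\<gamma>' t) (\<gamma>'' t) \<le> 6 * C * \<rho> ^ 4"
      have "s * (2 * inner (\<gamma>' t) (\<gamma>'' t)) \<le> s * (6 * C * \<rho> ^ 4)" using le s by (intro mult_left_mono) auto
      also have "\<dots> \<le> 1 * (6 * C * \<rho> ^ 4)" using s pos by (intro mult_right_mono) auto
      finally show ?thesis .
    qed
    then show ?thesis using t(3) \<gamma>0 by (simp add: power2_norm_eq_inner)
  qed
  have acc: "inner (\<gamma>'' s) n \<le> \<kappa> * (norm w)\<^sup>2 + 10 * a * C * \<rho> ^ 4" if s: "s \<in> {0..1}" for s
  proof -
    have "\<exists>\<tau> \<nu>. \<gamma>'' s = \<tau> + \<nu> \<and> \<tau> \<in> tangent_space M (\<gamma> s) \<and> (\<forall>w\<in>tangent_space M (\<gamma> s). inner w \<nu> = 0) \<and>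
      norm \<nu> \<le> \<kappa> * (norm (\<gamma>' s))\<^sup>2"
      by (rule curve_acceleration[OF \<gamma>M[OF s] d\<gamma>_ev[OF s] d\<gamma>']) (use s in auto)
    then obtain \<tau> \<nu> where \<tau>: "\<gamma>'' s = \<tau> + \<nu>" "\<tau> \<in> tangent_space M (\<gamma> s)" "inner \<tau> \<nu> = 0"
      and \<nu>: "norm \<nu> \<le> \<kappa> * (norm (\<gamma>' s))\<^sup>2" by blast
    have \<tau>_le: "norm \<tau> \<le> C * \<rho> ^ 3"
    proof (cases "\<tau> = 0")
      case False
      have "inner \<tau> (\<gamma>'' s) = norm \<tau> * norm \<tau>" using \<tau> by (simp add: inner_add_right power2_norm_eq_inner[symmetric] power2_eq_square)
      then have "norm \<tau> * norm \<tau> \<le> C * \<rho> ^ 3 * norm \<tau>" using tangential[OF s \<tau>(2)] by simp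
      then show ?thesis using False by simp
    qed (use pos in simp)
    have "inner \<tau> n \<le> 4 * a * \<rho> * norm n * norm \<tau>" using almost_normal[OF s \<tau>(2) n(2)] by simp
    also have "\<dots> \<le> 4 * a * \<rho> * 1 * (C * \<rho> ^ 3)" using n(1) \<tau>_le pos by (intro mult_mono) auto
    finally have 1: "inner \<tau> n \<le> 4 * a * C * \<rho> ^ 4" by (simp add: eval_nat_numeral mult_ac)
    have "inner \<nu> n \<le> norm \<nu> * norm n" by (rule norm_cauchy_schwarz)
    also have "\<dots> \<le> norm \<nu> * 1" using n(1) by (intro mult_left_mono) auto
    also have "\<dots> \<le> \<kappa> * (norm (\<gamma>' s))\<^sup>2" using \<nu> by simp
    also have "\<dots> \<le> \<kappa> * ((norm w)\<^sup>2 + 6 * C * \<rho> ^ 4)" using speed[OF s] \<kappa>_nonneg by (intro mult_left_mono)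
    also have "\<dots> = \<kappa> * (norm w)\<^sup>2 + \<kappa> * (6 * C * \<rho> ^ 4)" by (simp add: algebra_simps)
    also have "\<dots> \<le> \<kappa> * (norm w)\<^sup>2 + a * (6 * C * \<rho> ^ 4)"
      using \<kappa>_le pos by (intro add_left_mono mult_right_mono) (auto simp: a_def)
    finally have 2: "inner \<nu> n \<le> \<kappa> * (norm w)\<^sup>2 + 6 * a * C * \<rho> ^ 4" by (simp add: mult_ac)
    show ?thesis unfolding \<tau>(1) inner_add_left using 1 2 by (simp add: algebra_simps)
  qed
  have inner_\<gamma>: "((\<lambda>s. inner (\<gamma> s - p) m) has_real_derivative inner (\<gamma>' s) m) (at s)"
    "((\<lambda>s. inner (\<gamma>' s) m) has_real_derivative inner (\<gamma>'' s) m) (at s)" if s: "0 \<le> s" "s \<le> 1" for s m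
  proof -
    have sJ: "s \<in> ?J" using s by auto
    have "((\<lambda>s. \<gamma> s - p) has_vector_derivative \<gamma>' s) (at s)"
      using has_vector_derivative_diff[OF d\<gamma>[OF sJ] has_vector_derivative_const[of p]] by simp
    then show "((\<lambda>s. inner (\<gamma> s - p) m) has_real_derivative inner (\<gamma>' s) m) (at s)"
      unfolding has_real_derivative_iff_has_vector_derivative
      by (rule bounded_linear.has_vector_derivative[OF bounded_linear_inner_left])
    show "((\<lambda>s. inner (\<gamma>' s) m) has_real_derivative inner (\<gamma>'' s) m) (at s)"
      unfolding has_real_derivative_iff_has_vector_derivative
      by (rule bounded_linear.has_vector_derivative[OF bounded_linear_inner_left d\<gamma>'[OF sJ]])
  qed
  have "inner (\<gamma> 1 - p) n \<le> inner (\<gamma> 0 - p) n + inner (\<gamma>' 0) n + (\<kappa> * (norm w)\<^sup>2 + 10 * a * C * \<rho> ^ 4) / 2"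
    by (rule second_order_upper_bound[OF inner_\<gamma> acc]) auto
  then have height: "inner (x - p) n \<le> \<kappa> / 2 * (norm w)\<^sup>2 + 5 * a * C * \<rho> ^ 4"
    using n(2)[OF w] by (simp add: \<gamma>0 \<gamma>1 add_divide_distrib mult_ac)
  \<comment> \<open>A lower bound for the component of the chord in direction w, which bounds the initial speed by
    \<open>|x - y|\<close>.\<close>
  have "inner (\<gamma> 1 - p) (- w) \<le> inner (\<gamma> 0 - p) (- w) + inner (\<gamma>' 0) (- w) + (2 * C * \<rho> ^ 4) / 2"
  proof (rule second_order_upper_bound[OF inner_\<gamma>])
    fix s :: real assume s: "0 \<le> s" "s \<le> 1"
    have "inner (\<gamma>'' s) (- w) = - inner w (\<gamma>'' s - G)" using G_perp[OF w] by (simp add: inner_diff_right inner_commute)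
    also have "\<dots> \<le> norm w * norm (\<gamma>'' s - G)" using Cauchy_Schwarz_ineq2[of w "\<gamma>'' s - G"] by linarith
    also have "\<dots> \<le> (2 * \<rho>) * (C * \<rho> ^ 3)" using w_\<rho> pos err_C[of s] s by (intro mult_mono) auto
    finally show "inner (\<gamma>'' s) (- w) \<le> 2 * C * \<rho> ^ 4" by (simp add: eval_nat_numeral mult_ac)
  qed auto
  then have "(norm w)\<^sup>2 \<le> inner (x - p) w + C * \<rho> ^ 4"
    by (simp add: \<gamma>0 \<gamma>1 power2_norm_eq_inner)
  also have "inner (x - p) w = inner (x - y) w" using y[OF w] by (simp add: inner_diff_left)
  also have "\<dots> \<le> ((norm (x - y))\<^sup>2 + (norm w)\<^sup>2) / 2"
  proof -
    have "0 \<le> (norm (x - y) - norm w)\<^sup>2" by simp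
    then show ?thesis using norm_cauchy_schwarz[of "x - y" w] by (simp add: power2_diff)
  qed
  finally have "(norm w)\<^sup>2 \<le> (norm (x - y))\<^sup>2 + 2 * C * \<rho> ^ 4" by (simp add: field_simps)
  then have "\<kappa> / 2 * (norm w)\<^sup>2 \<le> \<kappa> / 2 * ((norm (x - y))\<^sup>2 + 2 * C * \<rho> ^ 4)" using \<kappa>_nonneg by (intro mult_left_mono) auto
  also have "\<dots> = \<kappa> / 2 * (norm (x - y))\<^sup>2 + \<kappa> * (C * \<rho> ^ 4)" by (simp add: algebra_simps)
  also have "\<dots> \<le> \<kappa> / 2 * (norm (x - y))\<^sup>2 + a * (C * \<rho> ^ 4)"
    using \<kappa>_le pos by (intro add_left_mono mult_right_mono) (auto simp: a_def)
  finally have "inner (x - p) n \<le> \<kappa> / 2 * (norm (x - y))\<^sup>2 + 6 * a * C * \<rho> ^ 4" using height by simp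
  then show ?thesis by (simp add: a_def b_def C_def \<rho>_def)
qed

section \<open>Distance from convex hulls and midpoints to the manifold\<close>

text \<open>For x in \<open>\<sigma>\<close> the condition \<open>|x - c| \<le> t\<close> bounds \<open>|x - y|\<^sup>2\<close> by an affine function of x. Inserted
  into the osculating bound it confines \<open>\<sigma>\<close> to a half-space, which therefore contains y; at y the
  quadratic terms have disappeared. The factor \<open>8 ^ 4\<close> comes from \<open>|x - p| \<le> 4 t\<close> and from the factor
  2 in \<open>nearby_points_in_chart\<close>.\<close>

lemma infdist_convex_hull_le:
  assumes \<sigma>: "\<sigma> \<subseteq> M" "\<sigma> \<subseteq> cball c t" and y: "y \<in> convex hull \<sigma>"
    and t: "4 * t < R" "L 2 * t < 1 / 128"
  shows "infdist y M \<le> \<kappa> / 2 * t\<^sup>2 + 6 * L 2 * (8 * L 3 + 9 * (L 2)\<^sup>2) * 8 ^ 4 * t ^ 4"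
proof -
  have L23: "0 < L 2" "0 < L 3" using L_positive k_ge by auto
  define K where "K = 6 * L 2 * (8 * L 3 + 9 * (L 2)\<^sup>2)"
  have K: "0 \<le> K" using L23 by (simp add: K_def)
  obtain p where p: "p \<in> M" "\<forall>m\<in>M. dist y p \<le> dist y m"
    using continuous_attains_inf[OF compact_M M_nonempty continuous_on_dist[OF continuous_on_const[of _ y] continuous_on_id]] ..
  obtain E r N where chart: "tangent_chart M p E r N k L" using charts[OF p(1)] by blast
  have T: "tangent_space M p = span E" by (rule tangent_chart.tangent_space_p[OF chart])
  have orth: "inner (y - p) w = 0" if "w \<in> span E" for w
    by (rule nearest_point_orthogonal[of M]) (use p that T in auto)
  define n where "n = sgn (y - p)"
  have n_le: "norm n \<le> 1" by (simp add: n_def norm_sgn)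
  have n_orth: "inner w n = 0" if "w \<in> span E" for w
    using orth[OF that] by (simp add: n_def sgn_div_norm inner_commute)
  have n_y: "inner (y - p) n = norm (y - p)"
    by (cases "y = p") (simp_all add: n_def sgn_div_norm dot_square_norm power2_eq_square)
  have "convex hull \<sigma> \<subseteq> cball c t" using \<sigma>(2) by (rule hull_minimal) (rule convex_cball)
  then have yc: "y \<in> cball c t" using y by blast
  define b where "b = \<kappa> / 2 * t\<^sup>2 + K * (8 * t) ^ 4"
  have "\<sigma> \<subseteq> {x. inner (n + \<kappa> *\<^sub>R (y - c)) x \<le> inner p n + \<kappa> * inner y (y - c) + b}"
  proof
    fix x assume x: "x \<in> \<sigma>"
    then have xM: "x \<in> M" and xc: "norm (x - c) \<le> t" using \<sigma> by (auto simp: dist_norm norm_minus_commute)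
    have xy: "norm (x - y) \<le> 2 * t"
      using xc yc norm_triangle_ineq4[of "x - c" "y - c"] by (simp add: dist_norm norm_minus_commute)
    have "norm (y - p) \<le> norm (x - y)" using p(2) xM by (simp add: dist_norm norm_minus_commute)
    then have xp: "norm (x - p) \<le> 4 * t" using xy norm_triangle_ineq[of "x - y" "y - p"] by simp
    have "L 2 * norm (x - p) \<le> L 2 * (4 * t)" using xp L23 by (intro mult_left_mono) auto
    then have "\<exists>v\<in>span E. L 2 * norm v < 1 / 4 \<and> norm v \<le> 2 * norm (x - p) \<and> x = p + v + N v"
      using xp t by (intro nearby_points_in_chart[OF chart xM]) auto
    then obtain v where v: "v \<in> span E" "norm v \<le> 2 * norm (x - p)" "x = p + v + N v" by blast
    have v8: "norm v \<le> 8 * t" using v(2) xp by simp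
    have "L 2 * norm v \<le> L 2 * (8 * t)" using v8 L23 by (intro mult_left_mono) auto
    then have "inner (x - p) n \<le> \<kappa> / 2 * (norm (x - y))\<^sup>2 + K * norm v ^ 4"
      unfolding K_def using t by (intro osculating_bound[OF chart v(1) _ v(3) n_le n_orth orth]) auto
    also have "\<dots> \<le> \<kappa> / 2 * (t\<^sup>2 - 2 * inner (x - y) (y - c)) + K * (8 * t) ^ 4"
    proof (intro add_mono mult_left_mono power_mono v8 K)
      have "(norm (x - c))\<^sup>2 \<le> t\<^sup>2" using xc by (intro power_mono) auto
      moreover have "(norm (x - c))\<^sup>2 = (norm (x - y))\<^sup>2 + 2 * inner (x - y) (y - c) + (norm (y - c))\<^sup>2"
        by (simp add: power2_norm_eq_inner inner_simps inner_commute algebra_simps)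
      ultimately show "(norm (x - y))\<^sup>2 \<le> t\<^sup>2 - 2 * inner (x - y) (y - c)" using zero_le_power2[of "norm (y - c)"] by linarith
    qed (use \<kappa>_nonneg in auto)
    also have "\<dots> = b - \<kappa> * inner (x - y) (y - c)" by (simp add: b_def algebra_simps)
    finally show "x \<in> {x. inner (n + \<kappa> *\<^sub>R (y - c)) x \<le> inner p n + \<kappa> * inner y (y - c) + b}"
      by (simp add: inner_simps inner_commute algebra_simps)
  qed
  then have "convex hull \<sigma> \<subseteq> {x. inner (n + \<kappa> *\<^sub>R (y - c)) x \<le> inner p n + \<kappa> * inner y (y - c) + b}"
    by (rule hull_minimal) (rule convex_halfspace_le)
  with y have "inner (n + \<kappa> *\<^sub>R (y - c)) y \<le> inner p n + \<kappa> * inner y (y - c) + b" by blast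
  then have "inner (y - p) n \<le> b" by (simp add: inner_simps inner_commute algebra_simps)
  then have "norm (y - p) \<le> b" using n_y by simp
  moreover have "infdist y M \<le> norm (y - p)" using infdist_le[OF p(1), of y] by (simp add: dist_norm)
  ultimately show ?thesis by (simp add: b_def K_def power_mult_distrib mult_ac)
qed

text \<open>The error \<open>\<delta>\<close> of the even part of \<open>N\<close> is left open, since its order depends on k.\<close>

lemma infdist_midpoint_ge:
  assumes \<mu>: "0 \<le> \<mu>" "\<mu> < \<kappa>" and t: "0 \<le> t" "t < R" "L 2 * t < 1 / 128" "L 3 * t\<^sup>2 \<le> 6"
    and even: "\<And>p E r N z. tangent_chart M p E r N k L \<Longrightarrow> z \<in> span E \<Longrightarrow> norm z \<le> t \<Longrightarrow>
      norm (N z + N (- z) - tangent_chart.H E r N 0 [z, z]) \<le> 2 * \<delta>"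
  shows "\<exists>x\<in>M. \<exists>x'\<in>M. dist x x' \<le> 2 * t \<and>
    \<mu> / 2 * t\<^sup>2 - (L 2 * L 3 / 6 + 2 * L 2 ^ 3) * t ^ 4 - \<delta> \<le> infdist (midpoint x x') M"
proof -
  obtain p where p: "p \<in> M" "\<mu> < second_fundamental_norm M p"
    using \<mu>(2) unfolding \<kappa>_def by (subst (asm) less_cSUP_iff[OF M_nonempty bdd_second_fundamental_norm]) blast
  obtain E r N where chart_p: "tangent_chart M p E r N k L" using charts[OF p(1)] by blast
  interpret tangent_chart M p E r N k L by (rule chart_p)
  define a b where "a = L 2" and "b = L 3"
  have pos: "0 < a" "0 < b" using L2_pos L3_pos by (auto simp: a_def b_def)
  obtain u where u: "u \<in> span E" "norm u = 1" "\<mu> < norm (perp (H 0 [u, u]))"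
    using second_fundamental_norm_diagonal[of \<mu>] \<mu>(1) p(2) by (meson not_le)
  define Q where "Q = perp (H 0 [u, u])"
  \<comment> \<open>The correction makes room for the odd part of N, so that the two points have distance at most
    2 t.\<close>
  define s where "s = t - b * t ^ 3 / 6"
  have s_t: "s \<le> t" using t pos by (simp add: s_def)
  have "t * (b * t\<^sup>2) \<le> t * 6" using t by (intro mult_left_mono) (auto simp: b_def)
  then have s0: "0 \<le> s" by (simp add: s_def power2_eq_square power3_eq_cube mult_ac)
  have t_r0: "t < r0" using t(3) pos by (simp add: r0_def a_def[symmetric] field_simps)
  define z where "z = s *\<^sub>R u"
  have z: "z \<in> span E" "- z \<in> span E" and nz: "norm z = s" using u s0 by (auto simp: z_def span_scale span_neg)
  have z_r0: "norm z < r0" "norm (- z) < r0" using nz s_t t_r0 by auto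
  have zM: "\<psi> z \<in> M" "\<psi> (- z) \<in> M" using \<psi>_in_M[OF in_B[OF z(1) z_r0(1)]] \<psi>_in_M[OF in_B[OF z(2) z_r0(2)]] by auto
  have "s\<^sup>2 \<le> t\<^sup>2" "s ^ 3 \<le> t ^ 3" "s ^ 4 \<le> t ^ 4" using s0 s_t by (auto intro: power_mono)
  note sp = this
  have dist: "dist (\<psi> z) (\<psi> (- z)) \<le> 2 * t"
  proof -
    have "\<psi> z - \<psi> (- z) = 2 *\<^sub>R z + ((N z - H 0 [z, z] /\<^sub>R 2) - (N (- z) - H 0 [- z, - z] /\<^sub>R 2))"
      using d2N_uminus[OF z(1)] by (simp add: \<psi>_def scaleR_2)
    also have "norm \<dots> \<le> 2 * s + (L 3 * norm z ^ 3 / 6 + L 3 * norm (- z) ^ 3 / 6)"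
      by (rule order_trans[OF norm_triangle_ineq add_mono[OF _ order_trans[OF norm_triangle_ineq4 add_mono[OF N_expand N_expand]]]])
        (use z z_r0 nz in auto)
    also have "\<dots> = 2 * s + b * s ^ 3 / 3" by (simp add: nz b_def)
    also have "\<dots> \<le> 2 * s + b * t ^ 3 / 3" using sp pos by (simp add: divide_right_mono)
    also have "\<dots> = 2 * t" by (simp add: s_def)
    finally show ?thesis by (simp add: dist_norm)
  qed
  define y where "y = midpoint (\<psi> z) (\<psi> (- z))"
  have yp: "y - p = (N z + N (- z)) /\<^sub>R 2"
  proof -
    have "\<psi> z + \<psi> (- z) = 2 *\<^sub>R p + (N z + N (- z))" by (simp add: \<psi>_def scaleR_2)
    then show ?thesis by (simp add: y_def midpoint_def scaleR_right_distrib)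
  qed
  have yp_le: "norm (y - p) \<le> a * s\<^sup>2 / 2"
    using norm_triangle_ineq[of "N z" "N (- z)"] N_bound[OF z(1) z_r0(1)] N_bound[OF z(2) z_r0(2)]
    by (simp add: yp nz a_def)
  define n where "n = sgn Q"
  have n_le: "norm n \<le> 1" by (simp add: n_def norm_sgn)
  have n_orth: "inner w n = 0" if "w \<in> span E" for w
    using inner_perp[OF that] by (simp add: n_def Q_def sgn_div_norm inner_commute)
  have le_n: "inner x n \<le> norm x" for x
    using norm_cauchy_schwarz[of x n] mult_left_mono[OF n_le, of "norm x"] by simp
  have Qn: "inner (H 0 [u, u]) n = norm Q"
  proof -
    have "inner (H 0 [u, u] - Q) n = 0" using n_orth diff_perp_in_span by (simp add: Q_def)
    moreover have "inner Q n = norm Q"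
      by (cases "Q = 0") (simp_all add: n_def sgn_div_norm dot_square_norm power2_eq_square)
    ultimately show ?thesis by (simp add: inner_diff_left)
  qed
  have H_z: "H 0 [z, z] = s\<^sup>2 *\<^sub>R H 0 [u, u]"
    using d2N_add_left[of 0 u z s] d2N_add_left[of 0 0 z 1] d2N_add_right[of 0 u u s] d2N_add_right[of 0 0 u 1] u z
    by (simp add: span_zero z_def power2_eq_square)
  define LB where "LB = \<mu> / 2 * t\<^sup>2 - (a * b / 6 + 2 * a ^ 3) * t ^ 4 - \<delta>"
  have height: "LB + 2 * a ^ 3 * t ^ 4 \<le> inner (y - p) n"
  proof -
    have "norm (N z + N (- z) - H 0 [z, z]) \<le> 2 * \<delta>"
      using even[OF chart_p z(1)] nz s_t by simp
    then have "- (2 * \<delta>) \<le> inner (N z + N (- z) - H 0 [z, z]) n"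
      using le_n[of "- (N z + N (- z) - H 0 [z, z])"] unfolding norm_minus_cancel inner_minus_left by linarith
    then have 1: "s\<^sup>2 * norm Q / 2 - \<delta> \<le> inner (y - p) n"
      by (simp add: yp H_z Qn inner_diff_left)
    have "t\<^sup>2 - b * t ^ 4 / 3 \<le> s\<^sup>2"
    proof -
      have "s\<^sup>2 = t\<^sup>2 - b * t ^ 4 / 3 + (b * t ^ 3 / 6)\<^sup>2"
        by (simp add: s_def power2_eq_square eval_nat_numeral field_simps)
      then show ?thesis by simp
    qed
    then have "(t\<^sup>2 - b * t ^ 4 / 3) * \<mu> \<le> s\<^sup>2 * \<mu>" using \<mu>(1) by (rule mult_right_mono)
    also have "\<dots> \<le> s\<^sup>2 * norm Q" using u(3) by (intro mult_left_mono) (auto simp: Q_def)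
    finally have 2: "(t\<^sup>2 - b * t ^ 4 / 3) * \<mu> \<le> s\<^sup>2 * norm Q" .
    have "\<mu> * (b * t ^ 4) \<le> a * (b * t ^ 4)"
      using \<mu>(2) \<kappa>_le pos t(1) by (intro mult_right_mono) (auto simp: a_def)
    then have "LB + 2 * a ^ 3 * t ^ 4 \<le> (t\<^sup>2 - b * t ^ 4 / 3) * \<mu> / 2 - \<delta>"
      by (simp add: LB_def algebra_simps)
    also have "\<dots> \<le> s\<^sup>2 * norm Q / 2 - \<delta>" using 2 by (intro diff_right_mono divide_right_mono) auto
    also have "\<dots> \<le> inner (y - p) n" by (rule 1)
    finally show ?thesis .
  qed
  \<comment> \<open>Points of M that are closer to y than p have parameters of size O(t^2), hence height O(t^4).\<close>
  have "LB \<le> dist y m" if m: "m \<in> M" for m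
  proof (cases "dist y m < norm (y - p)")
    case False
    have "0 \<le> 2 * a ^ 3 * t ^ 4" using pos t by simp
    then show ?thesis using False height le_n[of "y - p"] by linarith
  next
    case True
    have "norm (m - p) \<le> norm (m - y) + norm (y - p)" using norm_triangle_ineq[of "m - y" "y - p"] by simp
    then have mp: "norm (m - p) \<le> a * s\<^sup>2" using True yp_le by (simp add: dist_norm norm_minus_commute)
    have "a * s\<^sup>2 \<le> a * t\<^sup>2" using sp pos by (intro mult_left_mono) auto
    also have "\<dots> = (a * t) * t" by (simp add: power2_eq_square)
    also have "\<dots> \<le> (1 / 128) * t" using t by (intro mult_right_mono) (auto simp: a_def)
    finally have mt: "norm (m - p) \<le> t / 128" using mp by simp
    have "a * norm (m - p) \<le> a * (t / 128)" using mt pos by (intro mult_left_mono) auto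
    then have "L 2 * norm (m - p) < 1 / 32" using t(3) by (simp add: a_def)
    moreover have "norm (m - p) < R" using mt t by simp
    ultimately obtain v where v: "v \<in> span E" "L 2 * norm v < 1 / 4" "norm v \<le> 2 * norm (m - p)" "m = p + v + N v"
      using nearby_points_in_chart[OF chart_p m] by blast
    have v_r0: "norm v < r0" using v(2) L2_pos by (simp add: r0_def field_simps)
    have v_s: "norm v \<le> 2 * a * s\<^sup>2" using v(3) mp by simp
    have "inner (m - p) n = inner (N v) n" using v(4) n_orth[OF v(1)] by (simp add: inner_add_left)
    also have "\<dots> \<le> norm (N v)" by (rule le_n)
    also have "\<dots> \<le> a * (norm v)\<^sup>2 / 2" using N_bound[OF v(1) v_r0] by (simp add: a_def)
    also have "\<dots> \<le> a * (2 * a * s\<^sup>2)\<^sup>2 / 2" using v_s pos by (intro divide_right_mono mult_left_mono power_mono) auto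
    also have "\<dots> = 2 * a ^ 3 * s ^ 4" by (simp add: power2_eq_square eval_nat_numeral)
    also have "\<dots> \<le> 2 * a ^ 3 * t ^ 4" using sp pos by (intro mult_left_mono) auto
    finally have "LB \<le> inner (y - p) n - inner (m - p) n" using height by simp
    also have "\<dots> = inner (y - m) n" by (simp add: inner_diff_left)
    also have "\<dots> \<le> dist y m" using le_n by (simp add: dist_norm)
    finally show ?thesis .
  qed
  then have "LB \<le> infdist y M"
    unfolding infdist_notempty[OF M_nonempty] by (intro cINF_greatest M_nonempty)
  then show ?thesis using zM dist unfolding y_def LB_def a_def b_def by blast
qed

end

section \<open>The convexity defect on the class of manifolds\<close>

lemma subspace_Rspace: "subspace (Rspace D)"
  unfolding subspace_def
proof (intro conjI ballI allI)
  show "0 \<in> Rspace D" by (simp add: Rspace_def)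
  fix x y :: "nat \<Rightarrow>\<^sub>0 real" and c :: real
  assume x: "x \<in> Rspace D"
  have "Poly_Mapping.keys (c *\<^sub>R x) \<subseteq> Poly_Mapping.keys x" by (auto simp: in_keys_iff scaleR_poly_mapping.rep_eq)
  then show "c *\<^sub>R x \<in> Rspace D" using x by (auto simp: Rspace_def)
  assume "y \<in> Rspace D"
  then show "x + y \<in> Rspace D" using x Poly_Mapping.keys_add[of x y] unfolding Rspace_def by blast
qed

lemma Rspace_eq_span: "Rspace D = span ((\<lambda>i. Poly_Mapping.single i 1) ` {..<D})"
proof
  show "span ((\<lambda>i. Poly_Mapping.single i 1) ` {..<D}) \<subseteq> Rspace D"
    by (rule span_minimal) (auto simp: subspace_Rspace, auto simp: Rspace_def)
  show "Rspace D \<subseteq> span ((\<lambda>i. Poly_Mapping.single i 1) ` {..<D})"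
  proof
    fix x assume x: "x \<in> Rspace D"
    have "x = (\<Sum>i<D. Poly_Mapping.lookup x i *\<^sub>R Poly_Mapping.single i 1)"
    proof (rule poly_mapping_eqI)
      fix j
      have "Poly_Mapping.lookup (\<Sum>i<D. Poly_Mapping.lookup x i *\<^sub>R Poly_Mapping.single i 1) j
        = (\<Sum>i<D. if i = j then Poly_Mapping.lookup x i else 0)"
        unfolding lookup_sum by (intro sum.cong) (auto simp: scaleR_poly_mapping.rep_eq lookup_single when_def)
      also have "\<dots> = Poly_Mapping.lookup x j"
        using x by (auto simp: Rspace_def in_keys_iff)
      finally show "Poly_Mapping.lookup x j = Poly_Mapping.lookup (\<Sum>i<D. Poly_Mapping.lookup x i *\<^sub>R Poly_Mapping.single i 1) j" ..
    qed
    also have "\<dots> \<in> span ((\<lambda>i. Poly_Mapping.single i 1) ` {..<D})"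
      by (intro span_sum span_scale span_base) auto
    finally show "x \<in> span ((\<lambda>i. Poly_Mapping.single i 1) ` {..<D})" .
  qed
qed

text \<open>The tangent charts of the class presuppose that the tangent space is a finite-dimensional
  subspace; this follows from the parametrizations over \<open>Rspace d\<close>.\<close>

lemma submanifold_tangent_space:
  assumes M: "submanifold k d D M" "0 < k" and p: "p \<in> M"
  shows "\<exists>E. orthonormal_basis E \<and> tangent_space M p = span E"
proof -
  let ?F = "(\<lambda>i. Poly_Mapping.single i (1::real)) ` {..<d}"
  obtain S \<phi> where S: "openin (top_of_set (Rspace d)) S" "p \<in> \<phi> ` S" "local_parametrization M S \<phi>"
    "Ck_on k (Rspace d) S \<phi>" "\<forall>x\<in>S. inj_on (frechet_derivative \<phi> (at x within S)) (Rspace d)"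
    using M(1) p unfolding submanifold_def by blast
  obtain x where x: "x \<in> S" "p = \<phi> x" using S(2) by blast
  let ?A = "frechet_derivative \<phi> (at x within S)"
  obtain j where "k = Suc j" using M(2) by (cases k) auto
  then have "\<phi> differentiable (at x within S)" using S(4) x(1) by simp
  then have A: "(\<phi> has_derivative ?A) (at x within S)" by (simp add: frechet_derivative_works)
  have "tangent_space M p = ?A ` Rspace d"
    unfolding x(2) using S x by (intro tangent_space_local_parametrization[OF _ Rspace_eq_span _ _ _ A]) auto
  also have "\<dots> = span (?A ` ?F)"
    unfolding Rspace_eq_span using linear_span_image[OF has_derivative_linear[OF A]] by simp
  finally show ?thesis using orthonormal_basis_exists[of "?A ` ?F"] by (metis finite_imageI finite_lessThan)
qed

lemma manifold_class_tangent_chart: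
  assumes M: "M \<in> manifold_class k d D Rmin Lperp L" and k: "3 \<le> k" and p: "p \<in> M"
    and L: "0 < Lperp" "\<And>i. 3 \<le> i \<Longrightarrow> i \<le> k \<Longrightarrow> 0 < L i"
  shows "\<exists>E r N. tangent_chart M p E r N k (L(2 := Lperp))"
proof -
  have "submanifold k d D M" using M by (simp add: manifold_class_def)
  then obtain E where E: "orthonormal_basis E" "tangent_space M p = span E"
    using submanifold_tangent_space[OF _ _ p] k by (metis gr0I not_numeral_le_zero)
  have "\<exists>r N. 1 / (4 * Lperp) \<le> r \<and>
        (let T = tangent_space M p; B = T \<inter> ball 0 r in
          local_parametrization M B (\<lambda>v. p + v + N v) \<and>
          N ` B \<subseteq> Rspace D \<and> Ck_on k T B N \<and>
          N 0 = 0 \<and> (N has_derivative (\<lambda>u. 0)) (at 0 within B) \<and>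
          (\<forall>v\<in>B. norm v \<le> 1 / (4 * Lperp) \<longrightarrow>
             multilinear_norm T 2 (higher_differential B N v) \<le> Lperp \<and>
             (\<forall>i\<in>{3..k}. multilinear_norm T i (higher_differential B N v) \<le> L i)))"
    using M p unfolding manifold_class_def by blast
  then obtain r N where r: "1 / (4 * Lperp) \<le> r"
    and lp: "local_parametrization M (span E \<inter> ball 0 r) (\<lambda>v. p + v + N v)"
    and N: "Ck_on k (span E) (span E \<inter> ball 0 r) N" "N 0 = 0" "(N has_derivative (\<lambda>u. 0)) (at 0 within span E \<inter> ball 0 r)"
    and b2: "\<forall>v\<in>span E \<inter> ball 0 r. norm v \<le> 1 / (4 * Lperp) \<longrightarrow>
             multilinear_norm (span E) 2 (higher_differential (span E \<inter> ball 0 r) N v) \<le> Lperp \<and>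
             (\<forall>i\<in>{3..k}. multilinear_norm (span E) i (higher_differential (span E \<inter> ball 0 r) N v) \<le> L i)"
    unfolding Let_def E(2) by (elim exE conjE) rule
  have "tangent_chart M p E r N k (L(2 := Lperp))"
  proof
    show "0 < (L(2 := Lperp)) i" if "i \<in> {2..k}" for i
      using that L by (cases "i = 2") auto
    show "multilinear_norm (span E) i (higher_differential (span E \<inter> ball 0 r) N v) \<le> (L(2 := Lperp)) i"
      if "v \<in> span E \<inter> ball 0 r" "norm v \<le> 1 / (4 * (L(2 := Lperp)) 2)" "i \<in> {2..k}" for v i
    proof (cases "i = 2")
      case True
      then show ?thesis using b2 that by simp
    next
      case False
      then have "i \<in> {3..k}" using that(3) by auto
      then show ?thesis using b2 that(1,2) False by simp
    qed
  qed (use E r lp N k in auto)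
  then show ?thesis by blast
qed

lemma reach_unique_nearest:
  assumes "ereal R \<le> reach D M" "x \<in> Rspace D" "infdist x M < R"
  shows "\<exists>!p. p \<in> M \<and> (\<forall>q\<in>M. dist x p \<le> dist x q)"
proof -
  have "ereal (infdist x M) < reach D M" using assms(1,3) by (metis ereal_less(2) less_ereal.simps(1) order_less_le_trans)
  then obtain \<delta> where "\<forall>x\<in>Rspace D. infdist x M < \<delta> \<longrightarrow> (\<exists>!p. p \<in> M \<and> (\<forall>q\<in>M. dist x p \<le> dist x q))" "infdist x M < \<delta>"
    unfolding reach_def less_SUP_iff by auto
  then show ?thesis using assms(2) by blast
qed

lemma manifold_class_reach_manifold:
  assumes M: "M \<in> manifold_class k d D Rmin Lperp L" and k: "3 \<le> k"
    and L: "0 < Lperp" "\<And>i. 3 \<le> i \<Longrightarrow> i \<le> k \<Longrightarrow> 0 < L i" and R: "0 < Rmin"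
  shows "reach_manifold M (Rspace D) k (L(2 := Lperp)) Rmin"
proof
  show "compact M" "M \<noteq> {}" "M \<subseteq> Rspace D"
    using M by (auto simp: manifold_class_def submanifold_def)
  show "\<exists>E r N. tangent_chart M q E r N k (L(2 := Lperp))" if "q \<in> M" for q
    by (rule manifold_class_tangent_chart[OF M k that L])
  have reach: "ereal Rmin \<le> reach D M" using M by (simp add: manifold_class_def)
  show "\<exists>!p. p \<in> M \<and> (\<forall>q\<in>M. dist x p \<le> dist x q)" if "x \<in> Rspace D" "infdist x M < Rmin" for x
    by (rule reach_unique_nearest[OF reach that])
qed (use subspace_Rspace R in auto)

lemma (in reach_manifold) square_over_local_reach:
  "ereal (t\<^sup>2) / (2 * local_reach M) = ereal (\<kappa> / 2 * t\<^sup>2)"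
proof (cases "\<kappa> = 0")
  case True
  have "1 / ereal (second_fundamental_norm M p) = \<infinity>" if "p \<in> M" for p
  proof -
    have "second_fundamental_norm M p = 0"
      using second_fundamental_norm_nonneg_at[OF that] second_fundamental_norm_le_\<kappa>[OF that] True by simp
    then show ?thesis by (simp add: divide_ereal_def)
  qed
  then have "local_reach M = \<infinity>" using M_nonempty by (simp add: local_reach_def)
  then show ?thesis using True by simp
next
  case False
  then have \<kappa>: "0 < \<kappa>" using \<kappa>_nonneg by simp
  have inv: "1 / ereal c = ereal (1 / c)" if "0 < c" for c :: real
    using that by (simp add: divide_ereal_def one_ereal_def divide_inverse)
  have "local_reach M = ereal (1 / \<kappa>)"
  proof (rule antisym)
    show "ereal (1 / \<kappa>) \<le> local_reach M"
      unfolding local_reach_def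
    proof (rule INF_greatest)
      fix p assume p: "p \<in> M"
      show "ereal (1 / \<kappa>) \<le> 1 / ereal (second_fundamental_norm M p)"
      proof (cases "second_fundamental_norm M p = 0")
        case True
        then show ?thesis by (simp add: divide_ereal_def)
      next
        case False
        then have pos: "0 < second_fundamental_norm M p" using second_fundamental_norm_nonneg_at[OF p] by simp
        then show ?thesis unfolding inv[OF pos] using second_fundamental_norm_le_\<kappa>[OF p] by (simp add: frac_le)
      qed
    qed
    show "local_reach M \<le> ereal (1 / \<kappa>)"
    proof (rule ccontr)
      assume "\<not> local_reach M \<le> ereal (1 / \<kappa>)"
      then have "ereal (1 / \<kappa>) < local_reach M" by simp
      from ereal_dense2[OF this] obtain c where c: "ereal (1 / \<kappa>) < ereal c" "ereal c < local_reach M" by blast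
      have c\<kappa>: "1 / \<kappa> < c" using c(1) by simp
      moreover have "0 < 1 / \<kappa>" using \<kappa> by simp
      ultimately have c0: "0 < c" by linarith
      have "1 / c < \<kappa>" using c\<kappa> c0 \<kappa> by (simp add: field_simps)
      then obtain p where p: "p \<in> M" "1 / c < second_fundamental_norm M p"
        unfolding \<kappa>_def by (subst (asm) less_cSUP_iff[OF M_nonempty bdd_second_fundamental_norm]) blast
      have "0 < 1 / c" using c0 by simp
      then have pos: "0 < second_fundamental_norm M p" using p(2) by linarith
      have "local_reach M \<le> 1 / ereal (second_fundamental_norm M p)" unfolding local_reach_def by (rule INF_lower[OF p(1)])
      also have "\<dots> = ereal (1 / second_fundamental_norm M p)" by (rule inv[OF pos])
      also have "\<dots> \<le> ereal c" using p(2) pos c0 by (simp add: field_simps)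
      finally show False using c(2) by simp
    qed
  qed
  then show ?thesis using \<kappa> by simp
qed

lemma Rad_pair_le:
  assumes "x \<in> Rspace D" "x' \<in> Rspace D"
  shows "Rad D {x, x'} \<le> dist x x' / 2"
  unfolding Rad_def
proof (rule cInf_lower)
  have "midpoint x x' \<in> Rspace D"
    unfolding midpoint_def using assms subspace_Rspace by (intro subspace_scale subspace_add) auto
  moreover have "{x, x'} \<subseteq> cball (midpoint x x') (dist x x' / 2)" by (simp add: dist_midpoint)
  ultimately show "dist x x' / 2 \<in> {r. 0 \<le> r \<and> (\<exists>c\<in>Rspace D. {x, x'} \<subseteq> cball c r)}"
    by (intro CollectI conjI bexI[of _ "midpoint x x'"]) auto
qed (auto simp: bdd_below_def)

lemma Rad_enclosing_ball:
  assumes "compact \<sigma>" "Rad D \<sigma> < t"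
  shows "\<exists>c\<in>Rspace D. \<exists>r. 0 \<le> r \<and> r < t \<and> \<sigma> \<subseteq> cball c r"
proof -
  let ?S = "{r. 0 \<le> r \<and> (\<exists>c\<in>Rspace D. \<sigma> \<subseteq> cball c r)}"
  obtain b where b: "0 < b" "\<forall>x\<in>\<sigma>. norm x \<le> b"
    using compact_imp_bounded[OF assms(1)] unfolding bounded_pos by blast
  have "0 \<in> Rspace D" using subspace_0[OF subspace_Rspace] .
  moreover have "\<sigma> \<subseteq> cball 0 b" using b(2) by auto
  ultimately have "b \<in> ?S" using b(1) by auto
  then have "?S \<noteq> {}" by blast
  from cInf_lessD[OF this assms(2)[unfolded Rad_def]]
  obtain r where "r \<in> ?S" "r < t" by blast
  then show ?thesis by blast
qed

text \<open>An enclosing ball of radius exactly \<open>Rad D \<sigma>\<close> and a direction of maximal curvature need not be at hand,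
  so both bounds are first proved up to e and then passed to the limit.\<close>

lemma convexity_defect_expansion:
  assumes "reach_manifold M (Rspace D) k L R"
    and t: "0 \<le> t" "t \<le> R / 16" "L 2 * t \<le> 1 / 512" "L 3 * t\<^sup>2 \<le> 6"
    and even: "\<And>p E r N z. tangent_chart M p E r N k L \<Longrightarrow> z \<in> span E \<Longrightarrow> norm z \<le> t \<Longrightarrow>
      norm (N z + N (- z) - tangent_chart.H E r N 0 [z, z]) \<le> 2 * \<delta>" and \<delta>: "0 \<le> \<delta>"
  shows "\<bar>ereal (convexity_defect D M t) - ereal (t ^ 2) / (2 * local_reach M)\<bar>
    \<le> ereal ((6 * L 2 * (8 * L 3 + 9 * (L 2)\<^sup>2) * 8 ^ 4 + L 2 * L 3 / 6 + 2 * L 2 ^ 3) * t ^ 4 + \<delta>)"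
proof -
  interpret reach_manifold M "Rspace D" k L R by fact
  have L23: "0 < L 2" "0 < L 3" using L_positive k_ge by auto
  define K where "K = 6 * L 2 * (8 * L 3 + 9 * (L 2)\<^sup>2) * 8 ^ 4"
  define K' where "K' = L 2 * L 3 / 6 + 2 * L 2 ^ 3"
  have K: "0 \<le> K" "0 \<le> K'" using L23 by (auto simp: K_def K'_def)
  have upper: "infdist y M \<le> \<kappa> / 2 * t\<^sup>2 + K * t ^ 4" if y: "y \<in> Hull D M t" for y
  proof -
    obtain \<sigma> where \<sigma>: "\<sigma> \<subseteq> M" "compact \<sigma>" "Rad D \<sigma> \<le> t" "y \<in> convex hull \<sigma>"
      using y unfolding Hull_def by blast
    define e0 where "e0 = min (R / 16) (1 / (512 * L 2))"
    have e0: "0 < e0" using R_pos L23 by (simp add: e0_def)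
    have bound: "infdist y M \<le> \<kappa> / 2 * (t + e)\<^sup>2 + K * (t + e) ^ 4" if e: "0 < e" "e < e0" for e
    proof -
      have "Rad D \<sigma> < t + e" using \<sigma>(3) e by simp
      from Rad_enclosing_ball[OF \<sigma>(2) this]
      obtain c r where r: "0 \<le> r" "r < t + e" "\<sigma> \<subseteq> cball c r" by blast
      have e1: "e < R / 16" "e < 1 / (512 * L 2)" using e by (auto simp: e0_def)
      have "L 2 * e < L 2 * (1 / (512 * L 2))" using e1 L23 by (intro mult_strict_left_mono) auto
      also have "\<dots> = 1 / 512" using L23 by simp
      finally have "L 2 * e < 1 / 512" .
      moreover have "L 2 * r \<le> L 2 * t + L 2 * e" using mult_left_mono[of r "t + e" "L 2"] r L23 by (simp add: distrib_left)
      ultimately have "L 2 * r < 1 / 128" using t(3) by linarith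
      moreover have "4 * r < R" using r e1 t R_pos by linarith
      ultimately have "infdist y M \<le> \<kappa> / 2 * r\<^sup>2 + K * r ^ 4"
        unfolding K_def by (intro infdist_convex_hull_le[OF \<sigma>(1) r(3) \<sigma>(4)])
      also have "\<dots> \<le> \<kappa> / 2 * (t + e)\<^sup>2 + K * (t + e) ^ 4"
        using r K \<kappa>_nonneg by (intro add_mono mult_left_mono power_mono) auto
      finally show ?thesis .
    qed
    have "((\<lambda>e. \<kappa> / 2 * (t + e)\<^sup>2 + K * (t + e) ^ 4) \<longlongrightarrow> \<kappa> / 2 * (t + 0)\<^sup>2 + K * (t + 0) ^ 4) (at_right 0)"
      by (intro tendsto_intros)
    moreover have "\<forall>\<^sub>F e in at_right 0. infdist y M \<le> \<kappa> / 2 * (t + e)\<^sup>2 + K * (t + e) ^ 4"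
      using eventually_at_right[OF e0] bound e0 by (auto simp: eventually_at_right_field)
    ultimately have "infdist y M \<le> \<kappa> / 2 * (t + 0)\<^sup>2 + K * (t + 0) ^ 4"
      by (rule tendsto_lowerbound) simp
    then show ?thesis by simp
  qed
  have pair: "midpoint x x' \<in> Hull D M t" if "x \<in> M" "x' \<in> M" "dist x x' \<le> 2 * t" for x x'
  proof -
    have "x \<in> Rspace D" "x' \<in> Rspace D" using that M_sub by auto
    then have "Rad D {x, x'} \<le> t" using Rad_pair_le[of x D x'] that(3) by linarith
    moreover have "midpoint x x' \<in> convex hull {x, x'}" using midpoint_in_closed_segment segment_convex_hull by metis
    ultimately show ?thesis unfolding Hull_def using that by (intro UN_I[of "{x, x'}"]) auto
  qed
  have bdd: "bdd_above ((\<lambda>y. infdist y M) ` Hull D M t)" using upper by (auto simp: bdd_above_def)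
  obtain q where q: "q \<in> M" using M_nonempty by blast
  have q_hull: "q \<in> Hull D M t" using pair[OF q q] t(1) by simp
  have defect_ge: "infdist y M \<le> convexity_defect D M t" if "y \<in> Hull D M t" for y
    unfolding convexity_defect_def by (rule cSUP_upper[OF that bdd])
  have 1: "convexity_defect D M t \<le> \<kappa> / 2 * t\<^sup>2 + K * t ^ 4"
    unfolding convexity_defect_def using q_hull upper by (intro cSUP_least) auto
  have 2: "\<kappa> / 2 * t\<^sup>2 - K' * t ^ 4 - \<delta> \<le> convexity_defect D M t"
  proof (cases "\<kappa> = 0")
    case True
    have "0 \<le> convexity_defect D M t" using defect_ge[OF q_hull] infdist_nonneg[of q M] by linarith
    moreover have "0 \<le> K' * t ^ 4" using K t by simp
    ultimately show ?thesis using True \<delta> by simp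
  next
    case False
    then have \<kappa>: "0 < \<kappa>" using \<kappa>_nonneg by simp
    have bound: "(\<kappa> - e) / 2 * t\<^sup>2 - K' * t ^ 4 - \<delta> \<le> convexity_defect D M t" if e: "0 < e" "e < \<kappa>" for e
    proof -
      have "\<exists>x\<in>M. \<exists>x'\<in>M. dist x x' \<le> 2 * t \<and> (\<kappa> - e) / 2 * t\<^sup>2 - K' * t ^ 4 - \<delta> \<le> infdist (midpoint x x') M"
        unfolding K'_def using e t R_pos even by (intro infdist_midpoint_ge) auto
      then obtain x x' where x: "x \<in> M" "x' \<in> M" "dist x x' \<le> 2 * t"
        and le: "(\<kappa> - e) / 2 * t\<^sup>2 - K' * t ^ 4 - \<delta> \<le> infdist (midpoint x x') M" by blast
      from le defect_ge[OF pair[OF x]] show ?thesis by (rule order_trans)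
    qed
    have "((\<lambda>e. (\<kappa> - e) / 2 * t\<^sup>2 - K' * t ^ 4 - \<delta>) \<longlongrightarrow> (\<kappa> - 0) / 2 * t\<^sup>2 - K' * t ^ 4 - \<delta>) (at_right 0)"
      by (intro tendsto_intros) auto
    moreover have "\<forall>\<^sub>F e in at_right 0. (\<kappa> - e) / 2 * t\<^sup>2 - K' * t ^ 4 - \<delta> \<le> convexity_defect D M t"
      using bound \<kappa> by (auto simp: eventually_at_right_field)
    ultimately have "(\<kappa> - 0) / 2 * t\<^sup>2 - K' * t ^ 4 - \<delta> \<le> convexity_defect D M t"
      by (rule tendsto_upperbound) simp
    then show ?thesis by simp
  qed
  have "0 \<le> K * t ^ 4" "0 \<le> K' * t ^ 4" using K t by auto
  then have "\<bar>convexity_defect D M t - \<kappa> / 2 * t\<^sup>2\<bar> \<le> (K + K') * t ^ 4 + \<delta>"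
    using 1 2 \<delta> unfolding distrib_right by linarith
  then show ?thesis unfolding square_over_local_reach by (simp add: K_def K'_def add.assoc)
qed

theorem proposition4p3:
  fixes d k :: nat and Rmin Lperp :: real and L :: "nat \<Rightarrow> real"
  assumes "1 \<le> d" and "0 < Rmin" and "0 < Lperp" and "\<And>i. 3 \<le> i \<Longrightarrow> i \<le> k \<Longrightarrow> 0 < L i"
  shows "(4 \<le> k \<longrightarrow>
           (\<exists>C t0. 0 < t0 \<and>
             (\<forall>D>d. \<forall>M\<in>manifold_class k d D Rmin Lperp L. \<forall>t. 0 \<le> t \<and> t \<le> t0 \<longrightarrow>
               \<bar>ereal (convexity_defect D M t) - ereal (t ^ 2) / (2 * local_reach M)\<bar>
                 \<le> ereal (C * t ^ 4)))) \<and>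
         (k = 3 \<longrightarrow>
           (\<exists>C' t0. 0 < t0 \<and>
             (\<forall>D>d. \<forall>M\<in>manifold_class k d D Rmin Lperp L. \<forall>t. 0 \<le> t \<and> t \<le> t0 \<longrightarrow>
               \<bar>ereal (convexity_defect D M t) - ereal (t ^ 2) / (2 * local_reach M)\<bar>
                 \<le> ereal (C' * t ^ 3))))"
proof -
  let ?L = "L(2 := Lperp)"
  define K where "K = 6 * ?L 2 * (8 * ?L 3 + 9 * (?L 2)\<^sup>2) * 8 ^ 4 + ?L 2 * ?L 3 / 6 + 2 * ?L 2 ^ 3"
  \<comment> \<open>The first two entries keep the relevant points within the reach and in the charts, the last
    two make the correction of s in the lower bound admissible. The last one also turns fourth into
    third powers.\<close>
  define t0 where "t0 = Min {Rmin / 16, 1 / (512 * Lperp), 1 / (1 + L 3), 1}"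
  show ?thesis
  proof (cases "3 \<le> k")
    case False
    then show ?thesis by auto
  next
    case k: True
    have L3: "0 < L 3" using assms(4) k by simp
    have K: "0 \<le> K" using assms(3) L3 by (simp add: K_def)
    have t0: "0 < t0" using assms L3 by (simp add: t0_def)
    have ts: "t \<le> Rmin / 16" "?L 2 * t \<le> 1 / 512" "?L 3 * t\<^sup>2 \<le> 6" "t \<le> 1" "t < 1 / (4 * ?L 2)"
      if t: "0 \<le> t" "t \<le> t0" for t
    proof -
      have le: "t \<le> Rmin / 16" "t \<le> 1 / (512 * Lperp)" "t \<le> 1 / (1 + L 3)" "t \<le> 1"
        using t(2) by (auto simp: t0_def)
      show "t \<le> Rmin / 16" "t \<le> 1" by fact+
      have "Lperp * t \<le> Lperp * (1 / (512 * Lperp))" using le assms(3) by (intro mult_left_mono) auto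
      then show "?L 2 * t \<le> 1 / 512" using assms(3) by simp
      have "t < 1 / (4 * Lperp)" using le(2) assms(3) by (simp add: field_simps)
      then show "t < 1 / (4 * ?L 2)" by simp
      have "L 3 * t \<le> (1 + L 3) * (1 / (1 + L 3))" using le(3) L3 t(1) by (intro mult_mono) auto
      then have "L 3 * t \<le> 1" using L3 by simp
      then have "(L 3 * t) * t \<le> 1 * 1" using le(4) t(1) by (intro mult_mono) auto
      then show "?L 3 * t\<^sup>2 \<le> 6" by (simp add: power2_eq_square)
    qed
    have main: "\<bar>ereal (convexity_defect D M t) - ereal (t ^ 2) / (2 * local_reach M)\<bar> \<le> ereal (K * t ^ 4 + \<delta>)"
      if M: "M \<in> manifold_class k d D Rmin Lperp L" and t: "0 \<le> t" "t \<le> t0" and \<delta>: "0 \<le> \<delta>"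
        and even: "\<And>p E r N z. tangent_chart M p E r N k ?L \<Longrightarrow> z \<in> span E \<Longrightarrow> norm z \<le> t \<Longrightarrow>
          norm (N z + N (- z) - tangent_chart.H E r N 0 [z, z]) \<le> 2 * \<delta>" for M D t \<delta>
      unfolding K_def
      by (rule convexity_defect_expansion[OF manifold_class_reach_manifold[OF M k assms(3,4,2)] t(1) ts(1,2,3)[OF t] even \<delta>])
    have small: "norm z < tangent_chart.r0 ?L" if "tangent_chart M p E r N k ?L" "norm z \<le> t" "0 \<le> t" "t \<le> t0"
      for M :: "(nat \<Rightarrow>\<^sub>0 real) set" and p E r N z t
      using ts(5)[of t] that by (simp add: tangent_chart.r0_def[OF that(1)])
    have "\<exists>C t0. 0 < t0 \<and> (\<forall>D>d. \<forall>M\<in>manifold_class k d D Rmin Lperp L. \<forall>t. 0 \<le> t \<and> t \<le> t0 \<longrightarrow>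
       \<bar>ereal (convexity_defect D M t) - ereal (t ^ 2) / (2 * local_reach M)\<bar> \<le> ereal (C * t ^ 4))" if k4: "4 \<le> k"
    proof (rule exI[of _ "K + L 4 / 24"], rule exI[of _ t0], intro conjI t0 allI impI ballI)
      fix D M t assume M: "M \<in> manifold_class k d D Rmin Lperp L" and t: "0 \<le> t \<and> t \<le> t0"
      have L4: "0 < L 4" using assms(4) k4 by simp
      have "\<bar>ereal (convexity_defect D M t) - ereal (t ^ 2) / (2 * local_reach M)\<bar> \<le> ereal (K * t ^ 4 + L 4 * t ^ 4 / 24)"
      proof (rule main[OF M])
        fix p E r N z assume c: "tangent_chart M p E r N k ?L" and z: "z \<in> span E" "norm z \<le> t"
        have "norm (N z + N (- z) - tangent_chart.H E r N 0 [z, z]) \<le> ?L 4 * norm z ^ 4 / 12"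
          using small[OF c z(2)] t by (intro tangent_chart.even_part_of_N_C4[OF c z(1) _ k4]) auto
        also have "\<dots> \<le> L 4 * t ^ 4 / 12" using L4 z by (auto intro!: mult_left_mono power_mono)
        finally show "norm (N z + N (- z) - tangent_chart.H E r N 0 [z, z]) \<le> 2 * (L 4 * t ^ 4 / 24)" by simp
      qed (use t L4 in auto)
      then show "\<bar>ereal (convexity_defect D M t) - ereal (t ^ 2) / (2 * local_reach M)\<bar> \<le> ereal ((K + L 4 / 24) * t ^ 4)"
        by (simp add: algebra_simps)
    qed
    moreover have "\<exists>C t0. 0 < t0 \<and> (\<forall>D>d. \<forall>M\<in>manifold_class k d D Rmin Lperp L. \<forall>t. 0 \<le> t \<and> t \<le> t0 \<longrightarrow>
       \<bar>ereal (convexity_defect D M t) - ereal (t ^ 2) / (2 * local_reach M)\<bar> \<le> ereal (C * t ^ 3))"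
    proof (rule exI[of _ "K + L 3 / 6"], rule exI[of _ t0], intro conjI t0 allI impI ballI)
      fix D M t assume M: "M \<in> manifold_class k d D Rmin Lperp L" and t: "0 \<le> t \<and> t \<le> t0"
      have "\<bar>ereal (convexity_defect D M t) - ereal (t ^ 2) / (2 * local_reach M)\<bar> \<le> ereal (K * t ^ 4 + L 3 * t ^ 3 / 6)"
      proof (rule main[OF M])
        fix p E r N z assume c: "tangent_chart M p E r N k ?L" and z: "z \<in> span E" "norm z \<le> t"
        have "norm (N z + N (- z) - tangent_chart.H E r N 0 [z, z]) \<le> ?L 3 * norm z ^ 3 / 3"
          using small[OF c z(2)] t by (intro tangent_chart.even_part_of_N_C3[OF c z(1)]) auto
        also have "\<dots> \<le> L 3 * t ^ 3 / 3" using L3 z by (auto intro!: mult_left_mono power_mono)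
        finally show "norm (N z + N (- z) - tangent_chart.H E r N 0 [z, z]) \<le> 2 * (L 3 * t ^ 3 / 6)" by simp
      qed (use t L3 in auto)
      also have "K * t ^ 4 + L 3 * t ^ 3 / 6 \<le> (K + L 3 / 6) * t ^ 3"
      proof -
        have "t ^ 4 \<le> t ^ 3" using t ts(4)[of t] by (intro power_decreasing) auto
        then have "K * t ^ 4 \<le> K * t ^ 3" using K by (intro mult_left_mono)
        then show ?thesis by (simp add: algebra_simps)
      qed
      finally show "\<bar>ereal (convexity_defect D M t) - ereal (t ^ 2) / (2 * local_reach M)\<bar> \<le> ereal ((K + L 3 / 6) * t ^ 3)"
        by simp
    qed
    ultimately show ?thesis by blast
  qed
qed

end
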